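(* Let $\nu,\eta>0$ satisfy $\frac{|\nu-\eta|}{\nu+\eta}\le\frac18$ and let $(u_0,B_0)\in H^3(\mathbb{R}^3)$ with $\operatorname{div}u_0=\operatorname{div}B_0=0$. Let $(u,B)\in C([0,T^* );H^3(\mathbb{R}^3))$ be the solution of the Hall MHD system (with $h=1$, see context) with initial data $(u_0,B_0)$, where $T^*\in(0,\infty]$ is its maximal existence time, and let $\omega=\nabla\times u$, $\omega_0=\nabla\times u_0$. If $(u_0,B_0)$ satisfies $$C_0=\left(\|B_0+\omega_0\|_{L^2}^2+C\mathcal{E}_0\frac{(\nu-\eta)^2}{(\nu+\eta)^2}\right)\exp\left(\frac{C(\mathcal{E}_0+\mathcal{E}_0^2)}{(\nu+\eta)^4}\right)<1,$$ then $$\sup_{t\in[0,T^* )}\|(B+\omega)(t)\|_{L^2}^2+\frac{\nu+\eta}{2}\int_0^{T^*}\|\nabla(B+\omega)(t)\|_{L^2}^2\,dt\le C_0.$$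
   Context: The Hall MHD system (Hall constant $h=1$) on $\mathbb{R}^3$ for the velocity $u$, magnetic field $B$ (both $\mathbb{R}^3$-valued) and pressure $p$ is $$\partial_t u-\nu\Delta u+u\cdot\nabla u-(\nabla\times B)\times B+\nabla p=0,$$ $$\partial_t B-\eta\Delta B+u\cdot\nabla B-B\cdot\nabla u+\nabla\times((\nabla\times B)\times B)=0,$$ $$\operatorname{div}u=0,\quad \operatorname{div}B=0,$$ where $\nu>0$ is the viscosity and $\eta>0$ the resistivity. It is locally well-posed in $H^3(\mathbb{R}^3)$. Set $\mathcal{E}_0=\|u_0\|_{L^2}^2+\|B_0\|_{L^2}^2$. $C$ denotes generic positive absolute constants (independent of $\nu,\eta$ and the data) that may vary from one occurrence to another; the definition of $C_0$ is with suitable such constants, and $C_0$ is the same quantity in the hypothesis and in the conclusion.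
   Formalization: The bound is proved for the supremum over t<T* of the sum of the squared norm at t and (ν+η)/2 times the integral over [0,t]; with the supremum and the full integral added separately it is false (ν=η, B_0=0, small u_0). *)

theory Defs
  imports "HOL-Analysis.Analysis"
begin

section \<open>Lebesgue and Sobolev spaces on three-dimensional space\<close>

text \<open>
  Elements of the function spaces are represented by Borel functions; all conditions below
  are invariant under changes on null sets.
\<close>

definition L2 :: "(real^3 \<Rightarrow> 'b::euclidean_space) \<Rightarrow> bool" where
  "L2 f \<longleftrightarrow> f \<in> borel_measurable lborel \<and> integrable lborel (\<lambda>x. (norm (f x))\<^sup>2)"

definition L2_norm :: "(real^3 \<Rightarrow> 'b::euclidean_space) \<Rightarrow> real" where
  "L2_norm f = sqrt (\<integral>x. (norm (f x))\<^sup>2 \<partial>lborel)"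

definition L1_loc :: "(real^3 \<Rightarrow> 'b::euclidean_space) \<Rightarrow> bool" where
  "L1_loc f \<longleftrightarrow> f \<in> borel_measurable lborel \<and> (\<forall>K. compact K \<longrightarrow> set_integrable lborel K f)"

definition pderiv_at :: "3 \<Rightarrow> (real^3 \<Rightarrow> real) \<Rightarrow> real^3 \<Rightarrow> real" where
  "pderiv_at i \<phi> x = frechet_derivative \<phi> (at x) (axis i 1)"

primrec Ck :: "nat \<Rightarrow> (real^3 \<Rightarrow> real) \<Rightarrow> bool" where
  "Ck 0 \<phi> \<longleftrightarrow> continuous_on UNIV \<phi>"
| "Ck (Suc k) \<phi> \<longleftrightarrow> (\<forall>x. \<phi> differentiable (at x)) \<and> (\<forall>i. Ck k (pderiv_at i \<phi>))"

definition test_function :: "(real^3 \<Rightarrow> real) \<Rightarrow> bool" where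
  "test_function \<phi> \<longleftrightarrow> (\<forall>k. Ck k \<phi>) \<and> compact (closure {x. \<phi> x \<noteq> 0})"

definition has_weak_pderiv ::
    "3 \<Rightarrow> (real^3 \<Rightarrow> 'b::euclidean_space) \<Rightarrow> (real^3 \<Rightarrow> 'b) \<Rightarrow> bool" where
  "has_weak_pderiv i f g \<longleftrightarrow> L1_loc f \<and> L1_loc g \<and>
     (\<forall>\<phi>. test_function \<phi> \<longrightarrow>
        (\<integral>x. pderiv_at i \<phi> x *\<^sub>R f x \<partial>lborel) = - (\<integral>x. \<phi> x *\<^sub>R g x \<partial>lborel))"

text \<open>
  A weak derivative is unique only up to null sets; \<open>wpderiv\<close> picks a representative, and it
  is meaningful only for functions that possess a weak derivative.
\<close>

definition wpderiv :: "3 \<Rightarrow> (real^3 \<Rightarrow> 'b::euclidean_space) \<Rightarrow> real^3 \<Rightarrow> 'b" where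
  "wpderiv i f = (SOME g. has_weak_pderiv i f g)"

primrec Hk :: "nat \<Rightarrow> (real^3 \<Rightarrow> 'b::euclidean_space) \<Rightarrow> bool" where
  "Hk 0 f \<longleftrightarrow> L2 f"
| "Hk (Suc k) f \<longleftrightarrow> L2 f \<and> (\<forall>i. \<exists>g. has_weak_pderiv i f g \<and> Hk k g)"

text \<open>
  The square of an \<open>H\<^sup>k\<close> norm. A derivative \<open>\<partial>\<^sup>\<alpha>f\<close> is counted once for each order in which
  its partial derivatives can be taken, which gives a norm equivalent to the usual one.
\<close>

primrec Hk_norm_sq :: "nat \<Rightarrow> (real^3 \<Rightarrow> 'b::euclidean_space) \<Rightarrow> real" where
  "Hk_norm_sq 0 f = (L2_norm f)\<^sup>2"
| "Hk_norm_sq (Suc k) f = (L2_norm f)\<^sup>2 + (\<Sum>i\<in>UNIV. Hk_norm_sq k (wpderiv i f))"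

definition Hk_norm :: "nat \<Rightarrow> (real^3 \<Rightarrow> 'b::euclidean_space) \<Rightarrow> real" where
  "Hk_norm k f = sqrt (Hk_norm_sq k f)"


section \<open>Vector calculus with weak derivatives\<close>

definition divergence :: "(real^3 \<Rightarrow> real^3) \<Rightarrow> real^3 \<Rightarrow> real" where
  "divergence v x = (\<Sum>i\<in>UNIV. wpderiv i v x $ i)"

definition curl :: "(real^3 \<Rightarrow> real^3) \<Rightarrow> real^3 \<Rightarrow> real^3" where
  "curl v x = vector
     [wpderiv 2 v x $ 3 - wpderiv 3 v x $ 2,
      wpderiv 3 v x $ 1 - wpderiv 1 v x $ 3,
      wpderiv 1 v x $ 2 - wpderiv 2 v x $ 1]"

definition laplacian :: "(real^3 \<Rightarrow> real^3) \<Rightarrow> real^3 \<Rightarrow> real^3" where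
  "laplacian v x = (\<Sum>i\<in>UNIV. wpderiv i (wpderiv i v) x)"

definition gradient :: "(real^3 \<Rightarrow> real) \<Rightarrow> real^3 \<Rightarrow> real^3" where
  "gradient p x = (\<chi> i. wpderiv i p x)"

text \<open>\<open>advect v w\<close> is \<open>v \<cdot> \<nabla>w\<close>.\<close>

definition advect :: "(real^3 \<Rightarrow> real^3) \<Rightarrow> (real^3 \<Rightarrow> real^3) \<Rightarrow> real^3 \<Rightarrow> real^3" where
  "advect v w x = (\<Sum>i\<in>UNIV. (v x $ i) *\<^sub>R wpderiv i w x)"

definition grad_L2_norm :: "(real^3 \<Rightarrow> real^3) \<Rightarrow> real" where
  "grad_L2_norm v = sqrt (\<Sum>i\<in>UNIV. (L2_norm (wpderiv i v))\<^sup>2)"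


section \<open>The Hall MHD system\<close>

definition time_interval :: "ereal \<Rightarrow> real set" where
  "time_interval T = {t. 0 \<le> t \<and> ereal t < T}"

definition continuous_into_Hk ::
    "nat \<Rightarrow> ereal \<Rightarrow> (real \<Rightarrow> real^3 \<Rightarrow> real^3) \<Rightarrow> bool" where
  "continuous_into_Hk k T v \<longleftrightarrow>
     (\<forall>t\<in>time_interval T. Hk k (v t) \<and>
        ((\<lambda>s. Hk_norm k (\<lambda>x. v s x - v t x)) \<longlongrightarrow> 0) (at t within time_interval T))"

definition has_L2_time_deriv ::
    "(real \<Rightarrow> real^3 \<Rightarrow> real^3) \<Rightarrow> (real^3 \<Rightarrow> real^3) \<Rightarrow> real \<Rightarrow> bool" where
  "has_L2_time_deriv v v' t \<longleftrightarrow> L2 v' \<and>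
     ((\<lambda>s. L2_norm (\<lambda>x. (v s x - v t x) /\<^sub>R (s - t) - v' x)) \<longlongrightarrow> 0) (at t)"

text \<open>
  Solutions in \<open>C([0,T); H\<^sup>3)\<close> with Hall constant 1. All terms of the equations without time
  derivative or pressure then belong to \<open>C([0,T); H\<^sup>1)\<close>, so the equations hold as identities
  in \<open>L\<^sup>2\<close>, with the time derivative taken in \<open>L\<^sup>2\<close>. The pressure is a function whose weak
  gradient exists.
\<close>

definition hall_mhd_solution ::
    "real \<Rightarrow> real \<Rightarrow> (real^3 \<Rightarrow> real^3) \<Rightarrow> (real^3 \<Rightarrow> real^3) \<Rightarrow> ereal \<Rightarrow>
     (real \<Rightarrow> real^3 \<Rightarrow> real^3) \<Rightarrow> (real \<Rightarrow> real^3 \<Rightarrow> real^3) \<Rightarrow> bool" where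
  "hall_mhd_solution \<nu> \<eta> u\<^sub>0 B\<^sub>0 T u B \<longleftrightarrow>
     0 < T \<and>
     continuous_into_Hk 3 T u \<and> continuous_into_Hk 3 T B \<and>
     (AE x in lborel. u 0 x = u\<^sub>0 x) \<and> (AE x in lborel. B 0 x = B\<^sub>0 x) \<and>
     (\<forall>t\<in>time_interval T.
        (AE x in lborel. divergence (u t) x = 0) \<and>
        (AE x in lborel. divergence (B t) x = 0)) \<and>
     (\<exists>p :: real \<Rightarrow> real^3 \<Rightarrow> real. \<forall>t\<in>time_interval T - {0}.
        (\<forall>i. \<exists>g. has_weak_pderiv i (p t) g) \<and>
        (\<exists>u' B'.
           has_L2_time_deriv u u' t \<and> has_L2_time_deriv B B' t \<and>
           (AE x in lborel.
              u' x - \<nu> *\<^sub>R laplacian (u t) x + advect (u t) (u t) x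
                - cross3 (curl (B t) x) (B t x) + gradient (p t) x = 0) \<and>
           (AE x in lborel.
              B' x - \<eta> *\<^sub>R laplacian (B t) x + advect (u t) (B t) x - advect (B t) (u t) x
                + curl (\<lambda>y. cross3 (curl (B t) y) (B t y)) x = 0)))"

definition maximal_hall_mhd_solution ::
    "real \<Rightarrow> real \<Rightarrow> (real^3 \<Rightarrow> real^3) \<Rightarrow> (real^3 \<Rightarrow> real^3) \<Rightarrow> ereal \<Rightarrow>
     (real \<Rightarrow> real^3 \<Rightarrow> real^3) \<Rightarrow> (real \<Rightarrow> real^3 \<Rightarrow> real^3) \<Rightarrow> bool" where
  "maximal_hall_mhd_solution \<nu> \<eta> u\<^sub>0 B\<^sub>0 T u B \<longleftrightarrow>
     hall_mhd_solution \<nu> \<eta> u\<^sub>0 B\<^sub>0 T u B \<and>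
     (\<forall>T' u' B'. hall_mhd_solution \<nu> \<eta> u\<^sub>0 B\<^sub>0 T' u' B' \<longrightarrow> T' \<le> T)"

definition energy :: "(real^3 \<Rightarrow> real^3) \<Rightarrow> (real^3 \<Rightarrow> real^3) \<Rightarrow> real" where
  "energy u\<^sub>0 B\<^sub>0 = (L2_norm u\<^sub>0)\<^sup>2 + (L2_norm B\<^sub>0)\<^sup>2"

text \<open>\<open>C\<^sub>1\<close> and \<open>C\<^sub>2\<close> are the two occurrences of the generic absolute constant.\<close>

definition hall_C0 ::
    "real \<Rightarrow> real \<Rightarrow> real \<Rightarrow> real \<Rightarrow> (real^3 \<Rightarrow> real^3) \<Rightarrow> (real^3 \<Rightarrow> real^3) \<Rightarrow> real" where
  "hall_C0 C\<^sub>1 C\<^sub>2 \<nu> \<eta> u\<^sub>0 B\<^sub>0 =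
     ((L2_norm (\<lambda>x. B\<^sub>0 x + curl u\<^sub>0 x))\<^sup>2
        + C\<^sub>1 * energy u\<^sub>0 B\<^sub>0 * ((\<nu> - \<eta>)\<^sup>2 / (\<nu> + \<eta>)\<^sup>2))
     * exp (C\<^sub>2 * (energy u\<^sub>0 B\<^sub>0 + (energy u\<^sub>0 B\<^sub>0)\<^sup>2) / (\<nu> + \<eta>)^4)"

end

(* Taking the curl of the velocity equation and adding the magnetic equation, the Hall terms cancel:
   W = B + curl u satisfies  dW/dt - (nu+eta)/2 Lap W + u.grad W - W.grad u = (nu-eta)/2 Lap (W - 2 B).
   Testing with W leaves the trilinear term  int (W.grad u).W  <=  |grad u| |W|_4^2, which the
   Ladyzhenskaya inequality  |W|_4^4 <= C |W| |grad W|^3  and Young's inequality turn into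
   eps |grad W|^2 + C |grad u|^4 |W|^2.  Since |grad u| = |curl u| <= |W| + |B|, as long as |W| <= 1 the
   Gronwall exponent is at most C (1 + E_0) int |grad u|^2, which the energy equality controls;
   the resulting bound C_0 < 1 then keeps |W| below 1.

   Weak derivatives are handled by translations instead of mollification: a function with a weak
   derivative satisfies f(x + h e_i) - f(x) = int_0^h d_i f(x + s e_i) ds almost everywhere, so its
   difference quotients converge in L2 as soon as the derivative is in L2, and identities for them
   pass to the limit. *)

theory Submission
  imports Defs
begin

section \<open>Test functions\<close>

text \<open>The velocity equation is never differentiated: its curl would call for a time derivative
  of \<open>curl u\<close> in L2, which the solution concept does not supply. It is tested with
  \<open>curl W\<close> instead, and the magnetic equation with \<open>W\<close>; since the curl is
  symmetric on H^1, the sum of the two pairings is half the time derivative of |W|^2. The pressure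
  is the obstacle that shapes the spatial part. It is only a function with a weak gradient and no
  known decay, so cut-offs at infinity are out of reach. The gradient of p + |u|^2 / 2 is in L2
  because the velocity equation expresses it through terms that are. Its orthogonality to curls
  comes from the symmetry of second derivatives, and its orthogonality to divergence-free fields
  from translating the field to infinity. The one embedding used is that of H^1 into L4: it makes
  the quadratic terms of the equations square integrable and gives the trilinear estimate. All
  constants are explicit, and they end in the witnesses 10 and 20000000.\<close>

lemma Ck_const: "Ck k (\<lambda>x. c)"
proof (induction k arbitrary: c)
  case (Suc k)
  have "pderiv_at i (\<lambda>x. c) = (\<lambda>x. 0)" for i
    by (simp add: pderiv_at_def fun_eq_iff)
  with Suc show ?case by simp
qed simp

lemma Ck_Suc_imp_Ck: "Ck (Suc k) f \<Longrightarrow> Ck k f"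
proof (induction k arbitrary: f)
  case 0
  then show ?case
    by (auto intro: differentiable_imp_continuous_on simp: differentiable_on_def)
qed auto

lemma pderiv_at_eq: "(f has_derivative f') (at x) \<Longrightarrow> pderiv_at i f x = f' (axis i 1)"
  unfolding pderiv_at_def by (metis frechet_derivative_at)

lemma Ck_add: "Ck k f \<Longrightarrow> Ck k g \<Longrightarrow> Ck k (\<lambda>x. f x + g x)"
proof (induction k arbitrary: f g)
  case (Suc k)
  have "pderiv_at i (\<lambda>x. f x + g x) = (\<lambda>x. pderiv_at i f x + pderiv_at i g x)" for i
  proof
    fix x
    have "(f has_derivative frechet_derivative f (at x)) (at x)"
      "(g has_derivative frechet_derivative g (at x)) (at x)"
      using Suc.prems by (auto simp: frechet_derivative_works)
    from pderiv_at_eq[OF has_derivative_add[OF this]]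
    show "pderiv_at i (\<lambda>x. f x + g x) x = pderiv_at i f x + pderiv_at i g x"
      by (simp add: pderiv_at_def)
  qed
  with Suc show ?case by (simp add: differentiable_add)
qed (auto intro: continuous_intros)

lemma pderiv_at_mult:
  assumes "f differentiable (at x)" "g differentiable (at x)"
  shows "pderiv_at i (\<lambda>x. f x * g x) x = f x * pderiv_at i g x + pderiv_at i f x * g x"
proof -
  have "(f has_derivative frechet_derivative f (at x)) (at x)"
    "(g has_derivative frechet_derivative g (at x)) (at x)"
    using assms by (auto simp: frechet_derivative_works)
  from pderiv_at_eq[OF has_derivative_mult[OF this]]
  show ?thesis by (simp add: pderiv_at_def)
qed

lemma Ck_mult: "Ck k f \<Longrightarrow> Ck k g \<Longrightarrow> Ck k (\<lambda>x. f x * g x)"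
proof (induction k arbitrary: f g)
  case (Suc k)
  have "pderiv_at i (\<lambda>x. f x * g x) = (\<lambda>x. f x * pderiv_at i g x + pderiv_at i f x * g x)" for i
    using Suc.prems by (auto intro!: ext pderiv_at_mult)
  moreover have "Ck k f" "Ck k g"
    using Suc.prems Ck_Suc_imp_Ck by blast+
  ultimately show ?case
    using Suc by (simp add: Ck_add differentiable_mult)
qed (auto intro: continuous_intros)

lemma Ck_prod: "finite A \<Longrightarrow> (\<And>i. i \<in> A \<Longrightarrow> Ck k (f i)) \<Longrightarrow> Ck k (\<lambda>x. \<Prod>i\<in>A. f i x)"
  by (induction A rule: finite_induct) (simp_all add: Ck_const Ck_mult del: Ck.simps)

lemma pderiv_at_shift:
  assumes "f differentiable (at (x + a))"
  shows "pderiv_at i (\<lambda>x. f (x + a)) x = pderiv_at i f (x + a)"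
proof -
  have "(f has_derivative frechet_derivative f (at (x + a))) (at (x + a))"
    using assms by (auto simp: frechet_derivative_works)
  moreover have "((\<lambda>x. x + a) has_derivative (\<lambda>v. v)) (at x)"
    by (auto intro!: derivative_eq_intros)
  ultimately have "((\<lambda>x. f (x + a)) has_derivative frechet_derivative f (at (x + a))) (at x)"
    using has_derivative_compose[where f="\<lambda>x. x + a" and f'="\<lambda>v. v"] by fastforce
  from pderiv_at_eq[OF this] show ?thesis by (simp add: pderiv_at_def)
qed

lemma Ck_shift: "Ck k f \<Longrightarrow> Ck k (\<lambda>x. f (x + a))"
proof (induction k arbitrary: f)
  case 0
  then show ?case
    by (auto intro!: continuous_on_compose2[where f="\<lambda>x. x + a" and g=f] continuous_intros)
next
  case (Suc k)
  have "pderiv_at i (\<lambda>x. f (x + a)) = (\<lambda>x. pderiv_at i f (x + a))" for i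
    using Suc.prems by (auto intro!: ext pderiv_at_shift)
  moreover have "(\<lambda>x. f (x + a)) differentiable at x" for x
    using Suc.prems by (auto intro!: differentiable_compose[of f "\<lambda>x. x + a"] derivative_intros)
  ultimately show ?case using Suc by simp
qed

lemma test_functionD:
  assumes "test_function \<phi>"
  shows "\<phi> differentiable (at x)" "continuous_on UNIV \<phi>" "continuous_on UNIV (pderiv_at i \<phi>)"
proof -
  have c: "Ck (Suc (Suc 0)) \<phi>" "Ck 0 \<phi>" using assms unfolding test_function_def by blast+
  then show "\<phi> differentiable (at x)" "continuous_on UNIV \<phi>" by auto
  have "Ck (Suc 0) (pderiv_at i \<phi>)" using c by simp
  then have "Ck 0 (pderiv_at i \<phi>)" by (rule Ck_Suc_imp_Ck)
  then show "continuous_on UNIV (pderiv_at i \<phi>)" by simp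
qed

lemma test_function_bounded_support:
  assumes "test_function \<phi>"
  obtains R where "R > 0" "\<And>x. norm x > R \<Longrightarrow> \<phi> x = 0" "\<And>x i. norm x > R \<Longrightarrow> pderiv_at i \<phi> x = 0"
proof -
  have "bounded {x. \<phi> x \<noteq> 0}"
    using assms unfolding test_function_def by (simp add: compact_closure)
  then obtain R where R: "R > 0" "\<And>x. \<phi> x \<noteq> 0 \<Longrightarrow> norm x \<le> R"
    unfolding bounded_pos by blast
  have z: "\<phi> x = 0" if "norm x > R" for x
    using R(2)[of x] that by fastforce
  have "pderiv_at i \<phi> x = 0" if "norm x > R" for x i
  proof -
    have "open {x::real^3. norm x > R}"
      by (intro open_Collect_less continuous_intros)
    then have "eventually (\<lambda>y. norm y > R) (nhds x)"
      using that by (auto simp: eventually_nhds)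
    then have "eventually (\<lambda>y. 0 = \<phi> y) (nhds x)"
      by eventually_elim (simp add: z)
    moreover have "((\<lambda>x. 0) has_derivative (\<lambda>x. 0::real)) (at x)" by simp
    ultimately have "(\<phi> has_derivative (\<lambda>x. 0)) (at x)"
      using has_derivative_transform_eventually[of "\<lambda>x. 0" "\<lambda>x. 0" x UNIV \<phi>] z that
      by (simp add: eventually_at_filter eventually_mono)
    from pderiv_at_eq[OF this] show ?thesis .
  qed
  with R(1) z show thesis using that by blast
qed

lemma test_functionI:
  assumes "\<And>k. Ck k \<phi>" "bounded {x. \<phi> x \<noteq> 0}"
  shows "test_function \<phi>"
  using assms unfolding test_function_def by (simp add: compact_closure)

lemma test_function_mult:
  assumes "test_function \<phi>" "test_function \<psi>"
  shows "test_function (\<lambda>x. \<phi> x * \<psi> x)"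
proof (rule test_functionI)
  show "Ck k (\<lambda>x. \<phi> x * \<psi> x)" for k
    using assms unfolding test_function_def by (intro Ck_mult) auto
  have "bounded {x. \<phi> x \<noteq> 0}"
    using assms unfolding test_function_def by (simp add: compact_closure)
  then show "bounded {x. \<phi> x * \<psi> x \<noteq> 0}"
    by (rule bounded_subset) auto
qed

lemma test_function_shift:
  assumes "test_function \<phi>"
  shows "test_function (\<lambda>x. \<phi> (x + a))"
proof (rule test_functionI)
  show "Ck k (\<lambda>x. \<phi> (x + a))" for k
    using assms unfolding test_function_def by (intro Ck_shift) auto
  obtain R where R: "R > 0" "\<And>x. norm x > R \<Longrightarrow> \<phi> x = 0"
    using test_function_bounded_support[OF assms] by metis
  show "bounded {x. \<phi> (x + a) \<noteq> 0}"
  proof (rule boundedI)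
    fix x assume "x \<in> {x. \<phi> (x + a) \<noteq> 0}"
    then have "norm (x + a) \<le> R" using R(2)[of "x + a"] by fastforce
    then show "norm x \<le> R + norm a"
      using norm_triangle_ineq4[of "x + a" a] by simp
  qed
qed

lemma compact_support_bounded:
  fixes \<psi> :: "real^3 \<Rightarrow> real"
  assumes "continuous_on UNIV \<psi>" "\<And>x. norm x > R \<Longrightarrow> \<psi> x = 0"
  obtains M where "M > 0" "\<And>x. \<bar>\<psi> x\<bar> \<le> M"
proof -
  have "compact (\<psi> ` cball 0 R)"
    using assms(1) by (intro compact_continuous_image) (auto intro: continuous_on_subset)
  then obtain M where "M > 0" "\<And>y. y \<in> \<psi> ` cball 0 R \<Longrightarrow> norm y \<le> M"
    using compact_imp_bounded bounded_pos by metis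
  then have "\<bar>\<psi> x\<bar> \<le> M" for x
    using assms(2)[of x] by (cases "norm x \<le> R") auto
  with \<open>M > 0\<close> show thesis using that by blast
qed

text \<open>The derivatives of \<open>exp (- c / t)\<close> on \<open>t > 0\<close> are of the form \<open>p (1 / t) * exp (- c / t)\<close>
  with a polynomial \<open>p\<close>.\<close>

definition hbump :: "real \<Rightarrow> real poly \<Rightarrow> real \<Rightarrow> real" where
  "hbump c p t = (if t > 0 then poly p (1 / t) * exp (- c / t) else 0)"

text \<open>The factor \<open>y ^ m\<close> serves the induction over \<open>pCons\<close>:
  splitting off the constant coefficient leaves \<open>y ^ m * (y * poly p y)\<close>, which is the
  claim for \<open>p\<close> with exponent \<open>Suc m\<close>.\<close>

lemma poly_exp_decay:
  assumes "c > 0"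
  shows "((\<lambda>y. y ^ m * poly p y * exp (- c * y)) \<longlongrightarrow> (0::real)) at_top"
proof (induction p arbitrary: m)
  case 0
  then show ?case by simp
next
  case (pCons a p)
  have "((\<lambda>y. (c * y) ^ m / exp (c * y)) \<longlongrightarrow> 0) at_top"
    using assms by (intro filterlim_compose[OF tendsto_power_div_exp_0]
      filterlim_tendsto_pos_mult_at_top[OF tendsto_const] filterlim_ident) auto
  then have "((\<lambda>y. a / c ^ m * ((c * y) ^ m / exp (c * y))) \<longlongrightarrow> a / c ^ m * 0) at_top"
    by (intro tendsto_intros)
  moreover have "a / c ^ m * ((c * y) ^ m / exp (c * y)) = a * y ^ m * exp (- c * y)" for y
    using assms by (simp add: power_mult_distrib exp_minus field_simps)
  ultimately have "((\<lambda>y. a * y ^ m * exp (- c * y)) \<longlongrightarrow> 0) at_top" by simp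
  from tendsto_add[OF this pCons.IH[of "Suc m"]]
  show ?case by (simp add: algebra_simps)
qed

text \<open>For t > 0 put y = 1/t. As dy/dt = - y^2, the chain rule gives y^2 (c p - p')(y) exp (- c
  y), so the family is closed under differentiation and only the polynomial changes. The delicate
  point is t = 0, where the exponential decay enters.\<close>

lemma hbump_has_derivative:
  assumes "c > 0"
  shows "(hbump c p has_real_derivative hbump c ([:0, 0, 1:] * (smult c p - pderiv p)) t) (at t)"
proof -
  consider "t < 0" | "t = 0" | "t > 0" by linarith
  then show ?thesis
  proof cases
    case 1
    have "eventually (\<lambda>s. s < 0) (nhds t)" using 1 by (auto simp: eventually_nhds intro: open_lessThan)
    then have "eventually (\<lambda>s. hbump c p s = 0) (nhds t)"
      by eventually_elim (simp add: hbump_def)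
    then have "(hbump c p has_real_derivative 0) (at t)"
      using DERIV_cong_ev[OF refl, of "hbump c p" "\<lambda>_. 0" t 0 0] by simp
    then show ?thesis using 1 by (simp add: hbump_def[of _ _ t])
  next
    case 2
    \<comment> \<open>With y = 1/h the right difference quotient at 0 is y p(y) exp (- c y); the
      division by h accounts for the exponent 1.\<close>
    have "((\<lambda>h. (1/h) ^ 1 * poly p (1/h) * exp (- c * (1/h))) \<longlongrightarrow> 0) (at_right 0)"
      by (rule filterlim_compose[OF poly_exp_decay[OF assms]])
        (simp add: filterlim_inverse_at_top_right divide_inverse)
    then have "((\<lambda>h. hbump c p h / h) \<longlongrightarrow> 0) (at_right 0)"
      by (rule Lim_transform_eventually)
        (auto simp: eventually_at_filter hbump_def field_simps)
    moreover have "((\<lambda>h. hbump c p h / h) \<longlongrightarrow> 0) (at_left 0)"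
      by (rule Lim_transform_eventually[OF tendsto_const])
        (auto simp: eventually_at_filter hbump_def)
    ultimately have "((\<lambda>h. hbump c p h / h) \<longlongrightarrow> 0) (at 0)"
      by (simp add: filterlim_at_split)
    then show ?thesis using 2 by (simp add: DERIV_def hbump_def)
  next
    case 3
    have "eventually (\<lambda>s. s > 0) (nhds t)" using 3 by (auto simp: eventually_nhds intro: open_greaterThan)
    then have ev: "eventually (\<lambda>s. hbump c p s = poly p (1/s) * exp (- c / s)) (nhds t)"
      by eventually_elim (simp add: hbump_def)
    have "((\<lambda>s. poly p (1/s) * exp (- c / s)) has_real_derivative
       (poly (pderiv p) (1/t) * (- 1/t\<^sup>2)) * exp (- c / t) + (exp (- c / t) * (c / t\<^sup>2)) * poly p (1/t)) (at t)"
      using 3 by (intro DERIV_mult DERIV_fun_exp DERIV_chain'[OF _ poly_DERIV])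
        (auto intro!: derivative_eq_intros simp: power2_eq_square)
    moreover have "(poly (pderiv p) (1/t) * (- 1/t\<^sup>2)) * exp (- c / t) + (exp (- c / t) * (c / t\<^sup>2)) * poly p (1/t)
      = hbump c ([:0, 0, 1:] * (smult c p - pderiv p)) t"
      using 3 by (simp add: hbump_def power2_eq_square field_simps)
    ultimately show ?thesis using DERIV_cong_ev[OF refl ev refl] by simp
  qed
qed

text \<open>The factor \<open>a\<close> and the polynomial are arbitrary in the induction because
  each partial derivative reproduces the same shape with a new factor and a new polynomial. The
  slopes 1 and -1 serve the lower and the upper face of a box.\<close>

lemma Ck_hbump:
  assumes "c > 0"
  shows "Ck k (\<lambda>x. a * hbump c p (s * (x $ i) + d))"
proof (induction k arbitrary: a p)
  case 0
  have "continuous_on UNIV (hbump c p)" for p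
    using hbump_has_derivative[OF assms] by (meson DERIV_continuous_on has_field_derivative_at_within)
  then have "continuous_on UNIV (\<lambda>x::real^3. hbump c p (s * (x $ i) + d))"
    by (rule continuous_on_compose2) (auto intro!: continuous_intros)
  then show ?case by (simp add: continuous_on_mult_left)
next
  case (Suc k)
  let ?q = "[:0, 0, 1:] * (smult c p - pderiv p)"
  have d: "((\<lambda>x. a * hbump c p (s * (x $ i) + d)) has_derivative
    (\<lambda>v. a * (hbump c ?q (s * (x $ i) + d) * (s * (v $ i))))) (at x)" for x
  proof -
    have "((\<lambda>x. s * (x $ i) + d) has_derivative (\<lambda>v. s * (v $ i))) (at x)"
      by (auto intro!: derivative_eq_intros bounded_linear_imp_has_derivative[OF bounded_linear_vec_nth])
    from has_derivative_mult_right[OF has_derivative_compose[OF this hbump_has_derivative[OF assms, unfolded has_field_derivative_def]]]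
    show ?thesis .
  qed
  have "pderiv_at j (\<lambda>x. a * hbump c p (s * (x $ i) + d)) = (\<lambda>x. (a * s * (axis j 1 $ i)) * hbump c ?q (s * (x $ i) + d))" for j
    by (rule ext) (simp add: pderiv_at_eq[OF d])
  moreover have "(\<lambda>x. a * hbump c p (s * (x $ i) + d)) differentiable (at x)" for x
    using d unfolding differentiable_def by blast
  ultimately show ?case using Suc unfolding Ck.simps by simp
qed

text \<open>The parameter \<open>c\<close> is meant to tend to 0: exp (- c / t) then tends to 1 for
  every t > 0, so these smooth functions approximate the indicator of the open box from below, with
  no convolution involved.\<close>

definition box_bump :: "real \<Rightarrow> real^3 \<Rightarrow> real^3 \<Rightarrow> real^3 \<Rightarrow> real" where
  "box_bump c l r x = (\<Prod>i\<in>UNIV. hbump c 1 (x $ i - l $ i) * hbump c 1 (r $ i - x $ i))"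

lemma box_bump_nonzero: "box_bump c l r x \<noteq> 0 \<longleftrightarrow> x \<in> box l r"
  unfolding box_bump_def by (auto simp: mem_box_cart hbump_def)

lemma box_bump_bounds: 
  assumes "c > 0" shows "0 \<le> box_bump c l r x" "box_bump c l r x \<le> 1"
proof -
  have h: "0 \<le> hbump c 1 t \<and> hbump c 1 t \<le> 1" for t using assms by (simp add: hbump_def)
  then show "0 \<le> box_bump c l r x" unfolding box_bump_def by (intro prod_nonneg) auto
  show "box_bump c l r x \<le> 1" unfolding box_bump_def
    using h by (intro prod_le_1) (auto intro!: mult_le_one)
qed

lemma test_function_box_bump:
  assumes "c > 0" shows "test_function (box_bump c l r)"
proof (rule test_functionI)
  have 1: "Ck k (\<lambda>x. hbump c 1 (x $ i - l $ i))" for k and i :: 3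
    using Ck_hbump[OF assms, of k 1 1 1 i "- l $ i"] by simp
  have 2: "Ck k (\<lambda>x. hbump c 1 (r $ i - x $ i))" for k and i :: 3
    using Ck_hbump[OF assms, of k 1 1 "-1" i "r $ i"] by (simp add: algebra_simps)
  show "Ck k (box_bump c l r)" for k
    unfolding box_bump_def by (intro Ck_prod Ck_mult 1 2) auto
  have "{x. box_bump c l r x \<noteq> 0} = box l r"
    by (simp add: box_bump_nonzero)
  then show "bounded {x. box_bump c l r x \<noteq> 0}" by simp
qed

lemma box_bump_tendsto: "(\<lambda>n. box_bump (1 / real (Suc n)) l r x) \<longlonglongrightarrow> indicator (box l r) x"
proof (cases "x \<in> box l r")
  case False
  then have "box_bump c l r x = 0" for c using box_bump_nonzero by blast
  with False show ?thesis by simp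
next
  case True
  have h: "(\<lambda>n. hbump (1 / real (Suc n)) 1 t) \<longlonglongrightarrow> 1" if "t > 0" for t
  proof -
    have "(\<lambda>n. exp (- (1 / t) * (1 / real (Suc n)))) \<longlonglongrightarrow> exp (- (1/t) * 0)"
      by (intro tendsto_exp tendsto_mult tendsto_const LIMSEQ_Suc[OF lim_1_over_n])
    then show ?thesis using that by (simp add: hbump_def mult.commute)
  qed
  have "(\<lambda>n. box_bump (1 / real (Suc n)) l r x) \<longlonglongrightarrow> (\<Prod>i\<in>(UNIV::3 set). 1 * 1)"
    unfolding box_bump_def using True by (intro tendsto_prod tendsto_mult h) (auto simp: mem_box_cart)
  with True show ?thesis by simp
qed

section \<open>The fundamental lemma and the space L2\<close>

lemma L1_locD:
  fixes f :: "real^3 \<Rightarrow> 'b::euclidean_space"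
  assumes "L1_loc f"
  shows "f \<in> borel_measurable lborel" "f \<in> borel_measurable borel"
    "integrable lborel (\<lambda>x. indicator (cball 0 R) x *\<^sub>R f x)"
  using assms unfolding L1_loc_def by (auto simp: set_integrable_def)

lemma L1_loc_set_integrable: "L1_loc f \<Longrightarrow> compact K \<Longrightarrow> set_integrable lborel K f"
  by (simp add: L1_loc_def)

lemma integrable_mult_compact_support:
  fixes f :: "real^3 \<Rightarrow> 'b::euclidean_space"
  assumes f: "L1_loc f" and [measurable]: "\<psi> \<in> borel_measurable borel"
    and "\<And>x. norm x > R \<Longrightarrow> \<psi> x = 0" and "\<And>x. \<bar>\<psi> x\<bar> \<le> M"
  shows "integrable lborel (\<lambda>x. \<psi> x *\<^sub>R f x)"
proof (rule Bochner_Integration.integrable_bound)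
  show "integrable lborel (\<lambda>x. M *\<^sub>R (indicator (cball 0 R) x *\<^sub>R f x))"
    by (intro integrable_scaleR_right L1_locD f)
  note [measurable] = L1_locD(2)[OF f]
  show "(\<lambda>x. \<psi> x *\<^sub>R f x) \<in> borel_measurable lborel" by simp
  have "norm (\<psi> x *\<^sub>R f x) \<le> norm (M *\<^sub>R (indicator (cball 0 R) x *\<^sub>R f x))" for x
    using assms(3)[of x] order_trans[OF assms(4)[of x] abs_ge_self[of M]] by (cases "norm x \<le> R") (auto intro: mult_right_mono)
  then show "AE x in lborel. norm (\<psi> x *\<^sub>R f x) \<le> norm (M *\<^sub>R (indicator (cball 0 R) x *\<^sub>R f x))"
    by simp
qed

text \<open>The bumps with parameter 1 / (n + 1) lie between 0 and 1 and converge pointwise to the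
  indicator, so dominated convergence, with |f| on the closed box as majorant, extends the
  hypothesis from test functions to boxes.\<close>

lemma integral_box_eq_0:
  fixes f :: "real^3 \<Rightarrow> real"
  assumes f: "L1_loc f" and 0: "\<And>\<phi>. test_function \<phi> \<Longrightarrow> (\<integral>x. \<phi> x * f x \<partial>lborel) = 0"
  shows "(\<integral>x. indicator (box l r) x * f x \<partial>lborel) = 0"
proof -
  let ?s = "\<lambda>n x. box_bump (1 / real (Suc n)) l r x * f x"
  note [measurable] = L1_locD(2)[OF f]
  have [measurable]: "box_bump (1 / real (Suc n)) l r \<in> borel_measurable borel" for n
    by (intro borel_measurable_continuous_onI test_functionD(2) test_function_box_bump) simp
  have "(\<lambda>n. integral\<^sup>L lborel (?s n)) \<longlonglongrightarrow> (\<integral>x. indicator (box l r) x * f x \<partial>lborel)"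
  proof (rule integral_dominated_convergence)
    have "set_integrable lborel (cbox l r) f" by (intro L1_loc_set_integrable f compact_cbox)
    then show "integrable lborel (\<lambda>x. \<bar>indicator (cbox l r) x * f x\<bar>)"
      unfolding set_integrable_def by (intro integrable_abs) simp
    show "AE x in lborel. (\<lambda>n. ?s n x) \<longlonglongrightarrow> indicator (box l r) x * f x"
      by (intro AE_I2 tendsto_mult box_bump_tendsto tendsto_const)
    have "norm (?s n x) \<le> \<bar>indicator (cbox l r) x * f x\<bar>" for n x
    proof (cases "x \<in> box l r")
      case True
      then have "x \<in> cbox l r" using box_subset_cbox by blast
      then show ?thesis using box_bump_bounds[of "1 / real (Suc n)" l r x]
        by (auto simp: abs_mult mult_left_le_one_le)
    next
      case False
      then have "box_bump (1 / real (Suc n)) l r x = 0" using box_bump_nonzero by blast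
      then show ?thesis by simp
    qed
    then show "AE x in lborel. norm (?s n x) \<le> \<bar>indicator (cbox l r) x * f x\<bar>" for n by simp
    show "?s n \<in> borel_measurable lborel" for n by measurable
  qed simp
  moreover have "integral\<^sup>L lborel (?s n) = 0" for n
    by (intro 0 test_function_box_bump) simp
  ultimately show ?thesis by (simp add: LIMSEQ_unique)
qed

text \<open>Turns a vanishing signed integral into an equality of two nonnegative ones, the form in
  which measures with densities can be compared.\<close>

lemma nn_integral_eq_uminus:
  fixes g :: "'a \<Rightarrow> real"
  assumes "integrable M g" "integral\<^sup>L M g = 0"
  shows "(\<integral>\<^sup>+x. ennreal (g x) \<partial>M) = (\<integral>\<^sup>+x. ennreal (- g x) \<partial>M)"
proof -
  have fin: "(\<integral>\<^sup>+x. ennreal (g x) \<partial>M) < top" "(\<integral>\<^sup>+x. ennreal (- g x) \<partial>M) < top"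
    using assms(1) by (auto simp: real_integrable_def top.not_eq_extremum)
  have "enn2real (\<integral>\<^sup>+x. ennreal (g x) \<partial>M) = enn2real (\<integral>\<^sup>+x. ennreal (- g x) \<partial>M)"
    using real_lebesgue_integral_def[OF assms(1)] assms(2) by simp
  then show ?thesis
    by (subst ennreal_enn2real[OF fin(1), symmetric], subst ennreal_enn2real[OF fin(2), symmetric]) (rule arg_cong)
qed

lemma UN_centered_boxes: "(\<Union>n. box (\<chi> i. - real n) (\<chi> i. real n)) = (UNIV :: (real^3) set)"
proof -
  have "\<exists>n. x \<in> box (\<chi> i. - real n) (\<chi> i. real n)" for x :: "real^3"
  proof -
    obtain n where n: "norm x < real n" using reals_Archimedean2 by blast
    have "\<bar>x $ i\<bar> < real n" for i using component_le_norm_cart[of x i] n by linarith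
    then have "- real n < x $ i \<and> x $ i < real n" for i by (simp add: abs_less_iff minus_less_iff)
    then have "x \<in> box (\<chi> i. - real n) (\<chi> i. real n)" by (simp add: mem_box_cart)
    then show ?thesis ..
  qed
  then show ?thesis by blast
qed

text \<open>The positive and the negative part of f, restricted to a bounded box, are densities of
  two finite measures that agree on all boxes. Boxes are an intersection-stable generator, so the
  measures coincide and the densities agree almost everywhere. Two equal parts of which one is
  always 0 both vanish.\<close>

lemma fundamental_lemma_real:
  fixes f :: "real^3 \<Rightarrow> real"
  assumes f: "L1_loc f" and 0: "\<And>\<phi>. test_function \<phi> \<Longrightarrow> (\<integral>x. \<phi> x * f x \<partial>lborel) = 0"
  shows "AE x in lborel. f x = 0"
proof -
  define Q where "Q n = (box (\<chi> i. - real n) (\<chi> i. real n) :: (real^3) set)" for n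
  have Qs [measurable]: "Q n \<in> sets borel" for n by (simp add: Q_def)
  note [measurable] = L1_locD(2)[OF f]
  have "AE x in lborel. indicator (Q n) x * f x = (0::real)" for n
  proof -
    let ?g = "\<lambda>x. indicator (Q n) x * f x"
    have "density lborel (\<lambda>x. ennreal (?g x)) = density lborel (\<lambda>x. ennreal (- ?g x))"
    proof (rule measure_eqI_generator_eq[where E="range (\<lambda>(a, b). box a b)" and \<Omega>=UNIV and A=Q])
      show "Int_stable (range (\<lambda>(a, b). box a b :: (real^3) set))"
        by (auto simp: Int_stable_def box_Int_box)
      have sets: "sets borel = sigma_sets UNIV (range (\<lambda>(a, b). box a b :: (real^3) set))"
        by (subst borel_eq_box) simp
      then show "sets (density lborel (\<lambda>x. ennreal (?g x))) = sigma_sets UNIV (range (\<lambda>(a, b). box a b))"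
        "sets (density lborel (\<lambda>x. ennreal (- ?g x))) = sigma_sets UNIV (range (\<lambda>(a, b). box a b))"
        by simp_all
      show "range Q \<subseteq> range (\<lambda>(a, b). box a b)" by (auto simp: Q_def)
      show "(\<Union>i. Q i) = UNIV" using UN_centered_boxes by (simp add: Q_def)
      have *: "integrable lborel (\<lambda>x. indicator (box a b \<inter> Q n) x * f x)" for a b
      proof -
        have "set_integrable lborel (cbox (\<chi> i. - real n) (\<chi> i. real n)) f" by (intro L1_loc_set_integrable f compact_cbox)
        then have "set_integrable lborel (box a b \<inter> Q n) f"
          by (rule set_integrable_subset) (use box_subset_cbox in \<open>auto simp: Q_def\<close>)
        then show ?thesis by (simp add: set_integrable_def)
      qed
      have **: "emeasure (density lborel (\<lambda>x. ennreal (s * ?g x))) (box a b)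
          = (\<integral>\<^sup>+x. ennreal (s * (indicator (box a b \<inter> Q n) x * f x)) \<partial>lborel)" for a b and s
        by (subst emeasure_density) (auto intro!: nn_integral_cong simp: indicator_def)
      show "emeasure (density lborel (\<lambda>x. ennreal (?g x))) X = emeasure (density lborel (\<lambda>x. ennreal (- ?g x))) X"
        if X: "X \<in> range (\<lambda>(a, b). box a b)" for X
      proof -
        obtain a b where X: "X = box a b" using X by auto
        obtain l r where lr: "box a b \<inter> Q n = box l r" unfolding Q_def box_Int_box by blast
        have "(\<integral>x. indicator (box a b \<inter> Q n) x * f x \<partial>lborel) = 0"
          unfolding lr by (rule integral_box_eq_0[OF f 0])
        from nn_integral_eq_uminus[OF * this] show ?thesis
          using **[of 1 a b] **[of "-1" a b] by (simp add: X)
      qed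
      show "emeasure (density lborel (\<lambda>x. ennreal (?g x))) (Q i) \<noteq> \<infinity>" for i
      proof -
        obtain a b where X: "Q i = box a b" using Q_def by blast
        show ?thesis using **[of 1 a b] *[of a b] by (simp add: X real_integrable_def)
      qed
    qed auto
    then have "AE x in lborel. ennreal (?g x) = ennreal (- ?g x)"
      by (intro sigma_finite_measure.density_unique[OF sigma_finite_lborel]) simp_all
    then show ?thesis
    proof eventually_elim
      fix x assume "ennreal (?g x) = ennreal (- ?g x)"
      then show "?g x = 0" by (cases "0 \<le> ?g x") (auto simp: ennreal_neg ennreal_eq_0_iff)
    qed
  qed
  then have "AE x in lborel. \<forall>n. indicator (Q n) x * f x = (0::real)"
    by (subst AE_all_countable) blast
  then show ?thesis
  proof eventually_elim
    fix x assume *: "\<forall>n. indicator (Q n) x * f x = (0::real)"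
    obtain n where "x \<in> Q n" using UN_centered_boxes unfolding Q_def by blast
    then show "f x = 0" using spec[OF *, of n] by simp
  qed
qed

section \<open>The inner product and the norm of L2, and their behaviour under translations and
  limits\<close>

definition ip :: "(real^3 \<Rightarrow> 'b::euclidean_space) \<Rightarrow> (real^3 \<Rightarrow> 'b) \<Rightarrow> real" where
  "ip f g = (\<integral>x. f x \<bullet> g x \<partial>lborel)"

lemma L2_measurable: "L2 f \<Longrightarrow> f \<in> borel_measurable borel"
  by (simp add: L2_def)

lemma L2_integrable: "L2 f \<Longrightarrow> integrable lborel (\<lambda>x. (norm (f x))\<^sup>2)"
  by (simp add: L2_def)

lemma L2_bound:
  assumes "L2 f" "g \<in> borel_measurable borel" "AE x in lborel. norm (g x) \<le> C * norm (f x)"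
  shows "L2 g"
  unfolding L2_def
proof
  show [measurable]: "g \<in> borel_measurable lborel" using assms by simp
  show "integrable lborel (\<lambda>x. (norm (g x))\<^sup>2)"
  proof (rule Bochner_Integration.integrable_bound)
    show "integrable lborel (\<lambda>x. C\<^sup>2 * (norm (f x))\<^sup>2)" using L2_integrable[OF assms(1)] by simp
    show "AE x in lborel. norm ((norm (g x))\<^sup>2) \<le> norm (C\<^sup>2 * (norm (f x))\<^sup>2)"
      using assms(3)
    proof eventually_elim
      case (elim x)
      then have "(norm (g x))\<^sup>2 \<le> (C * norm (f x))\<^sup>2" by (intro power_mono) auto
      then show ?case by (simp add: power_mult_distrib abs_mult)
    qed
  qed simp
qed

lemma L2_norm_mult_integrable:
  fixes f :: "real^3 \<Rightarrow> 'b::euclidean_space" and g :: "real^3 \<Rightarrow> 'c::euclidean_space"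
  assumes "L2 f" "L2 g"
  shows "integrable lborel (\<lambda>x. norm (f x) * norm (g x))"
proof (rule Bochner_Integration.integrable_bound)
  note [measurable] = L2_measurable[OF assms(1)] L2_measurable[OF assms(2)]
  show "integrable lborel (\<lambda>x. (norm (f x))\<^sup>2 + (norm (g x))\<^sup>2)"
    using assms by (intro Bochner_Integration.integrable_add L2_integrable)
  have "norm (norm (f x) * norm (g x)) \<le> norm ((norm (f x))\<^sup>2 + (norm (g x))\<^sup>2)" for x
  proof -
    have "2 * (norm (f x) * norm (g x)) \<le> (norm (f x))\<^sup>2 + (norm (g x))\<^sup>2"
      using sum_squares_bound[of "norm (f x)" "norm (g x)"] by (simp only: mult.assoc)
    moreover have "0 \<le> norm (f x) * norm (g x)" by simp
    ultimately show ?thesis unfolding real_norm_def by linarith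
  qed
  then show "AE x in lborel. norm (norm (f x) * norm (g x)) \<le> norm ((norm (f x))\<^sup>2 + (norm (g x))\<^sup>2)" by simp
qed (use L2_measurable[OF assms(1)] L2_measurable[OF assms(2)] in measurable)

lemma L2_inner_integrable:
  assumes "L2 f" "L2 g" shows "integrable lborel (\<lambda>x. f x \<bullet> g x)"
  by (rule Bochner_Integration.integrable_bound[OF L2_norm_mult_integrable[OF assms]])
    (use L2_measurable[OF assms(1)] L2_measurable[OF assms(2)] Cauchy_Schwarz_ineq2 in auto)

lemma L2_cmult: "L2 f \<Longrightarrow> L2 (\<lambda>x. c *\<^sub>R f x)"
  by (rule L2_bound[of f _ "\<bar>c\<bar>"]) (simp_all add: L2_measurable borel_measurable_scaleR)

lemma L2_uminus: "L2 f \<Longrightarrow> L2 (\<lambda>x. - f x)"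
  by (rule L2_bound[of f _ 1]) (simp_all add: L2_measurable)

lemma L2_zero: "L2 (\<lambda>x. 0)" by (simp add: L2_def)

lemma L2_add: assumes "L2 f" "L2 g" shows "L2 (\<lambda>x. f x + g x)"
  unfolding L2_def
proof
  note [measurable] = L2_measurable[OF assms(1)] L2_measurable[OF assms(2)]
  show "(\<lambda>x. f x + g x) \<in> borel_measurable lborel" by simp
  show "integrable lborel (\<lambda>x. (norm (f x + g x))\<^sup>2)"
    unfolding power2_norm_eq_inner inner_add_left inner_add_right
    using assms by (intro Bochner_Integration.integrable_add L2_inner_integrable)
qed

lemma L2_diff: "L2 f \<Longrightarrow> L2 g \<Longrightarrow> L2 (\<lambda>x. f x - g x)"
  using L2_add[OF _ L2_uminus, of f g] by simp

lemma L2_sum: "finite A \<Longrightarrow> (\<And>i. i \<in> A \<Longrightarrow> L2 (f i)) \<Longrightarrow> L2 (\<lambda>x. \<Sum>i\<in>A. f i x)"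
  by (induction A rule: finite_induct) (auto simp: L2_zero L2_add)

lemma L2_bounded_linear:
  assumes "bounded_linear A" "L2 f" shows "L2 (\<lambda>x. A (f x))"
proof -
  obtain K where "\<And>x. norm (A x) \<le> norm x * K"
    using bounded_linear.bounded[OF assms(1)] by blast
  moreover have "(\<lambda>x. A (f x)) \<in> borel_measurable borel"
    using L2_measurable[OF assms(2)] borel_measurable_continuous_onI[OF linear_continuous_on[OF assms(1), of UNIV]]
    by (rule measurable_compose)
  ultimately show ?thesis
    by (intro L2_bound[OF assms(2), of _ K]) (auto simp: mult.commute)
qed

lemma L2_cong_AE: "L2 f \<Longrightarrow> g \<in> borel_measurable borel \<Longrightarrow> AE x in lborel. f x = g x \<Longrightarrow> L2 g"
  by (rule L2_bound[of f g 1]) auto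

lemma L2_nth: "L2 f \<Longrightarrow> L2 (\<lambda>x. f x $ k)" for f :: "real^3 \<Rightarrow> real^3"
  by (rule L2_bounded_linear[OF bounded_linear_vec_nth])

lemma L2_shift: assumes "L2 f" shows "L2 (\<lambda>x. f (x + a))"
proof -
  note [measurable] = L2_measurable[OF assms]
  have "integrable (distr lborel borel ((+) a)) (\<lambda>x. (norm (f x))\<^sup>2)"
    using L2_integrable[OF assms] by (simp add: lborel_distr_plus)
  then have "integrable lborel (\<lambda>x. (norm (f (a + x)))\<^sup>2)"
    by (subst (asm) integrable_distr_eq) auto
  then show ?thesis by (simp add: L2_def add.commute)
qed

lemma integral_shift:
  fixes f :: "real^3 \<Rightarrow> 'b::euclidean_space"
  assumes "f \<in> borel_measurable borel"
  shows "(\<integral>x. f (x + a) \<partial>lborel) = (\<integral>x. f x \<partial>lborel)"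
proof -
  have "(\<integral>x. f x \<partial>lborel) = (\<integral>x. f x \<partial>(distr lborel borel ((+) a)))"
    by (simp add: lborel_distr_plus)
  also have "\<dots> = (\<integral>x. f (a + x) \<partial>lborel)" using assms by (subst integral_distr) auto
  finally show ?thesis by (simp add: add.commute)
qed

lemma nn_integral_shift:
  fixes f :: "'a::euclidean_space \<Rightarrow> ennreal"
  assumes "f \<in> borel_measurable borel"
  shows "(\<integral>\<^sup>+x. f (x + a) \<partial>lborel) = (\<integral>\<^sup>+x. f x \<partial>lborel)"
proof -
  have "(\<integral>\<^sup>+x. f x \<partial>lborel) = (\<integral>\<^sup>+x. f x \<partial>(distr lborel borel ((+) a)))"
    by (simp add: lborel_distr_plus)
  also have "\<dots> = (\<integral>\<^sup>+x. f (a + x) \<partial>lborel)" using assms by (subst nn_integral_distr) auto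
  finally show ?thesis by (simp add: add.commute)
qed

lemma AE_shift:
  fixes a :: "'a::euclidean_space"
  assumes "AE x in lborel. P x" shows "AE x in lborel. P (x + a)"
proof -
  obtain N where N: "{x \<in> space lborel. \<not> P x} \<subseteq> N" "N \<in> null_sets lborel"
    using assms by (auto elim!: AE_E simp: null_sets_def)
  have "emeasure (distr lborel borel ((+) a)) N = 0"
    using N(2) by (simp add: lborel_distr_plus null_sets_def)
  then have "emeasure lborel ((+) a -` N) = 0"
    using N(2) by (subst (asm) emeasure_distr) (auto simp: null_sets_def)
  moreover have "(+) a -` N \<in> sets borel"
    using N(2) measurable_sets[of "(+) a" borel borel N] by (auto simp: null_sets_def)
  ultimately have "(+) a -` N \<in> null_sets lborel" by (simp add: null_sets_def)
  then show ?thesis by (rule AE_I') (use N in \<open>auto simp: add.commute\<close>)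
qed

lemma ip_shift:
  assumes "L2 f" "L2 g" shows "ip (\<lambda>x. f (x + a)) (\<lambda>x. g (x + a)) = ip f g"
  unfolding ip_def
  by (rule integral_shift[of "\<lambda>x. f x \<bullet> g x"]) (use L2_measurable[OF assms(1)] L2_measurable[OF assms(2)] in measurable)

lemma ip_commute: "ip f g = ip g f" by (simp add: ip_def inner_commute)

lemma ip_add_left: "L2 f \<Longrightarrow> L2 g \<Longrightarrow> L2 h \<Longrightarrow> ip (\<lambda>x. f x + g x) h = ip f h + ip g h"
  by (simp add: ip_def inner_add_left L2_inner_integrable)
lemma ip_add_right: "L2 f \<Longrightarrow> L2 g \<Longrightarrow> L2 h \<Longrightarrow> ip f (\<lambda>x. g x + h x) = ip f g + ip f h"
  by (simp add: ip_def inner_add_right L2_inner_integrable)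
lemma ip_diff_left: "L2 f \<Longrightarrow> L2 g \<Longrightarrow> L2 h \<Longrightarrow> ip (\<lambda>x. f x - g x) h = ip f h - ip g h"
  by (simp add: ip_def inner_diff_left L2_inner_integrable)
lemma ip_diff_right: "L2 f \<Longrightarrow> L2 g \<Longrightarrow> L2 h \<Longrightarrow> ip f (\<lambda>x. g x - h x) = ip f g - ip f h"
  by (simp add: ip_def inner_diff_right L2_inner_integrable)
lemma ip_minus_left: "ip (\<lambda>x. - f x) g = - ip f g" by (simp add: ip_def)
lemma ip_minus_right: "ip f (\<lambda>x. - g x) = - ip f g" by (simp add: ip_def)
lemma ip_scaleR_left: "ip (\<lambda>x. c *\<^sub>R f x) g = c * ip f g" by (simp add: ip_def)
lemma ip_scaleR_right: "ip f (\<lambda>x. c *\<^sub>R g x) = c * ip f g" by (simp add: ip_def)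
lemma ip_zero: "ip (\<lambda>x. 0) g = 0" "ip f (\<lambda>x. 0) = 0" by (simp_all add: ip_def)

lemma ip_sum_left:
  assumes "finite A" "\<And>i. i \<in> A \<Longrightarrow> L2 (f i)" "L2 g"
  shows "ip (\<lambda>x. \<Sum>i\<in>A. f i x) g = (\<Sum>i\<in>A. ip (f i) g)"
  using assms by (induction A rule: finite_induct) (auto simp: ip_zero ip_add_left L2_sum)

lemma ip_sum_right:
  assumes "finite A" "\<And>i. i \<in> A \<Longrightarrow> L2 (f i)" "L2 g"
  shows "ip g (\<lambda>x. \<Sum>i\<in>A. f i x) = (\<Sum>i\<in>A. ip g (f i))"
  using ip_sum_left[OF assms] by (simp add: ip_commute)

lemma ip_cong_AE:
  assumes "f \<in> borel_measurable borel" "f' \<in> borel_measurable borel"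
    "g \<in> borel_measurable borel" "g' \<in> borel_measurable borel"
    "AE x in lborel. f x = f' x" "AE x in lborel. g x = g' x"
  shows "ip f g = ip f' g'"
  unfolding ip_def using assms by (intro integral_cong_AE) auto

lemma L2_norm_nonneg: "0 \<le> L2_norm f" by (simp add: L2_norm_def)

lemma L2_norm_sq: "(L2_norm f)\<^sup>2 = ip f f"
  by (simp add: L2_norm_def ip_def power2_norm_eq_inner)

lemma L2_norm_cong_AE:
  assumes "f \<in> borel_measurable borel" "g \<in> borel_measurable borel" "AE x in lborel. f x = g x"
  shows "L2_norm f = L2_norm g"
  using ip_cong_AE[OF assms(1,2) assms(1,2) assms(3) assms(3)] L2_norm_sq[of f] L2_norm_sq[of g]
  by (metis L2_norm_nonneg power2_eq_iff_nonneg)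

lemma L2_norm_shift: "L2 f \<Longrightarrow> L2_norm (\<lambda>x. f (x + a)) = L2_norm f"
  using ip_shift[of f f a] L2_norm_sq by (metis L2_norm_nonneg power2_eq_iff_nonneg)

lemma L2_norm_minus: "L2_norm (\<lambda>x. - f x) = L2_norm f"
  by (simp add: L2_norm_def)

lemma L2_norm_minus_commute: "L2_norm (\<lambda>x. f x - g x) = L2_norm (\<lambda>x. g x - f x)"
  by (simp add: L2_norm_def norm_minus_commute)

lemma ip_abs_le: assumes "L2 f" "L2 g" shows "\<bar>ip f g\<bar> \<le> L2_norm f * L2_norm g"
proof (cases "ip g g = 0")
  case True
  then have "AE x in lborel. (norm (g x))\<^sup>2 = 0"
    using integral_nonneg_eq_0_iff_AE[OF L2_integrable[OF assms(2)]]
    by (simp add: ip_def power2_norm_eq_inner)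
  then have "AE x in lborel. f x \<bullet> g x = 0" by eventually_elim simp
  then have "ip f g = 0" unfolding ip_def by (rule integral_eq_zero_AE)
  then show ?thesis by (simp add: L2_norm_nonneg)
next
  case False
  have g0: "ip g g > 0" using False L2_norm_sq[of g] zero_le_power2[of "L2_norm g"] by linarith
  have "0 \<le> ip (\<lambda>x. ip g g *\<^sub>R f x - ip f g *\<^sub>R g x) (\<lambda>x. ip g g *\<^sub>R f x - ip f g *\<^sub>R g x)"
    using L2_norm_sq by (metis zero_le_power2)
  also have "\<dots> = ip g g * (ip f f * ip g g - (ip f g)\<^sup>2)"
    using assms by (simp add: ip_diff_left ip_diff_right ip_scaleR_left ip_scaleR_right L2_diff L2_cmult
        ip_commute[of g f] algebra_simps power2_eq_square)
  finally have "(ip f g)\<^sup>2 \<le> (L2_norm f * L2_norm g)\<^sup>2"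
    using g0 by (simp add: zero_le_mult_iff power_mult_distrib L2_norm_sq)
  then show ?thesis using L2_norm_nonneg abs_le_square_iff
    by (metis abs_of_nonneg mult_nonneg_nonneg)
qed

lemma L2_norm_add: assumes "L2 f" "L2 g" shows "L2_norm (\<lambda>x. f x + g x) \<le> L2_norm f + L2_norm g"
proof (rule power2_le_imp_le)
  have "(L2_norm (\<lambda>x. f x + g x))\<^sup>2 = ip f f + 2 * ip f g + ip g g"
    using assms by (simp add: L2_norm_sq ip_add_left ip_add_right L2_add ip_commute[of g f])
  also have "\<dots> \<le> ip f f + 2 * (L2_norm f * L2_norm g) + ip g g"
    using ip_abs_le[OF assms] by simp
  also have "\<dots> = (L2_norm f + L2_norm g)\<^sup>2"
    by (simp add: power2_sum L2_norm_sq)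
  finally show "(L2_norm (\<lambda>x. f x + g x))\<^sup>2 \<le> (L2_norm f + L2_norm g)\<^sup>2" .
qed (simp add: L2_norm_nonneg)

lemma L2_norm_diff: "L2 f \<Longrightarrow> L2 g \<Longrightarrow> L2_norm (\<lambda>x. f x - g x) \<le> L2_norm f + L2_norm g"
  using L2_norm_add[of f "\<lambda>x. - g x"] by (simp add: L2_uminus L2_norm_minus)

lemma L2_norm_triangle:
  assumes "L2 f" "L2 g" "L2 h"
  shows "L2_norm (\<lambda>x. f x - h x) \<le> L2_norm (\<lambda>x. f x - g x) + L2_norm (\<lambda>x. g x - h x)"
  using L2_norm_add[OF L2_diff[OF assms(1,2)] L2_diff[OF assms(2,3)]] by simp

lemma L2_norm_mono:
  assumes "L2 f" "g \<in> borel_measurable borel" "AE x in lborel. norm (g x) \<le> C * norm (f x)" "C \<ge> 0"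
  shows "L2_norm g \<le> C * L2_norm f"
proof -
  have "L2 g" by (rule L2_bound[OF assms(1-3)])
  have "(\<integral>x. (norm (g x))\<^sup>2 \<partial>lborel) \<le> (\<integral>x. C\<^sup>2 * (norm (f x))\<^sup>2 \<partial>lborel)"
  proof (rule integral_mono_AE)
    show "AE x in lborel. (norm (g x))\<^sup>2 \<le> C\<^sup>2 * (norm (f x))\<^sup>2"
      using assms(3) by eventually_elim (metis norm_ge_zero power_mono power_mult_distrib)
  qed (use \<open>L2 g\<close> assms(1) L2_integrable in auto)
  then have "L2_norm g \<le> sqrt (C\<^sup>2 * (\<integral>x. (norm (f x))\<^sup>2 \<partial>lborel))"
    unfolding L2_norm_def by (intro real_sqrt_le_mono) simp
  then show ?thesis using assms(4) by (simp add: L2_norm_def real_sqrt_mult)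
qed

text \<open>Both factors converge strongly along an arbitrary filter. This serves spatial difference
  quotients as h tends to 0 from the right as well as difference quotients in time.\<close>

lemma ip_tendsto:
  assumes f: "((\<lambda>s. L2_norm (\<lambda>x. f s x - f0 x)) \<longlongrightarrow> 0) F" and g: "((\<lambda>s. L2_norm (\<lambda>x. g s x - g0 x)) \<longlongrightarrow> 0) F"
    and L: "eventually (\<lambda>s. L2 (f s)) F" "eventually (\<lambda>s. L2 (g s)) F" "L2 f0" "L2 g0"
  shows "((\<lambda>s. ip (f s) (g s)) \<longlongrightarrow> ip f0 g0) F"
proof -
  let ?a = "\<lambda>s. L2_norm (\<lambda>x. f s x - f0 x)" and ?b = "\<lambda>s. L2_norm (\<lambda>x. g s x - g0 x)"
  have "((\<lambda>s. ip (f s) (g s) - ip f0 g0) \<longlongrightarrow> 0) F"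
  proof (rule tendsto_rabs_zero_cancel, rule tendsto_sandwich[OF _ _ tendsto_const])
    show "((\<lambda>s. ?a s * ?b s + ?a s * L2_norm g0 + L2_norm f0 * ?b s) \<longlongrightarrow> 0) F"
      by (rule tendsto_eq_intros f g | simp)+
    show "eventually (\<lambda>s. \<bar>ip (f s) (g s) - ip f0 g0\<bar> \<le> ?a s * ?b s + ?a s * L2_norm g0 + L2_norm f0 * ?b s) F"
      using L(1,2)
    proof eventually_elim
      case (elim s)
      have d: "L2 (\<lambda>x. f s x - f0 x)" "L2 (\<lambda>x. g s x - g0 x)" using elim L by (simp_all add: L2_diff)
      have "ip (f s) (g s) - ip f0 g0 = ip (\<lambda>x. f s x - f0 x) (\<lambda>x. g s x - g0 x)
          + ip (\<lambda>x. f s x - f0 x) g0 + ip f0 (\<lambda>x. g s x - g0 x)"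
        using elim L by (simp add: ip_diff_left ip_diff_right L2_diff)
      then show ?case
        using ip_abs_le[OF d] ip_abs_le[OF d(1) L(4)] ip_abs_le[OF L(3) d(2)] by linarith
    qed
  qed simp
  then show ?thesis by (simp add: LIM_zero_iff)
qed

lemma L2_imp_L1_loc: assumes "L2 f" shows "L1_loc f"
  unfolding L1_loc_def
proof (intro conjI allI impI)
  note [measurable] = L2_measurable[OF assms]
  show "f \<in> borel_measurable lborel" by simp
  fix K :: "(real^3) set" assume K: "compact K"
  then have [measurable]: "K \<in> sets borel" by (simp add: borel_compact)
  have "integrable lborel (\<lambda>x. indicator K x + (norm (f x))\<^sup>2)"
    using K L2_integrable[OF assms] emeasure_compact_finite[OF K]
    by (intro Bochner_Integration.integrable_add) (auto simp: integrable_indicator_iff)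
  then show "set_integrable lborel K f"
    unfolding set_integrable_def
  proof (rule Bochner_Integration.integrable_bound)
    have "norm (indicator K x *\<^sub>R f x) \<le> norm (indicator K x + (norm (f x))\<^sup>2)" for x
      using sum_squares_bound[of 1 "norm (f x)"] norm_ge_zero[of "f x"] by (simp add: indicator_def del: norm_ge_zero)
    then show "AE x in lborel. norm (indicator K x *\<^sub>R f x) \<le> norm (indicator K x + (norm (f x))\<^sup>2)" by simp
  qed simp
qed

section \<open>Weak derivatives and translations\<close>

lemma L1_loc_shift: 
  fixes f :: "real^3 \<Rightarrow> 'b::euclidean_space"
  assumes "L1_loc f" shows "L1_loc (\<lambda>x. f (x + a))"
  unfolding L1_loc_def
proof (intro conjI allI impI)
  note [measurable] = L1_locD(2)[OF assms]
  show "(\<lambda>x. f (x + a)) \<in> borel_measurable lborel" by simp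
  fix K :: "(real^3) set" assume K: "compact K"
  define K' where "K' = (\<lambda>x. x + a) ` K"
  have K': "compact K'" unfolding K'_def using K by (intro compact_continuous_image continuous_intros)
  then have [measurable]: "K' \<in> sets borel" by (simp add: borel_compact)
  have ind: "indicator K' (x + a) = (indicator K x :: real)" for x
    by (auto simp: K'_def indicator_def)
  have "integrable lborel (\<lambda>x. indicator K' x *\<^sub>R f x)"
    using L1_loc_set_integrable[OF assms K'] by (simp add: set_integrable_def)
  then have "integrable (distr lborel borel ((+) a)) (\<lambda>x. indicator K' x *\<^sub>R f x)"
    by (simp add: lborel_distr_plus)
  then have "integrable lborel (\<lambda>x. indicator K' (a + x) *\<^sub>R f (a + x))"
    by (subst (asm) integrable_distr_eq) auto
  then show "set_integrable lborel K (\<lambda>x. f (x + a))"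
    by (simp add: set_integrable_def add.commute[of a] ind)
qed

lemma L1_loc_add: "L1_loc f \<Longrightarrow> L1_loc g \<Longrightarrow> L1_loc (\<lambda>x. f x + g x)"
  unfolding L1_loc_def by (auto intro!: set_integral_add borel_measurable_add)

lemma L1_loc_cmult: "L1_loc f \<Longrightarrow> L1_loc (\<lambda>x. c *\<^sub>R f x)"
  unfolding L1_loc_def by (auto intro!: set_integrable_scaleR_right borel_measurable_scaleR)

lemma L1_loc_diff: "L1_loc f \<Longrightarrow> L1_loc g \<Longrightarrow> L1_loc (\<lambda>x. f x - g x)"
  using L1_loc_add[OF _ L1_loc_cmult[of g "-1"], of f] by simp

text \<open>Uniform L1 bounds on the slices give joint integrability because the strip has finite
  width: \<open>C * indicator {0..h}\<close> dominates the slice norms.\<close>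

lemma integrable_pair_strip:
  fixes f :: "real \<Rightarrow> real^3 \<Rightarrow> real"
  assumes [measurable]: "(\<lambda>(s, x). f s x) \<in> borel_measurable (lborel \<Otimes>\<^sub>M lborel)"
    and "\<And>s. s \<in> {0..h} \<Longrightarrow> integrable lborel (f s)"
    and "\<And>s. s \<in> {0..h} \<Longrightarrow> (\<integral>x. norm (f s x) \<partial>lborel) \<le> C"
    and "\<And>s x. s \<notin> {0..h} \<Longrightarrow> f s x = 0"
  shows "integrable (lborel \<Otimes>\<^sub>M lborel) (\<lambda>(s, x). f s x)"
proof (rule lborel_pair.Fubini_integrable)
  show "(\<lambda>(s, x). f s x) \<in> borel_measurable (lborel \<Otimes>\<^sub>M lborel)" by fact
  have i: "integrable lborel (f s)" for s
  proof (cases "s \<in> {0..h}")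
    case False
    then have "f s = (\<lambda>x. 0)" using assms(4) by auto
    then show ?thesis by simp
  qed (use assms(2) in simp)
  then show "AE s in lborel. integrable lborel (\<lambda>x. case (s, x) of (s, x) \<Rightarrow> f s x)" by simp
  have m: "(\<lambda>s. \<integral>x. norm (f s x) \<partial>lborel) \<in> borel_measurable lborel"
    by (intro lborel.borel_measurable_lebesgue_integral) simp
  have "integrable lborel (\<lambda>s. C * indicator {0..h} s)"
    by (intro integrable_mult_right) (simp add: integrable_indicator_iff emeasure_lborel_Icc_eq)
  then have "integrable lborel (\<lambda>s. \<integral>x. norm (f s x) \<partial>lborel)"
  proof (rule Bochner_Integration.integrable_bound[OF _ m])
    have "norm (\<integral>x. norm (f s x) \<partial>lborel) \<le> norm (C * indicator {0..h} s)" for s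
      using assms(3)[of s] assms(4)[of s] Bochner_Integration.integral_nonneg[of lborel "\<lambda>x. norm (f s x)"]
      by (cases "s \<in> {0..h}") auto
    then show "AE s in lborel. norm (\<integral>x. norm (f s x) \<partial>lborel) \<le> norm (C * indicator {0..h} s)" by simp
  qed
  then show "integrable lborel (\<lambda>s. \<integral>x. norm (case (s, x) of (s, x) \<Rightarrow> f s x) \<partial>lborel)" by simp
qed

abbreviation ax :: "3 \<Rightarrow> real^3" where "ax i \<equiv> axis i 1"

text \<open>Integrability for the two double integrals behind the translation formula. With c = 1
  the argument of g moves along \<open>ax i\<close>; with c = 0 it stays fixed and the cut-off moves
  instead. In both cases |c s| <= h, so only the values of g on the ball of radius r + h
  count.\<close>

lemma strip_integrable:
  fixes g :: "real^3 \<Rightarrow> real"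
  assumes g: "L1_loc g" and psi[measurable]: "(\<lambda>(s, x). \<psi> s x) \<in> borel_measurable (borel \<Otimes>\<^sub>M borel)"
    and z: "\<And>s x. s \<in> {0..h} \<Longrightarrow> norm x > r \<Longrightarrow> \<psi> s x = 0" and b: "\<And>s x. \<bar>\<psi> s x\<bar> \<le> M" and c: "\<bar>c\<bar> \<le> 1"
  shows "integrable (lborel \<Otimes>\<^sub>M lborel) (\<lambda>(s, x). indicator {0..h} s * (\<psi> s x * g (x + (c * s) *\<^sub>R ax i)))"
proof -
  define R where "R = r + h"
  define k where "k = (\<lambda>x. indicator (cball 0 R) x *\<^sub>R g x)"
  note [measurable] = L1_locD(2)[OF g]
  have k: "integrable lborel k" unfolding k_def by (rule L1_locD[OF g])
  have km [measurable]: "k \<in> borel_measurable borel" 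
    unfolding k_def by (intro borel_measurable_scaleR borel_measurable_indicator L1_locD(2)[OF g]) simp
  have psim [measurable]: "\<psi> s \<in> borel_measurable borel" for s
    using measurable_compose[OF measurable_Pair1' psi, of s] by simp
  have kshift: "integrable lborel (\<lambda>x. k (x + a))" for a
  proof -
    have "integrable (distr lborel borel ((+) a)) k" using k by (simp add: lborel_distr_plus)
    then show ?thesis by (subst (asm) integrable_distr_eq) (auto simp: add.commute)
  qed
  have M: "M \<ge> 0" using b[of 0 0] by linarith
  have bd: "norm (indicator {0..h} s * (\<psi> s x * g (x + (c * s) *\<^sub>R ax i))) \<le> M * norm (k (x + (c * s) *\<^sub>R ax i))"
    if s: "s \<in> {0..h}" for s x
  proof (cases "norm x > r")
    case True
    then show ?thesis using z[OF s] M by simp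
  next
    case False
    have "\<bar>c * s\<bar> \<le> h" using c s by (auto simp: abs_mult intro: mult_le_one order_trans[OF mult_left_le_one_le])
    then have "norm (x + (c * s) *\<^sub>R ax i) \<le> R"
      using False norm_triangle_ineq[of x "(c * s) *\<^sub>R ax i"] by (simp add: R_def)
    then have "k (x + (c * s) *\<^sub>R ax i) = g (x + (c * s) *\<^sub>R ax i)" by (simp add: k_def)
    then show ?thesis using s b[of s x] by (simp add: abs_mult mult_right_mono)
  qed
  show ?thesis
  proof (rule integrable_pair_strip[where h=h and C="M * (\<integral>x. norm (k x) \<partial>lborel)"])
    show "(\<lambda>(s, x). indicator {0..h} s * (\<psi> s x * g (x + (c * s) *\<^sub>R ax i))) \<in> borel_measurable (lborel \<Otimes>\<^sub>M lborel)"
      by measurable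
    show i: "integrable lborel (\<lambda>x. indicator {0..h} s * (\<psi> s x * g (x + (c * s) *\<^sub>R ax i)))" if s: "s \<in> {0..h}" for s
    proof (rule Bochner_Integration.integrable_bound)
      show "integrable lborel (\<lambda>x. M * norm (k (x + (c * s) *\<^sub>R ax i)))"
        by (intro integrable_mult_right integrable_norm kshift)
      show "AE x in lborel. norm (indicator {0..h} s * (\<psi> s x * g (x + (c * s) *\<^sub>R ax i))) \<le> norm (M * norm (k (x + (c * s) *\<^sub>R ax i)))"
        using order_trans[OF bd[OF s] abs_ge_self] by simp
    qed measurable
    show "(\<integral>x. norm (indicator {0..h} s * (\<psi> s x * g (x + (c * s) *\<^sub>R ax i))) \<partial>lborel) \<le> M * (\<integral>x. norm (k x) \<partial>lborel)"
      if s: "s \<in> {0..h}" for s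
    proof -
      have "(\<integral>x. norm (indicator {0..h} s * (\<psi> s x * g (x + (c * s) *\<^sub>R ax i))) \<partial>lborel)
          \<le> (\<integral>x. M * norm (k (x + (c * s) *\<^sub>R ax i)) \<partial>lborel)"
        by (intro integral_mono integrable_norm integrable_mult_right i kshift s bd)
      also have "\<dots> = M * (\<integral>x. norm (k x) \<partial>lborel)"
        using integral_shift[of "\<lambda>x. norm (k x)" "(c * s) *\<^sub>R ax i"] by simp
      finally show ?thesis .
    qed
  qed simp
qed

lemma test_function_FTC:
  assumes "test_function \<phi>" "h \<ge> 0"
  shows "\<phi> (x - h *\<^sub>R ax i) - \<phi> x = - (\<integral>s. indicator {0..h} s * pderiv_at i \<phi> (x - s *\<^sub>R ax i) \<partial>lborel)"
proof -
  have "(\<integral>s. (- pderiv_at i \<phi> (x - s *\<^sub>R ax i)) * indicator {0..h} s \<partial>lborel)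
      = \<phi> (x - h *\<^sub>R ax i) - \<phi> (x - 0 *\<^sub>R ax i)"
  proof (rule integral_FTC_Icc_real)
    fix s
    have "(\<phi> has_derivative frechet_derivative \<phi> (at (x - s *\<^sub>R ax i))) (at (x - s *\<^sub>R ax i))"
      using test_functionD(1)[OF assms(1)] by (simp add: frechet_derivative_works)
    moreover have "((\<lambda>s. x - s *\<^sub>R ax i) has_derivative (\<lambda>v. - v *\<^sub>R ax i)) (at s)"
      by (auto intro!: derivative_eq_intros)
    ultimately have d: "((\<lambda>s. \<phi> (x - s *\<^sub>R ax i)) has_derivative
        (\<lambda>v. frechet_derivative \<phi> (at (x - s *\<^sub>R ax i)) (- v *\<^sub>R ax i))) (at s)"
      by (rule has_derivative_compose[rotated])
    have "linear (frechet_derivative \<phi> (at (x - s *\<^sub>R ax i)))"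
      using test_functionD(1)[OF assms(1)] linear_frechet_derivative by blast
    then have "frechet_derivative \<phi> (at (x - s *\<^sub>R ax i)) (- v *\<^sub>R ax i) = (- pderiv_at i \<phi> (x - s *\<^sub>R ax i)) * v" for v
      using linear_cmul[of "frechet_derivative \<phi> (at (x - s *\<^sub>R ax i))" "- v" "ax i"]
      by (simp add: pderiv_at_def)
    then have eq: "(\<lambda>v. frechet_derivative \<phi> (at (x - s *\<^sub>R ax i)) (- v *\<^sub>R ax i)) = (*) (- pderiv_at i \<phi> (x - s *\<^sub>R ax i))"
      by blast
    show "DERIV (\<lambda>s. \<phi> (x - s *\<^sub>R ax i)) s :> - pderiv_at i \<phi> (x - s *\<^sub>R ax i)"
      using d unfolding eq has_field_derivative_def .
    have "continuous_on UNIV (\<lambda>s. - pderiv_at i \<phi> (x - s *\<^sub>R ax i))"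
      by (intro continuous_intros continuous_on_compose2[OF test_functionD(3)[OF assms(1)]]) auto
    then show "isCont (\<lambda>s. - pderiv_at i \<phi> (x - s *\<^sub>R ax i)) s"
      by (simp add: continuous_on_eq_continuous_at)
  qed (rule assms)
  then show ?thesis by (simp add: mult.commute)
qed

lemma has_weak_pderivD:
  assumes "has_weak_pderiv i f g"
  shows "L1_loc f" "L1_loc g" 
    "\<And>\<phi>. test_function \<phi> \<Longrightarrow> (\<integral>x. pderiv_at i \<phi> x *\<^sub>R f x \<partial>lborel) = - (\<integral>x. \<phi> x *\<^sub>R g x \<partial>lborel)"
  using assms unfolding has_weak_pderiv_def by blast+

lemma test_function_measurable:
  assumes "test_function \<phi>"
  shows "\<phi> \<in> borel_measurable borel" "pderiv_at i \<phi> \<in> borel_measurable borel"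
  using test_functionD[OF assms] by (auto intro: borel_measurable_continuous_onI)

lemma test_function_bounds:
  assumes "test_function \<phi>"
  obtains R M where "R > 0" "M > 0" "\<And>x. norm x > R \<Longrightarrow> \<phi> x = 0" "\<And>x. norm x > R \<Longrightarrow> pderiv_at i \<phi> x = 0"
    "\<And>x. \<bar>\<phi> x\<bar> \<le> M" "\<And>x. \<bar>pderiv_at i \<phi> x\<bar> \<le> M"
proof -
  obtain R where R: "R > 0" "\<And>x. norm x > R \<Longrightarrow> \<phi> x = 0" "\<And>x i. norm x > R \<Longrightarrow> pderiv_at i \<phi> x = 0"
    using test_function_bounded_support[OF assms] by metis
  obtain M1 where M1: "M1 > 0" "\<And>x. \<bar>\<phi> x\<bar> \<le> M1"
    using compact_support_bounded[OF test_functionD(2)[OF assms] R(2)] by metis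
  obtain M2 where M2: "M2 > 0" "\<And>x. \<bar>pderiv_at i \<phi> x\<bar> \<le> M2"
    using compact_support_bounded[OF test_functionD(3)[OF assms] R(3)] by metis
  show thesis
    using that[of R "M1 + M2"] R M1 M2 by (smt (verit))
qed

lemma integrable_test_mult:
  fixes f :: "real^3 \<Rightarrow> 'b::euclidean_space"
  assumes "test_function \<phi>" "L1_loc f"
  shows "integrable lborel (\<lambda>x. \<phi> x *\<^sub>R f x)" "integrable lborel (\<lambda>x. pderiv_at i \<phi> x *\<^sub>R f x)"
proof -
  obtain R M where "R > 0" "M > 0" "\<And>x. norm x > R \<Longrightarrow> \<phi> x = 0" "\<And>x. norm x > R \<Longrightarrow> pderiv_at i \<phi> x = 0"
    "\<And>x. \<bar>\<phi> x\<bar> \<le> M" "\<And>x. \<bar>pderiv_at i \<phi> x\<bar> \<le> M"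
    using test_function_bounds[OF assms(1)] by metis
  then show "integrable lborel (\<lambda>x. \<phi> x *\<^sub>R f x)" "integrable lborel (\<lambda>x. pderiv_at i \<phi> x *\<^sub>R f x)"
    by (auto intro!: integrable_mult_compact_support[OF assms(2)] test_function_measurable[OF assms(1)])
qed

text \<open>Tested against phi, the translation goes over to phi, where the classical fundamental
  theorem of calculus applies. Fubini, the definition of the weak derivative for a translated test
  function, translation back and Fubini again give the pairing of phi with the right-hand side, and
  the fundamental lemma removes phi. The exceptional null set may depend on h.\<close>

theorem weak_pderiv_shift_integral:
  fixes f g :: "real^3 \<Rightarrow> real"
  assumes w: "has_weak_pderiv i f g" and h: "h \<ge> 0"
  shows "AE x in lborel. f (x + h *\<^sub>R ax i) - f x = (\<integral>s. indicator {0..h} s * g (x + s *\<^sub>R ax i) \<partial>lborel)"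
proof -
  note f = has_weak_pderivD(1)[OF w] and g = has_weak_pderivD(2)[OF w]
  note fm[measurable] = L1_locD(2)[OF f] and gm[measurable] = L1_locD(2)[OF g]
  define G where "G x = (\<integral>s. indicator {0..h} s * g (x + s *\<^sub>R ax i) \<partial>lborel)" for x
  have Gm [measurable]: "G \<in> borel_measurable borel"
    unfolding G_def
    using lborel.borel_measurable_lebesgue_integral[of "\<lambda>x s. indicator {0..h} s * g (x + s *\<^sub>R ax i)" borel] by simp
  have "L1_loc G"
    unfolding L1_loc_def
  proof (intro conjI allI impI)
    show "G \<in> borel_measurable lborel" by simp
    fix K :: "(real^3) set" assume K: "compact K"
    then have [measurable]: "K \<in> sets borel" by (simp add: borel_compact)
    obtain r where r: "\<And>x. x \<in> K \<Longrightarrow> norm x \<le> r"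
      using compact_imp_bounded[OF K] bounded_pos by metis
    \<comment> \<open>Local integrability of the line integral \<open>G\<close> is Fubini over the
      strip, with the indicator of K as cut-off.\<close>
    have "integrable (lborel \<Otimes>\<^sub>M lborel) (\<lambda>(s, x). indicator {0..h} s * (indicator K x * g (x + (1 * s) *\<^sub>R ax i)))"
      by (rule strip_integrable[OF g, where r=r and M=1]) (auto simp: indicator_def dest: r)
    from lborel_pair.integrable_snd[OF this]
    have "integrable lborel (\<lambda>x. \<integral>s. indicator {0..h} s * (indicator K x * g (x + s *\<^sub>R ax i)) \<partial>lborel)" by simp
    moreover have "(\<integral>s. indicator {0..h} s * (indicator K x * g (x + s *\<^sub>R ax i)) \<partial>lborel) = indicator K x * G x" for x
      unfolding G_def by (cases "x \<in> K") auto
    ultimately show "set_integrable lborel K G" by (simp add: set_integrable_def)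
  qed
  have "AE x in lborel. (f (x + h *\<^sub>R ax i) - f x) - G x = 0"
  proof (rule fundamental_lemma_real)
    show "L1_loc (\<lambda>x. f (x + h *\<^sub>R ax i) - f x - G x)"
      by (intro L1_loc_diff L1_loc_shift f \<open>L1_loc G\<close>)
    fix \<phi> assume phi: "test_function \<phi>"
    note [measurable] = test_function_measurable[OF phi]
    obtain R M where R: "R > 0" "M > 0" "\<And>x. norm x > R \<Longrightarrow> \<phi> x = 0" "\<And>x. norm x > R \<Longrightarrow> pderiv_at i \<phi> x = 0"
      "\<And>x. \<bar>\<phi> x\<bar> \<le> M" "\<And>x. \<bar>pderiv_at i \<phi> x\<bar> \<le> M"
      using test_function_bounds[OF phi] by metis
    have phis: "test_function (\<lambda>x. \<phi> (x - s *\<^sub>R ax i))" for s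
      using test_function_shift[OF phi, of "- (s *\<^sub>R ax i)"] by simp
    have pphis: "pderiv_at i (\<lambda>x. \<phi> (x - s *\<^sub>R ax i)) x = pderiv_at i \<phi> (x - s *\<^sub>R ax i)" for s x
      using pderiv_at_shift[of \<phi> x "- (s *\<^sub>R ax i)"] test_functionD(1)[OF phi] by simp
    have far: "norm (x - s *\<^sub>R ax i) > R" if "s \<in> {0..h}" "norm x > R + h" for s x
      using that norm_triangle_ineq2[of x "s *\<^sub>R ax i"] by auto
    \<comment> \<open>Case c = 0: the translated test functions with 0 <= s <= h all vanish outside
      the ball of radius R + h.\<close>
    have i1: "integrable (lborel \<Otimes>\<^sub>M lborel) (\<lambda>(s, x). indicator {0..h} s * (pderiv_at i \<phi> (x - s *\<^sub>R ax i) * f (x + (0 * s) *\<^sub>R ax i)))"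
      by (rule strip_integrable[OF f, where r="R + h" and M=M]) (use R far in auto)
    have i2: "integrable (lborel \<Otimes>\<^sub>M lborel) (\<lambda>(s, x). indicator {0..h} s * (\<phi> x * g (x + (1 * s) *\<^sub>R ax i)))"
      by (rule strip_integrable[OF g, where r=R and M=M]) (use R in auto)
    have "(\<integral>x. \<phi> x * (f (x + h *\<^sub>R ax i) - f x) \<partial>lborel)
        = (\<integral>x. \<phi> x * f (x + h *\<^sub>R ax i) \<partial>lborel) - (\<integral>x. \<phi> x * f x \<partial>lborel)"
      using integrable_test_mult(1)[OF phi L1_loc_shift[OF f, of "h *\<^sub>R ax i"]] integrable_test_mult(1)[OF phi f]
      by (simp add: right_diff_distrib)
    also have "(\<integral>x. \<phi> x * f (x + h *\<^sub>R ax i) \<partial>lborel) = (\<integral>x. \<phi> (x - h *\<^sub>R ax i) * f x \<partial>lborel)"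
      using integral_shift[of "\<lambda>x. \<phi> (x - h *\<^sub>R ax i) * f x" "h *\<^sub>R ax i"] by simp
    also have "(\<integral>x. \<phi> (x - h *\<^sub>R ax i) * f x \<partial>lborel) - (\<integral>x. \<phi> x * f x \<partial>lborel)
        = (\<integral>x. (\<phi> (x - h *\<^sub>R ax i) - \<phi> x) * f x \<partial>lborel)"
      using integrable_test_mult(1)[OF phis f, of h] integrable_test_mult(1)[OF phi f]
      by (simp add: left_diff_distrib)
    also have "\<dots> = - (\<integral>x. (\<integral>s. indicator {0..h} s * (pderiv_at i \<phi> (x - s *\<^sub>R ax i) * f x) \<partial>lborel) \<partial>lborel)"
    proof -
      have "(\<phi> (x - h *\<^sub>R ax i) - \<phi> x) * f x = - (\<integral>s. indicator {0..h} s * (pderiv_at i \<phi> (x - s *\<^sub>R ax i) * f x) \<partial>lborel)" for x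
        unfolding test_function_FTC[OF phi h] mult.assoc[symmetric] by simp
      then show ?thesis by simp
    qed
    also have "(\<integral>x. (\<integral>s. indicator {0..h} s * (pderiv_at i \<phi> (x - s *\<^sub>R ax i) * f x) \<partial>lborel) \<partial>lborel)
        = (\<integral>s. (\<integral>x. indicator {0..h} s * (pderiv_at i \<phi> (x - s *\<^sub>R ax i) * f x) \<partial>lborel) \<partial>lborel)"
      using lborel_pair.Fubini_integral[OF i1] by simp
    also have "\<dots> = - (\<integral>s. (\<integral>x. indicator {0..h} s * (\<phi> x * g (x + s *\<^sub>R ax i)) \<partial>lborel) \<partial>lborel)"
    proof -
      have "(\<integral>x. pderiv_at i \<phi> (x - s *\<^sub>R ax i) * f x \<partial>lborel) = - (\<integral>x. \<phi> x * g (x + s *\<^sub>R ax i) \<partial>lborel)" for s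
      proof -
        have "(\<integral>x. pderiv_at i \<phi> (x - s *\<^sub>R ax i) * f x \<partial>lborel) = - (\<integral>x. \<phi> (x - s *\<^sub>R ax i) * g x \<partial>lborel)"
          using has_weak_pderivD(3)[OF w phis[of s]] by (simp add: pphis)
        then show ?thesis
          using integral_shift[of "\<lambda>x. \<phi> (x - s *\<^sub>R ax i) * g x" "s *\<^sub>R ax i"] by simp
      qed
      then show ?thesis by simp
    qed
    also have "(\<integral>s. (\<integral>x. indicator {0..h} s * (\<phi> x * g (x + s *\<^sub>R ax i)) \<partial>lborel) \<partial>lborel)
        = (\<integral>x. (\<integral>s. indicator {0..h} s * (\<phi> x * g (x + s *\<^sub>R ax i)) \<partial>lborel) \<partial>lborel)"
      using lborel_pair.Fubini_integral[OF i2] by simp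
    also have "\<dots> = (\<integral>x. \<phi> x * G x \<partial>lborel)"
      unfolding G_def mult.left_commute[of _ "\<phi> _"] by simp
    finally have eq: "(\<integral>x. \<phi> x * (f (x + h *\<^sub>R ax i) - f x) \<partial>lborel) = (\<integral>x. \<phi> x * G x \<partial>lborel)" by simp
    have "(\<integral>x. \<phi> x * (f (x + h *\<^sub>R ax i) - f x - G x) \<partial>lborel)
        = (\<integral>x. \<phi> x * (f (x + h *\<^sub>R ax i) - f x) \<partial>lborel) - (\<integral>x. \<phi> x * G x \<partial>lborel)"
      using integrable_test_mult(1)[OF phi L1_loc_diff[OF L1_loc_shift[OF f, of "h *\<^sub>R ax i"] f]] integrable_test_mult(1)[OF phi \<open>L1_loc G\<close>]
      by (simp add: right_diff_distrib)
    then show "(\<integral>x. \<phi> x * (f (x + h *\<^sub>R ax i) - f x - G x) \<partial>lborel) = 0" using eq by simp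
  qed
  then show ?thesis unfolding G_def by eventually_elim simp
qed

section \<open>Difference quotients\<close>

lemma nn_integral_L2: "L2 f \<Longrightarrow> (\<integral>\<^sup>+x. ennreal ((norm (f x))\<^sup>2) \<partial>lborel) = ennreal ((L2_norm f)\<^sup>2)"
  using nn_integral_eq_integral[OF L2_integrable, of f] by (simp add: L2_norm_def)

lemma L2I_nn:
  assumes [measurable]: "f \<in> borel_measurable borel"
    and le: "(\<integral>\<^sup>+x. ennreal ((norm (f x))\<^sup>2) \<partial>lborel) \<le> ennreal (c\<^sup>2)" and "c \<ge> 0"
  shows "L2 f" "L2_norm f \<le> c"
proof -
  have "(\<integral>\<^sup>+x. ennreal (norm ((norm (f x))\<^sup>2)) \<partial>lborel) < \<infinity>"
    using le_less_trans[OF le ennreal_less_top] by simp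
  then have "integrable lborel (\<lambda>x. (norm (f x))\<^sup>2)"
    unfolding integrable_iff_bounded by simp
  then show "L2 f" by (simp add: L2_def)
  from nn_integral_L2[OF this] le have "(L2_norm f)\<^sup>2 \<le> c\<^sup>2" by simp
  then show "L2_norm f \<le> c" using \<open>c \<ge> 0\<close> by (rule power2_le_imp_le)
qed

lemma L2_norm_dominated:
  fixes g :: "nat \<Rightarrow> real^3 \<Rightarrow> 'b::euclidean_space" and w :: "real^3 \<Rightarrow> 'c::euclidean_space"
  assumes [measurable]: "\<And>n. g n \<in> borel_measurable borel" and w: "L2 w"
    and b: "\<And>n. AE x in lborel. norm (g n x) \<le> norm (w x)"
    and lim: "AE x in lborel. (\<lambda>n. g n x) \<longlonglongrightarrow> 0"
  shows "(\<lambda>n. L2_norm (g n)) \<longlonglongrightarrow> 0"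
proof -
  have "(\<lambda>n. \<integral>x. (norm (g n x))\<^sup>2 \<partial>lborel) \<longlonglongrightarrow> (\<integral>x. 0 \<partial>(lborel :: (real^3) measure))"
  proof (rule integral_dominated_convergence)
    show "integrable lborel (\<lambda>x. (norm (w x))\<^sup>2)" by (rule L2_integrable[OF w])
    show "AE x in lborel. (\<lambda>n. (norm (g n x))\<^sup>2) \<longlonglongrightarrow> 0"
      using lim by eventually_elim (auto intro!: tendsto_eq_intros tendsto_norm_zero)
    show "AE x in lborel. norm ((norm (g n x))\<^sup>2) \<le> (norm (w x))\<^sup>2" for n
      using b[of n] by eventually_elim (simp add: power_mono)
  qed measurable
  then have "(\<lambda>n. sqrt (\<integral>x. (norm (g n x))\<^sup>2 \<partial>lborel)) \<longlonglongrightarrow> sqrt 0"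
    by (intro tendsto_real_sqrt) simp
  then show ?thesis by (simp add: L2_norm_def)
qed

section \<open>Density of continuous functions with compact support, and continuity of translations
  in L2\<close>

lemma L2_indicator_cball: "L2 (\<lambda>x. c * indicator (cball 0 R) x :: real)"
proof -
  have i: "integrable lborel (\<lambda>x::real^3. c\<^sup>2 * indicator (cball 0 R) x :: real)"
    using emeasure_compact_finite[OF compact_cball[of "0::real^3" R]]
    by (intro integrable_mult_right) (simp add: integrable_indicator_iff less_top)
  have e: "(norm (c * indicator (cball 0 R) x))\<^sup>2 = c\<^sup>2 * indicator (cball 0 R) x" for x :: "real^3"
    by (simp add: indicator_def power_mult_distrib)
  have m: "(\<lambda>x. c * indicator (cball 0 R) x :: real) \<in> borel_measurable borel"
    by (intro borel_measurable_times borel_measurable_const borel_measurable_indicator) simp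
  show ?thesis unfolding L2_def e using i m by simp
qed

lemma L2_compact_support:
  fixes k :: "real^3 \<Rightarrow> real"
  assumes "k \<in> borel_measurable borel" "\<And>x. norm x > R \<Longrightarrow> k x = 0" "\<And>x. \<bar>k x\<bar> \<le> M"
  shows "L2 k"
proof (rule L2_bound[OF L2_indicator_cball assms(1)])
  show "AE x in lborel. norm (k x) \<le> 1 * norm (M * indicator (cball 0 R) x :: real)"
    using assms(2) order_trans[OF assms(3) abs_ge_self] by (auto simp: indicator_def not_le)
qed

text \<open>Two approximations. Clamping the values to [-n, n] and cutting off outside a ball keeps
  f close in L2. Measurability then supplies continuous functions converging to f almost everywhere,
  and the same clamp and cut-off applied to them provides the dominating function for the limit in
  L2.\<close>

lemma L2_cc_approx:
  fixes f :: "real^3 \<Rightarrow> real"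
  assumes f: "L2 f" and e: "e > 0"
  obtains k R M where "continuous_on UNIV k" "\<And>x. norm x > R \<Longrightarrow> k x = 0" "\<And>x. \<bar>k x\<bar> \<le> M" "L2 k"
    "L2_norm (\<lambda>x. f x - k x) < e"
proof -
  define cl where "cl n y = max (- real n) (min (real n) y)" for n :: nat and y :: real
  define chi where "chi n x = max 0 (min 1 (real n + 1 - norm x))" for n :: nat and x :: "real^3"
  have fm [measurable]: "f \<in> borel_measurable borel" by (rule L2_measurable[OF f])
  have chic: "continuous_on UNIV (chi n)" for n unfolding chi_def by (intro continuous_intros)
  have chi0: "chi n x = 0" if "norm x > real n + 1" for n x using that by (simp add: chi_def)
  have chib: "0 \<le> chi n x" "chi n x \<le> 1" for n x by (auto simp: chi_def)
  have [measurable]: "chi n \<in> borel_measurable borel" for n using chic by (rule borel_measurable_continuous_onI)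
  have [measurable]: "cl n \<in> borel_measurable borel" for n unfolding cl_def by measurable
  have clb: "\<bar>cl n y\<bar> \<le> \<bar>y\<bar>" "\<bar>cl n y\<bar> \<le> real n" for n y by (auto simp: cl_def)
  have ccb: "\<bar>chi n x * cl n y\<bar> \<le> real n" for n x y
    using mult_mono[OF chib(2)[of n x] clb(2)[of n y]] chib[of n x] by (simp add: abs_mult)
  let ?F = "\<lambda>n x. chi n x * cl n (f x)"
  have "(\<lambda>n. L2_norm (\<lambda>x. f x - ?F n x)) \<longlonglongrightarrow> 0"
  proof (rule L2_norm_dominated)
    show "L2 (\<lambda>x. 2 *\<^sub>R f x)" by (rule L2_cmult[OF f])
    have "\<bar>chi n x * cl n (f x)\<bar> \<le> \<bar>f x\<bar>" for n x
      using mult_mono[OF chib(2)[of n x] clb(1)[of n "f x"]] chib[of n x] by (simp add: abs_mult)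
    then have "norm (f x - ?F n x) \<le> norm (2 *\<^sub>R f x)" for n x
      using order_trans[OF abs_triangle_ineq4 add_left_mono, of "?F n x" "\<bar>f x\<bar>" "f x"]
      by (simp add: abs_mult)
    then show "AE x in lborel. norm (f x - ?F n x) \<le> norm (2 *\<^sub>R f x)" for n by simp
    have "(\<lambda>n. f x - ?F n x) \<longlonglongrightarrow> 0" for x
    proof -
      obtain N where N: "norm x + \<bar>f x\<bar> < real N" using reals_Archimedean2 by blast
      have "f x - ?F n x = 0" if "n \<ge> N" for n
      proof -
        have "norm x + \<bar>f x\<bar> < real n" using N that by (smt (verit) of_nat_le_iff)
        then have "norm x < real n" "\<bar>f x\<bar> < real n"
          using norm_ge_zero[of x] abs_ge_zero[of "f x"] by linarith+
        then have "chi n x = 1" "cl n (f x) = f x"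
          by (auto simp: chi_def cl_def abs_less_iff max_def min_def)
        then show ?thesis by simp
      qed
      then have "eventually (\<lambda>n. f x - ?F n x = 0) sequentially"
        unfolding eventually_sequentially by blast
      then show ?thesis by (rule tendsto_eventually)
    qed
    then show "AE x in lborel. (\<lambda>n. f x - ?F n x) \<longlonglongrightarrow> 0" by simp
  qed measurable
  then have "eventually (\<lambda>n. L2_norm (\<lambda>x. f x - ?F n x) < e / 2) sequentially"
    using e by (intro order_tendstoD) auto
  then obtain n where n: "L2_norm (\<lambda>x. f x - ?F n x) < e / 2"
    by (meson eventually_sequentially order_refl)
  \<comment> \<open>\<open>measurable_on\<close> unfolds to a sequence of continuous functions
    converging to f off a negligible set.\<close>
  have "f measurable_on UNIV"
    by (intro lebesgue_measurable_imp_measurable_on_real measurable_completion) auto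
  then obtain N g where N: "negligible N" and gc: "\<And>m. continuous_on UNIV (g m)"
    and lim: "\<And>x. x \<notin> N \<Longrightarrow> (\<lambda>m. g m x) \<longlonglongrightarrow> f x"
    unfolding measurable_on_def by auto
  have "AE x in lebesgue. x \<notin> N"
    using N by (intro AE_not_in) (simp add: negligible_iff_null_sets)
  then have aeN: "AE x in lborel. x \<notin> N" by (simp add: AE_completion_iff)
  let ?k = "\<lambda>m x. chi n x * cl n (g m x)"
  have kc: "continuous_on UNIV (?k m)" for m
    unfolding cl_def by (intro continuous_intros chic gc)
  have km [measurable]: "?k m \<in> borel_measurable borel" for m by (rule borel_measurable_continuous_onI[OF kc])
  have L2F: "L2 (?F n)" by (rule L2_compact_support[OF _ _ ccb, where R="real n + 1"]) (measurable, simp add: chi0)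
  have L2k: "L2 (?k m)" for m by (rule L2_compact_support[OF km _ ccb, where R="real n + 1"]) (simp add: chi0)
  have "(\<lambda>m. L2_norm (\<lambda>x. ?F n x - ?k m x)) \<longlonglongrightarrow> 0"
  proof (rule L2_norm_dominated)
    show "L2 (\<lambda>x. (2 * real n) * indicator (cball 0 (real n + 1)) x :: real)" by (rule L2_indicator_cball)
    have "norm (?F n x - ?k m x) \<le> norm ((2 * real n) * indicator (cball 0 (real n + 1)) x :: real)" for m x
    proof (cases "norm x > real n + 1")
      case True then show ?thesis by (simp add: chi0)
    next
      case False
      then show ?thesis using ccb[of n x "f x"] ccb[of n x "g m x"] by simp
    qed
    then show "AE x in lborel. norm (?F n x - ?k m x) \<le> norm ((2 * real n) * indicator (cball 0 (real n + 1)) x :: real)" for m by simp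
    show "AE x in lborel. (\<lambda>m. ?F n x - ?k m x) \<longlonglongrightarrow> 0"
      using aeN
    proof eventually_elim
      case (elim x)
      have "(\<lambda>m. cl n (g m x)) \<longlonglongrightarrow> cl n (f x)"
        unfolding cl_def by (intro tendsto_intros lim elim)
      then have "(\<lambda>m. ?F n x - ?k m x) \<longlonglongrightarrow> ?F n x - chi n x * cl n (f x)"
        by (intro tendsto_intros)
      then show ?case by simp
    qed
  qed measurable
  then have "eventually (\<lambda>m. L2_norm (\<lambda>x. ?F n x - ?k m x) < e / 2) sequentially"
    using e by (intro order_tendstoD) auto
  then obtain m where m: "L2_norm (\<lambda>x. ?F n x - ?k m x) < e / 2"
    by (meson eventually_sequentially order_refl)
  have *: "L2_norm (\<lambda>x. f x - ?k m x) < e"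
    using L2_norm_triangle[OF f L2F L2k, of m] n m by linarith
  show thesis
    by (rule that[where R="real n + 1", OF kc _ ccb L2k *]) (simp add: chi0)
qed

text \<open>An epsilon/3 argument: translation is an isometry of L2, and for a continuous function
  of compact support the claim is dominated convergence, since along a bounded sequence of shifts
  all differences live in one ball.\<close>

lemma L2_shift_continuous:
  fixes f :: "real^3 \<Rightarrow> real"
  assumes f: "L2 f"
  shows "((\<lambda>a. L2_norm (\<lambda>x. f (x + a) - f x)) \<longlongrightarrow> 0) (at 0)"
proof (rule tendstoI)
  fix e :: real assume e: "e > 0"
  obtain k R M where k: "continuous_on UNIV k" "\<And>x. norm x > R \<Longrightarrow> k x = 0" "\<And>x. \<bar>k x\<bar> \<le> M" "L2 k"
    and fk: "L2_norm (\<lambda>x. f x - k x) < e / 3"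
    using L2_cc_approx[OF f, of "e / 3"] e by auto
  have km [measurable]: "k \<in> borel_measurable borel" by (rule L2_measurable[OF k(4)])
  have "((\<lambda>a. L2_norm (\<lambda>x. k (x + a) - k x)) \<longlongrightarrow> 0) (at 0)"
    unfolding tendsto_at_iff_sequentially comp_def
  proof (intro allI impI)
    fix X :: "nat \<Rightarrow> real^3" assume X: "X \<longlonglongrightarrow> 0"
    then have "Bseq X" using convergentI convergent_imp_Bseq by blast
    then obtain B where B: "B > 0" "\<And>n. norm (X n) \<le> B" unfolding Bseq_def by blast
    show "(\<lambda>n. L2_norm (\<lambda>x. k (x + X n) - k x)) \<longlonglongrightarrow> 0"
    proof (rule L2_norm_dominated)
      show "L2 (\<lambda>x. (2 * M) * indicator (cball 0 (R + B)) x :: real)" by (rule L2_indicator_cball)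
      have "norm (k (x + X n) - k x) \<le> norm ((2 * M) * indicator (cball 0 (R + B)) x :: real)" for n x
      proof (cases "norm x > R + B")
        case True
        then have "norm (x + X n) > R" "norm x > R"
          using B(1) B(2)[of n] norm_diff_ineq[of x "X n"] by linarith+
        then show ?thesis using k(2) by simp
      next
        case False
        then show ?thesis using k(3)[of x] k(3)[of "x + X n"] by simp
      qed
      then show "AE x in lborel. norm (k (x + X n) - k x) \<le> norm ((2 * M) * indicator (cball 0 (R + B)) x :: real)" for n by simp
      have "(\<lambda>n. k (x + X n) - k x) \<longlonglongrightarrow> 0" for x
      proof -
        have "isCont k x" using k(1) by (simp add: continuous_on_eq_continuous_at)
        moreover have "(\<lambda>n. x + X n) \<longlonglongrightarrow> x" using tendsto_add[OF tendsto_const X, of x] by simp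
        ultimately have "(\<lambda>n. k (x + X n)) \<longlonglongrightarrow> k x" by (rule isCont_tendsto_compose)
        then show ?thesis by (simp add: LIM_zero)
      qed
      then show "AE x in lborel. (\<lambda>n. k (x + X n) - k x) \<longlonglongrightarrow> 0" by simp
    qed measurable
  qed
  then have "eventually (\<lambda>a. L2_norm (\<lambda>x. k (x + a) - k x) < e / 3) (at 0)"
    using e by (intro order_tendstoD) auto
  then show "eventually (\<lambda>a. dist (L2_norm (\<lambda>x. f (x + a) - f x)) 0 < e) (at 0)"
  proof eventually_elim
    case (elim a)
    have "L2_norm (\<lambda>x. f (x + a) - k (x + a)) = L2_norm (\<lambda>x. f x - k x)"
      by (rule L2_norm_shift[of "\<lambda>x. f x - k x"]) (intro L2_diff f k)
    moreover have "L2_norm (\<lambda>x. k x - f x) = L2_norm (\<lambda>x. f x - k x)"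
      by (rule L2_norm_minus_commute)
    moreover have "L2_norm (\<lambda>x. f (x + a) - f x) \<le> L2_norm (\<lambda>x. f (x + a) - k (x + a))
        + L2_norm (\<lambda>x. k (x + a) - f x)"
      by (intro L2_norm_triangle L2_shift f k)
    moreover have "L2_norm (\<lambda>x. k (x + a) - f x) \<le> L2_norm (\<lambda>x. k (x + a) - k x) + L2_norm (\<lambda>x. k x - f x)"
      by (intro L2_norm_triangle L2_shift f k)
    ultimately show ?case using elim fk L2_norm_nonneg[of "\<lambda>x. f (x + a) - f x"] by simp
  qed
qed

lemma L2_shift_tendsto:
  fixes f :: "real^3 \<Rightarrow> real"
  assumes f: "L2 f"
  shows "((\<lambda>h. L2_norm (\<lambda>x. f (x + h *\<^sub>R ax i) - f x)) \<longlongrightarrow> 0) (at_right 0)"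
proof (rule filterlim_compose[OF L2_shift_continuous[OF f]])
  have "((\<lambda>h. h *\<^sub>R ax i) \<longlongrightarrow> 0 *\<^sub>R ax i) (at_right (0::real))"
    by (intro tendsto_intros)
  moreover have "eventually (\<lambda>h. h *\<^sub>R ax i \<noteq> 0) (at_right (0::real))"
    by (auto simp: eventually_at_filter axis_eq_0_iff)
  ultimately show "filterlim (\<lambda>h. h *\<^sub>R ax i) (at 0) (at_right (0::real))"
    by (simp add: filterlim_at)
qed

definition dq :: "3 \<Rightarrow> real \<Rightarrow> (real^3 \<Rightarrow> real) \<Rightarrow> real^3 \<Rightarrow> real" where
  "dq i h f x = (f (x + h *\<^sub>R ax i) - f x) / h"

text \<open>\<open>dq i h f - g\<close> is the mean over 0 <= s <= h of g(x + s e_i) - g(x).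
  Cauchy-Schwarz in s and Tonelli bound its L2 norm by a common bound for the norms at fixed s. Only
  g enters the estimate, so it is available for an f that is not square integrable.\<close>

lemma dq_L2_bound:
  fixes f g :: "real^3 \<Rightarrow> real"
  assumes w: "has_weak_pderiv i f g" and g: "L2 g" and h: "h > 0"
    and e: "\<And>s. s \<in> {0..h} \<Longrightarrow> L2_norm (\<lambda>x. g (x + s *\<^sub>R ax i) - g x) \<le> e"
  shows "L2 (\<lambda>x. dq i h f x - g x)" "L2_norm (\<lambda>x. dq i h f x - g x) \<le> e"
proof -
  have fm [measurable]: "f \<in> borel_measurable borel" and gm [measurable]: "g \<in> borel_measurable borel"
    using has_weak_pderivD[OF w] L1_locD(2) by blast+
  have m [measurable]: "(\<lambda>x. dq i h f x - g x) \<in> borel_measurable borel" unfolding dq_def by measurable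
  have e0: "e \<ge> 0" using e[of 0] h L2_norm_nonneg[of "\<lambda>x. g (x + 0 *\<^sub>R ax i) - g x"] by simp
  let ?W = "\<lambda>x s. indicator {0..h} s * (g (x + s *\<^sub>R ax i) - g x)"
  have ind: "(\<integral>\<^sup>+s. ennreal ((indicator {0..h} s)\<^sup>2) \<partial>lborel) = ennreal h"
  proof -
    have "(\<integral>\<^sup>+s. ennreal ((indicator {0..h} s)\<^sup>2) \<partial>lborel) = (\<integral>\<^sup>+s. indicator {0..h} s \<partial>lborel)"
      by (intro nn_integral_cong) (simp add: indicator_def)
    then show ?thesis using h by simp
  qed
  have pt: "ennreal ((norm (dq i h f x - g x))\<^sup>2) \<le> ennreal (1 / h) * (\<integral>\<^sup>+s. ennreal ((?W x s)\<^sup>2) \<partial>lborel)"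
    if eq: "f (x + h *\<^sub>R ax i) - f x = (\<integral>s. indicator {0..h} s * g (x + s *\<^sub>R ax i) \<partial>lborel)" for x
  \<comment> \<open>An infinite inner integral makes the claim trivial. A finite one makes the line
    integrand integrable, which is what splitting the Bochner integral requires.\<close>
  proof (cases "(\<integral>\<^sup>+s. ennreal ((?W x s)\<^sup>2) \<partial>lborel) = \<infinity>")
    case True
    then show ?thesis using h by (simp add: ennreal_mult_eq_top_iff)
  next
    case False
    let ?A = "\<integral>\<^sup>+s. ennreal (norm (?W x s)) \<partial>lborel" and ?B = "\<integral>\<^sup>+s. ennreal ((?W x s)\<^sup>2) \<partial>lborel"
    have AA: "?A = (\<integral>\<^sup>+s. ennreal (norm (?W x s)) * ennreal (indicator {0..h} s) \<partial>lborel)"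
      by (intro nn_integral_cong) (simp add: indicator_def)
    have "?A\<^sup>2 \<le> (\<integral>\<^sup>+s. (ennreal (norm (?W x s)))\<^sup>2 \<partial>lborel) * (\<integral>\<^sup>+s. (ennreal (indicator {0..h} s))\<^sup>2 \<partial>lborel)"
      unfolding AA by (rule Cauchy_Schwarz_nn_integral) measurable
    also have "\<dots> = ?B * ennreal h"
      using ind by (simp add: ennreal_power)
    finally have A2: "?A\<^sup>2 \<le> ?B * ennreal h" .
    have "?B * ennreal h < top" using False by (simp add: ennreal_mult_less_top less_top)
    then have "?A\<^sup>2 < top" using A2 by (rule le_less_trans[rotated])
    then have "?A < \<infinity>" by (auto simp: power2_eq_square ennreal_mult_less_top)
    then have iW: "integrable lborel (?W x)" unfolding integrable_iff_bounded by simp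
    have iI: "integrable lborel (\<lambda>s. indicator {0..h} s * g x)"
      by (intro integrable_mult_left) (simp add: integrable_indicator_iff emeasure_lborel_Icc_eq)
    have "(\<integral>s. indicator {0..h} s * g (x + s *\<^sub>R ax i) \<partial>lborel) = (\<integral>s. ?W x s + indicator {0..h} s * g x \<partial>lborel)"
      by (intro Bochner_Integration.integral_cong) (auto simp: algebra_simps)
    also have "\<dots> = (\<integral>s. ?W x s \<partial>lborel) + h * g x"
      using iW iI h by (simp add: Bochner_Integration.integral_add)
    finally have "dq i h f x - g x = (1 / h) * (\<integral>s. ?W x s \<partial>lborel)"
      using h by (simp add: dq_def eq field_simps)
    then have n: "norm (dq i h f x - g x) = (1 / h) * norm (\<integral>s. ?W x s \<partial>lborel)"
      using h by (simp add: abs_mult)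
    have "ennreal ((norm (dq i h f x - g x))\<^sup>2) = ennreal ((1 / h)\<^sup>2) * (ennreal (norm (\<integral>s. ?W x s \<partial>lborel)))\<^sup>2"
      unfolding n power_mult_distrib by (simp add: ennreal_mult ennreal_power)
    also have "\<dots> \<le> ennreal ((1 / h)\<^sup>2) * ?A\<^sup>2"
      by (intro mult_left_mono power_mono integral_norm_bound_ennreal iW) auto
    also have "\<dots> \<le> ennreal ((1 / h)\<^sup>2) * (?B * ennreal h)"
      by (intro mult_left_mono A2) simp
    also have "\<dots> = ennreal ((1 / h)\<^sup>2) * ennreal h * ?B" by (simp add: mult_ac)
    also have "ennreal ((1 / h)\<^sup>2) * ennreal h = ennreal (1 / h)"
      using h by (simp flip: ennreal_mult add: power2_eq_square)
    finally show ?thesis .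
  qed
  have "AE x in lborel. ennreal ((norm (dq i h f x - g x))\<^sup>2) \<le> ennreal (1 / h) * (\<integral>\<^sup>+s. ennreal ((?W x s)\<^sup>2) \<partial>lborel)"
    using weak_pderiv_shift_integral[OF w less_imp_le[OF h]] by eventually_elim (rule pt)
  then have "(\<integral>\<^sup>+x. ennreal ((norm (dq i h f x - g x))\<^sup>2) \<partial>lborel)
      \<le> (\<integral>\<^sup>+x. ennreal (1 / h) * (\<integral>\<^sup>+s. ennreal ((?W x s)\<^sup>2) \<partial>lborel) \<partial>lborel)"
    by (rule nn_integral_mono_AE)
  also have "\<dots> = ennreal (1 / h) * (\<integral>\<^sup>+x. (\<integral>\<^sup>+s. ennreal ((?W x s)\<^sup>2) \<partial>lborel) \<partial>lborel)"
    by (rule nn_integral_cmult) measurable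
  also have "(\<integral>\<^sup>+x. (\<integral>\<^sup>+s. ennreal ((?W x s)\<^sup>2) \<partial>lborel) \<partial>lborel) = (\<integral>\<^sup>+s. (\<integral>\<^sup>+x. ennreal ((?W x s)\<^sup>2) \<partial>lborel) \<partial>lborel)"
    by (rule lborel_pair.Fubini') measurable
  also have "\<dots> \<le> (\<integral>\<^sup>+s. ennreal (e\<^sup>2) * indicator {0..h} s \<partial>lborel)"
  proof (intro nn_integral_mono)
    fix s :: real
    show "(\<integral>\<^sup>+x. ennreal ((?W x s)\<^sup>2) \<partial>lborel) \<le> ennreal (e\<^sup>2) * indicator {0..h} s"
    proof (cases "s \<in> {0..h}")
      case True
      have L: "L2 (\<lambda>x. g (x + s *\<^sub>R ax i) - g x)" by (intro L2_diff L2_shift g)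
      have "(\<integral>\<^sup>+x. ennreal ((?W x s)\<^sup>2) \<partial>lborel) = ennreal ((L2_norm (\<lambda>x. g (x + s *\<^sub>R ax i) - g x))\<^sup>2)"
        using nn_integral_L2[OF L] True by simp
      also have "\<dots> \<le> ennreal (e\<^sup>2)"
        by (intro ennreal_leI power_mono e True L2_norm_nonneg)
      finally show ?thesis using True by simp
    qed simp
  qed
  also have "\<dots> = ennreal (e\<^sup>2) * ennreal h"
    using h by (simp add: nn_integral_cmult_indicator)
  finally have "(\<integral>\<^sup>+x. ennreal ((norm (dq i h f x - g x))\<^sup>2) \<partial>lborel) \<le> ennreal (1 / h) * (ennreal (e\<^sup>2) * ennreal h)"
    by (simp add: mult_left_mono)
  also have "\<dots> = ennreal (e\<^sup>2)" using h by (simp flip: ennreal_mult)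
  finally have *: "(\<integral>\<^sup>+x. ennreal ((norm (dq i h f x - g x))\<^sup>2) \<partial>lborel) \<le> ennreal (e\<^sup>2)" .
  show "L2 (\<lambda>x. dq i h f x - g x)" "L2_norm (\<lambda>x. dq i h f x - g x) \<le> e"
    using L2I_nn[OF m * e0] by blast+
qed

text \<open>The crude bound 2 |g| for the difference of g and its translate already suffices. This
  will be applied to a pressure of unknown integrability.\<close>

lemma L2_dq:
  assumes w: "has_weak_pderiv i f g" and g: "L2 g" and h: "h > 0"
  shows "L2 (dq i h f)"
proof -
  have "L2_norm (\<lambda>x. g (x + s *\<^sub>R ax i) - g x) \<le> 2 * L2_norm g" for s
    using L2_norm_diff[OF L2_shift[OF g, of "s *\<^sub>R ax i"] g] L2_norm_shift[OF g, of "s *\<^sub>R ax i"] by simp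
  then have "L2 (\<lambda>x. dq i h f x - g x)" by (intro dq_L2_bound[OF w g h])
  from L2_add[OF this g] show ?thesis by simp
qed

theorem dq_tendsto:
  assumes w: "has_weak_pderiv i f g" and g: "L2 g"
  shows "((\<lambda>h. L2_norm (\<lambda>x. dq i h f x - g x)) \<longlongrightarrow> 0) (at_right 0)"
proof (rule tendstoI)
  fix e :: real assume e: "e > 0"
  have "eventually (\<lambda>h. L2_norm (\<lambda>x. g (x + h *\<^sub>R ax i) - g x) < e / 2) (at_right 0)"
    using L2_shift_tendsto[OF g] e by (intro order_tendstoD) auto
  then obtain b where b: "b > 0" "\<And>s. s > 0 \<Longrightarrow> s < b \<Longrightarrow> L2_norm (\<lambda>x. g (x + s *\<^sub>R ax i) - g x) < e / 2"
    unfolding eventually_at_right_field by blast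
  have "L2_norm (\<lambda>x. dq i h f x - g x) < e" if "0 < h" "h < b" for h
  proof -
    have "L2_norm (\<lambda>x. g (x + s *\<^sub>R ax i) - g x) \<le> e / 2" if "s \<in> {0..h}" for s
      using b(2)[of s] that \<open>h < b\<close> e by (cases "s = 0") (auto simp: L2_norm_def)
    then have "L2_norm (\<lambda>x. dq i h f x - g x) \<le> e / 2" by (intro dq_L2_bound[OF w g \<open>0 < h\<close>])
    then show ?thesis using e by linarith
  qed
  then show "eventually (\<lambda>h. dist (L2_norm (\<lambda>x. dq i h f x - g x)) 0 < e) (at_right 0)"
    unfolding eventually_at_right_field using b(1) by (auto simp: L2_norm_nonneg)
qed

section \<open>Calculus of weak derivatives\<close>

text \<open>Covers at one stroke components, scalar multiples, and inner and cross products with a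
  fixed vector.\<close>

lemma has_weak_pderiv_bounded_linear:
  fixes f g :: "real^3 \<Rightarrow> 'b::euclidean_space" and A :: "'b \<Rightarrow> 'c::euclidean_space"
  assumes A: "bounded_linear A" and w: "has_weak_pderiv i f g"
  shows "has_weak_pderiv i (\<lambda>x. A (f x)) (\<lambda>x. A (g x))"
proof -
  interpret A: bounded_linear A by fact
  have L: "L1_loc (\<lambda>x. A (k x))" if "L1_loc k" for k :: "real^3 \<Rightarrow> 'b"
    unfolding L1_loc_def
  proof (intro conjI allI impI)
    show "(\<lambda>x. A (k x)) \<in> borel_measurable lborel"
      using measurable_compose[OF L1_locD(2)[OF that] borel_measurable_continuous_onI[OF linear_continuous_on[OF A, of UNIV]]]
      by simp
    fix K :: "(real^3) set" assume "compact K"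
    then have "set_integrable lborel K k" by (rule L1_loc_set_integrable[OF that])
    then have "integrable lborel (\<lambda>x. A (indicator K x *\<^sub>R k x))"
      unfolding set_integrable_def by (rule integrable_bounded_linear[OF A])
    then show "set_integrable lborel K (\<lambda>x. A (k x))"
      unfolding set_integrable_def by (simp add: A.scaleR)
  qed
  note f = has_weak_pderivD(1)[OF w] and g = has_weak_pderivD(2)[OF w]
  show ?thesis
    unfolding has_weak_pderiv_def
  proof (intro conjI allI impI L f g)
    fix \<phi> assume phi: "test_function \<phi>"
    have "(\<integral>x. pderiv_at i \<phi> x *\<^sub>R A (f x) \<partial>lborel) = A (\<integral>x. pderiv_at i \<phi> x *\<^sub>R f x \<partial>lborel)"
      using integral_bounded_linear[OF A integrable_test_mult(2)[OF phi f, of i]] by (simp add: A.scaleR)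
    moreover have "(\<integral>x. \<phi> x *\<^sub>R A (g x) \<partial>lborel) = A (\<integral>x. \<phi> x *\<^sub>R g x \<partial>lborel)"
      using integral_bounded_linear[OF A integrable_test_mult(1)[OF phi g]] by (simp add: A.scaleR)
    ultimately show "(\<integral>x. pderiv_at i \<phi> x *\<^sub>R A (f x) \<partial>lborel) = - (\<integral>x. \<phi> x *\<^sub>R A (g x) \<partial>lborel)"
      using has_weak_pderivD(3)[OF w phi] by (simp add: A.neg)
  qed
qed

lemma has_weak_pderiv_add:
  assumes w: "has_weak_pderiv i f f'" "has_weak_pderiv i g g'"
  shows "has_weak_pderiv i (\<lambda>x. f x + g x) (\<lambda>x. f' x + g' x)"
  unfolding has_weak_pderiv_def
proof (intro conjI allI impI L1_loc_add)
  note L = has_weak_pderivD(1,2)[OF w(1)] has_weak_pderivD(1,2)[OF w(2)]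
  show "L1_loc f" "L1_loc f'" "L1_loc g" "L1_loc g'" by (rule L)+
  fix \<phi> assume phi: "test_function \<phi>"
  show "(\<integral>x. pderiv_at i \<phi> x *\<^sub>R (f x + g x) \<partial>lborel) = - (\<integral>x. \<phi> x *\<^sub>R (f' x + g' x) \<partial>lborel)"
    using integrable_test_mult(1)[OF phi L(2)] integrable_test_mult(1)[OF phi L(4)]
      integrable_test_mult(2)[OF phi L(1), of i] integrable_test_mult(2)[OF phi L(3), of i]
      has_weak_pderivD(3)[OF w(1) phi] has_weak_pderivD(3)[OF w(2) phi]
    by (simp add: scaleR_add_right)
qed

lemma has_weak_pderiv_scaleR:
  "has_weak_pderiv i f g \<Longrightarrow> has_weak_pderiv i (\<lambda>x. c *\<^sub>R f x) (\<lambda>x. c *\<^sub>R g x)"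
  by (rule has_weak_pderiv_bounded_linear[OF bounded_linear_scaleR_right])

lemma has_weak_pderiv_diff:
  "has_weak_pderiv i f f' \<Longrightarrow> has_weak_pderiv i g g' \<Longrightarrow>
    has_weak_pderiv i (\<lambda>x. f x - g x) (\<lambda>x. f' x - g' x)"
  using has_weak_pderiv_add[OF _ has_weak_pderiv_scaleR[of i g g' "-1"]] by simp

lemma has_weak_pderiv_zero: "has_weak_pderiv i (\<lambda>x. 0) (\<lambda>x. 0)"
  by (simp add: has_weak_pderiv_def L2_imp_L1_loc L2_zero)

lemma has_weak_pderiv_sum:
  "finite A \<Longrightarrow> (\<And>k. k \<in> A \<Longrightarrow> has_weak_pderiv i (f k) (f' k)) \<Longrightarrow>
    has_weak_pderiv i (\<lambda>x. \<Sum>k\<in>A. f k x) (\<lambda>x. \<Sum>k\<in>A. f' k x)"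
  by (induction A rule: finite_induct) (auto simp: has_weak_pderiv_zero has_weak_pderiv_add)

lemma L1_loc_cong_AE:
  assumes "L1_loc f" "g \<in> borel_measurable borel" "AE x in lborel. f x = g x"
  shows "L1_loc g"
  unfolding L1_loc_def
proof (intro conjI allI impI)
  note [measurable] = L1_locD(2)[OF assms(1)] assms(2)
  show "g \<in> borel_measurable lborel" by simp
  fix K :: "(real^3) set" assume K: "compact K"
  then have [measurable]: "K \<in> sets borel" by (simp add: borel_compact)
  have "set_integrable lborel K f" by (rule L1_loc_set_integrable[OF assms(1) K])
  then show "set_integrable lborel K g"
    unfolding set_integrable_def
    by (subst (asm) integrable_cong_AE[where g="\<lambda>x. indicator K x *\<^sub>R g x"]) (use assms(3) in auto)
qed

lemma has_weak_pderiv_cong_AE: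
  assumes w: "has_weak_pderiv i f g"
    and m: "f' \<in> borel_measurable borel" "g' \<in> borel_measurable borel"
    and ae: "AE x in lborel. f x = f' x" "AE x in lborel. g x = g' x"
  shows "has_weak_pderiv i f' g'"
  unfolding has_weak_pderiv_def
proof (intro conjI allI impI)
  note L = has_weak_pderivD(1,2)[OF w]
  show "L1_loc f'" "L1_loc g'"
    using L1_loc_cong_AE[OF L(1) m(1) ae(1)] L1_loc_cong_AE[OF L(2) m(2) ae(2)] by auto
  note [measurable] = L1_locD(2)[OF L(1)] L1_locD(2)[OF L(2)] m
  fix \<phi> assume phi: "test_function \<phi>"
  note [measurable] = test_function_measurable[OF phi]
  have "(\<integral>x. pderiv_at i \<phi> x *\<^sub>R f' x \<partial>lborel) = (\<integral>x. pderiv_at i \<phi> x *\<^sub>R f x \<partial>lborel)"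
    using ae(1) by (intro integral_cong_AE) auto
  moreover have "(\<integral>x. \<phi> x *\<^sub>R g' x \<partial>lborel) = (\<integral>x. \<phi> x *\<^sub>R g x \<partial>lborel)"
    using ae(2) by (intro integral_cong_AE) auto
  ultimately show "(\<integral>x. pderiv_at i \<phi> x *\<^sub>R f' x \<partial>lborel) = - (\<integral>x. \<phi> x *\<^sub>R g' x \<partial>lborel)"
    using has_weak_pderivD(3)[OF w phi] by simp
qed

lemma has_weak_pderiv_shift:
  fixes f g :: "real^3 \<Rightarrow> 'b::euclidean_space"
  assumes w: "has_weak_pderiv i f g"
  shows "has_weak_pderiv i (\<lambda>x. f (x + a)) (\<lambda>x. g (x + a))"
  unfolding has_weak_pderiv_def
proof (intro conjI allI impI L1_loc_shift)
  note L = has_weak_pderivD(1,2)[OF w]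
  show "L1_loc f" "L1_loc g" by (rule L)+
  note [measurable] = L1_locD(2)[OF L(1)] L1_locD(2)[OF L(2)]
  fix \<phi> assume phi: "test_function \<phi>"
  note [measurable] = test_function_measurable[OF phi]
  have phis: "test_function (\<lambda>x. \<phi> (x - a))"
    using test_function_shift[OF phi, of "- a"] by simp
  have "pderiv_at i (\<lambda>x. \<phi> (x - a)) x = pderiv_at i \<phi> (x - a)" for x
    using pderiv_at_shift[of \<phi> x "- a"] test_functionD(1)[OF phi] by simp
  then have "(\<integral>x. pderiv_at i \<phi> (x - a) *\<^sub>R f x \<partial>lborel) = - (\<integral>x. \<phi> (x - a) *\<^sub>R g x \<partial>lborel)"
    using has_weak_pderivD(3)[OF w phis] by simp
  then show "(\<integral>x. pderiv_at i \<phi> x *\<^sub>R f (x + a) \<partial>lborel) = - (\<integral>x. \<phi> x *\<^sub>R g (x + a) \<partial>lborel)"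
    using integral_shift[of "\<lambda>x. pderiv_at i \<phi> (x - a) *\<^sub>R f x" a] integral_shift[of "\<lambda>x. \<phi> (x - a) *\<^sub>R g x" a]
    by simp
qed

lemma has_weak_pderiv_dq:
  assumes w: "has_weak_pderiv i f g"
  shows "has_weak_pderiv i (dq j h f) (dq j h g)"
proof -
  have "dq j h k = (\<lambda>x. (1 / h) *\<^sub>R (k (x + h *\<^sub>R ax j) - k x))" for k
    by (auto simp: dq_def)
  then show ?thesis
    using has_weak_pderiv_scaleR[OF has_weak_pderiv_diff[OF has_weak_pderiv_shift[OF w, of "h *\<^sub>R ax j"] w], of "1 / h"] by simp
qed

text \<open>The difference is a weak derivative of 0. Its inner product with each basis vector is
  real-valued, which is the case that the fundamental lemma handles.\<close>

lemma weak_pderiv_unique: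
  fixes f :: "real^3 \<Rightarrow> 'b::euclidean_space"
  assumes w: "has_weak_pderiv i f g" "has_weak_pderiv i f g'"
  shows "AE x in lborel. g x = g' x"
proof -
  have d: "has_weak_pderiv i (\<lambda>x. 0) (\<lambda>x. g x - g' x)"
    using has_weak_pderiv_diff[OF w] by simp
  have "AE x in lborel. (g x - g' x) \<bullet> b = 0" for b
  proof (rule fundamental_lemma_real)
    have d': "has_weak_pderiv i (\<lambda>x. 0) (\<lambda>x. (g x - g' x) \<bullet> b)"
      using has_weak_pderiv_bounded_linear[OF bounded_linear_inner_left d, of b] by simp
    show "L1_loc (\<lambda>x. (g x - g' x) \<bullet> b)" by (rule has_weak_pderivD[OF d'])
    show "(\<integral>x. \<phi> x * ((g x - g' x) \<bullet> b) \<partial>lborel) = 0" if "test_function \<phi>" for \<phi>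
      using has_weak_pderivD(3)[OF d' that] by simp
  qed
  then have "AE x in lborel. \<forall>b\<in>Basis. (g x - g' x) \<bullet> b = 0"
    by (intro AE_finite_allI) auto
  then show ?thesis
  proof eventually_elim
    case (elim x)
    then have "g x - g' x = 0" using euclidean_all_zero_iff by blast
    then show ?case by simp
  qed
qed

lemma wpderiv_works: "has_weak_pderiv i f g \<Longrightarrow> has_weak_pderiv i f (wpderiv i f)"
  unfolding wpderiv_def by (rule someI[of "has_weak_pderiv i f" g])

lemma wpderiv_AE: "has_weak_pderiv i f g \<Longrightarrow> AE x in lborel. wpderiv i f x = g x"
  using weak_pderiv_unique wpderiv_works by blast

section \<open>Integration by parts, symmetry of second derivatives and the product rule\<close>

lemma ip_discrete_product:
  fixes f g :: "real^3 \<Rightarrow> real"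
  assumes "L2 f" "L2 g" "h > 0"
  shows "ip (dq i h f) (\<lambda>x. g (x + h *\<^sub>R ax i)) + ip f (dq i h g) = 0"
proof -
  let ?f = "\<lambda>x. f (x + h *\<^sub>R ax i)" and ?g = "\<lambda>x. g (x + h *\<^sub>R ax i)"
  have L: "L2 ?f" "L2 ?g" using assms by (simp_all add: L2_shift)
  have e: "dq i h k = (\<lambda>x. (1 / h) *\<^sub>R (k (x + h *\<^sub>R ax i) - k x))" for k
    by (auto simp: dq_def)
  have "ip (dq i h f) ?g = (1 / h) * (ip ?f ?g - ip f ?g)"
    unfolding e using assms L by (simp only: ip_scaleR_left ip_diff_left)
  moreover have "ip f (dq i h g) = (1 / h) * (ip f ?g - ip f g)"
    unfolding e using assms L by (simp only: ip_scaleR_right ip_diff_right)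
  \<comment> \<open>The two terms telescope to the difference of the integrals of f g and of its
    translate, divided by h; translation invariance makes it 0.\<close>
  moreover have "ip ?f ?g = ip f g" by (rule ip_shift[OF assms(1,2)])
  ultimately show ?thesis by (simp add: right_diff_distrib)
qed

lemma L2_dq_of_L2: "L2 f \<Longrightarrow> L2 (dq i h f)"
proof -
  assume f: "L2 f"
  have e: "dq i h f = (\<lambda>x. (1 / h) *\<^sub>R (f (x + h *\<^sub>R ax i) - f x))"
    by (auto simp: dq_def)
  show ?thesis unfolding e by (intro L2_cmult L2_diff L2_shift f)
qed

lemma at_right_pos: "eventually (\<lambda>h. h > 0) (at_right (0::real))"
  by (auto simp: eventually_at_filter)

text \<open>The limit of the discrete product rule as h tends to 0. Difference quotients and
  translations converge strongly in L2, so the defining identity of weak derivatives extends from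
  test functions to square integrable factors.\<close>

theorem weak_integration_by_parts_real:
  fixes f f' g g' :: "real^3 \<Rightarrow> real"
  assumes w: "has_weak_pderiv i f f'" "has_weak_pderiv i g g'" and L: "L2 f" "L2 f'" "L2 g" "L2 g'"
  shows "ip f' g = - ip f g'"
proof -
  have "((\<lambda>h. ip (dq i h f) (\<lambda>x. g (x + h *\<^sub>R ax i)) + ip f (dq i h g)) \<longlongrightarrow> ip f' g + ip f g') (at_right 0)"
    by (intro tendsto_add ip_tendsto dq_tendsto w L L2_shift_tendsto always_eventually allI L2_dq_of_L2 L2_shift)
      (simp add: L2_norm_def)
  moreover have "((\<lambda>h. ip (dq i h f) (\<lambda>x. g (x + h *\<^sub>R ax i)) + ip f (dq i h g)) \<longlongrightarrow> 0) (at_right 0)"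
  proof (rule tendsto_eventually)
    show "eventually (\<lambda>h. ip (dq i h f) (\<lambda>x. g (x + h *\<^sub>R ax i)) + ip f (dq i h g) = 0) (at_right 0)"
      using at_right_pos by eventually_elim (rule ip_discrete_product[OF L(1) L(3)])
  qed
  ultimately have "ip f' g + ip f g' = 0"
    using tendsto_unique trivial_limit_at_right_real by blast
  then show ?thesis by simp
qed

text \<open>This is the distributional identity \<open>\<partial>\<^sub>i \<partial>\<^sub>j p = \<partial>\<^sub>j \<partial>\<^sub>i p\<close>. The function \<open>p\<close> itself need not be
  square integrable, but its difference quotients are.\<close>

theorem weak_gradient_symmetric:
  fixes p :: "real^3 \<Rightarrow> real"
  assumes p: "has_weak_pderiv i p pi'" "has_weak_pderiv j p pj'" "L2 pi'" "L2 pj'"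
    and phi: "has_weak_pderiv i \<phi> \<phi>i" "has_weak_pderiv j \<phi> \<phi>j" "L2 \<phi>" "L2 \<phi>i" "L2 \<phi>j"
  shows "ip pi' \<phi>j = ip pj' \<phi>i"
proof -
  have lim1: "((\<lambda>h. ip (dq j h p) \<phi>i) \<longlongrightarrow> ip pj' \<phi>i) (at_right 0)"
  proof (rule ip_tendsto)
    show "eventually (\<lambda>h. L2 (dq j h p)) (at_right 0)"
      using at_right_pos by eventually_elim (rule L2_dq[OF p(2) p(4)])
    show "((\<lambda>h. L2_norm (\<lambda>x. \<phi>i x - \<phi>i x)) \<longlongrightarrow> 0) (at_right (0::real))" by (simp add: L2_norm_def)
  qed (use dq_tendsto[OF p(2) p(4)] phi p in auto)
  have lim2: "((\<lambda>h. ip (\<lambda>x. pi' (x + h *\<^sub>R ax j)) (dq j h \<phi>)) \<longlongrightarrow> ip pi' \<phi>j) (at_right 0)"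
    by (intro ip_tendsto dq_tendsto phi p L2_shift_tendsto always_eventually allI L2_dq_of_L2 L2_shift)
  \<comment> \<open>The difference quotient in direction j replaces p by a square integrable
    function, to which integration by parts in direction i applies; the discrete product rule then
    moves the quotient from \<open>pi'\<close> over to the other factor.\<close>
  have ev: "eventually (\<lambda>h. ip (dq j h p) \<phi>i = ip (\<lambda>x. pi' (x + h *\<^sub>R ax j)) (dq j h \<phi>)) (at_right 0)"
    using at_right_pos
  proof eventually_elim
    case (elim h)
    have "ip (dq j h pi') \<phi> = - ip (dq j h p) \<phi>i"
      by (rule weak_integration_by_parts_real[OF has_weak_pderiv_dq[OF p(1)] phi(1) L2_dq[OF p(2) p(4) elim] L2_dq_of_L2[OF p(3)] phi(3,4)])
    moreover have "ip (dq j h \<phi>) (\<lambda>x. pi' (x + h *\<^sub>R ax j)) + ip \<phi> (dq j h pi') = 0"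
      by (rule ip_discrete_product[OF phi(3) p(3) elim])
    ultimately show ?case by (simp add: ip_commute)
  qed
  have lim3: "((\<lambda>h. ip (\<lambda>x. pi' (x + h *\<^sub>R ax j)) (dq j h \<phi>)) \<longlongrightarrow> ip pj' \<phi>i) (at_right 0)"
    by (rule Lim_transform_eventually[OF lim1 ev])
  show ?thesis by (rule tendsto_unique[OF trivial_limit_at_right_real lim2 lim3])
qed

lemma L2_test_function:
  assumes "test_function \<phi>" shows "L2 \<phi>" "L2 (pderiv_at i \<phi>)"
proof -
  obtain R M where "R > 0" "M > 0" "\<And>x. norm x > R \<Longrightarrow> \<phi> x = 0" "\<And>x. norm x > R \<Longrightarrow> pderiv_at i \<phi> x = 0"
    "\<And>x. \<bar>\<phi> x\<bar> \<le> M" "\<And>x. \<bar>pderiv_at i \<phi> x\<bar> \<le> M"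
    using test_function_bounds[OF assms] by metis
  then show "L2 \<phi>" "L2 (pderiv_at i \<phi>)"
    by (auto intro!: L2_compact_support test_function_measurable assms)
qed

text \<open>Difference quotients in direction j commute with the weak derivative in direction i. The
  defining identity for \<open>dq j h f\<close> and a test function passes to the limit on both
  sides.\<close>

lemma weak_pderiv_commute_real:
  fixes f :: "real^3 \<Rightarrow> real"
  assumes w: "has_weak_pderiv i f fi" "has_weak_pderiv j f fj" "has_weak_pderiv j fi fij"
    and L: "L2 f" "L2 fi" "L2 fj" "L2 fij"
  shows "has_weak_pderiv i fj fij"
  unfolding has_weak_pderiv_def
proof (intro conjI allI impI)
  show "L1_loc fj" "L1_loc fij" using L by (simp_all add: L2_imp_L1_loc)
  fix \<phi> assume phi: "test_function \<phi>"
  have z: "((\<lambda>h. L2_norm (\<lambda>x. k x - k x)) \<longlongrightarrow> 0) (at_right (0::real))" for k :: "real^3 \<Rightarrow> real"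
    by (simp add: L2_norm_def)
  have 1: "((\<lambda>h. ip (dq j h f) (pderiv_at i \<phi>)) \<longlongrightarrow> ip fj (pderiv_at i \<phi>)) (at_right 0)"
    by (intro ip_tendsto dq_tendsto w L z always_eventually allI L2_dq_of_L2 L2_test_function phi)
  have 2: "((\<lambda>h. - ip (dq j h fi) \<phi>) \<longlongrightarrow> - ip fij \<phi>) (at_right 0)"
    by (intro tendsto_minus ip_tendsto dq_tendsto w L z always_eventually allI L2_dq_of_L2 L2_test_function phi)
  have "ip (dq j h f) (pderiv_at i \<phi>) = - ip (dq j h fi) \<phi>" for h
    using has_weak_pderivD(3)[OF has_weak_pderiv_dq[OF w(1), of j h] phi]
    by (simp add: ip_def mult.commute)
  then have "ip fj (pderiv_at i \<phi>) = - ip fij \<phi>"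
    using tendsto_unique[OF trivial_limit_at_right_real 1] 2 by simp
  then show "(\<integral>x. pderiv_at i \<phi> x *\<^sub>R fj x \<partial>lborel) = - (\<integral>x. \<phi> x *\<^sub>R fij x \<partial>lborel)"
    by (simp add: ip_def mult.commute)
qed

lemma L1_loc_bounded_mult:
  fixes f :: "real^3 \<Rightarrow> real"
  assumes f: "L1_loc f" and [measurable]: "\<psi> \<in> borel_measurable borel" and b: "\<And>x. \<bar>\<psi> x\<bar> \<le> M"
  shows "L1_loc (\<lambda>x. \<psi> x * f x)"
  unfolding L1_loc_def
proof (intro conjI allI impI)
  note [measurable] = L1_locD(2)[OF f]
  show "(\<lambda>x. \<psi> x * f x) \<in> borel_measurable lborel" by measurable
  fix K :: "(real^3) set" assume K: "compact K"
  then have [measurable]: "K \<in> sets borel" by (simp add: borel_compact)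
  have "integrable lborel (\<lambda>x. M * (indicator K x *\<^sub>R f x))"
    using L1_loc_set_integrable[OF f K] unfolding set_integrable_def by (rule integrable_mult_right)
  then show "set_integrable lborel K (\<lambda>x. \<psi> x * f x)"
    unfolding set_integrable_def
  proof (rule Bochner_Integration.integrable_bound)
    have "norm (indicator K x *\<^sub>R (\<psi> x * f x)) \<le> norm (M * (indicator K x *\<^sub>R f x))" for x
      using mult_right_mono[OF order_trans[OF b[of x] abs_ge_self], of "\<bar>f x\<bar>"] by (simp add: indicator_def abs_mult)
    then show "AE x in lborel. norm (indicator K x *\<^sub>R (\<psi> x * f x)) \<le> norm (M * (indicator K x *\<^sub>R f x))" by simp
  qed simp
qed

text \<open>An intermediate product rule, obtained from the classical one for two test functions.
  With it \<open>\<phi> * g\<close> can be the second factor in an integration by parts.\<close>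

lemma has_weak_pderiv_test_mult:
  fixes g :: "real^3 \<Rightarrow> real"
  assumes w: "has_weak_pderiv i g g'" and phi: "test_function \<phi>"
  shows "has_weak_pderiv i (\<lambda>x. \<phi> x * g x) (\<lambda>x. pderiv_at i \<phi> x * g x + \<phi> x * g' x)"
  unfolding has_weak_pderiv_def
proof (intro conjI allI impI)
  note L = has_weak_pderivD(1,2)[OF w]
  obtain R M where b: "\<And>x. \<bar>\<phi> x\<bar> \<le> M" "\<And>x. \<bar>pderiv_at i \<phi> x\<bar> \<le> M"
    using test_function_bounds[OF phi] by metis
  have m: "L1_loc (\<lambda>x. \<phi> x * g x)" "L1_loc (\<lambda>x. pderiv_at i \<phi> x * g x)" "L1_loc (\<lambda>x. \<phi> x * g' x)"
    by (intro L1_loc_bounded_mult[where M=M] b test_function_measurable phi L)+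
  show "L1_loc (\<lambda>x. \<phi> x * g x)" by (rule m)
  show "L1_loc (\<lambda>x. pderiv_at i \<phi> x * g x + \<phi> x * g' x)" by (intro L1_loc_add m)
  fix \<psi> assume psi: "test_function \<psi>"
  have "pderiv_at i \<psi> x * (\<phi> x * g x) = pderiv_at i (\<lambda>x. \<psi> x * \<phi> x) x * g x - \<psi> x * (pderiv_at i \<phi> x * g x)" for x
    using pderiv_at_mult[of \<psi> x \<phi> i] test_functionD(1)[OF phi] test_functionD(1)[OF psi] by (simp add: algebra_simps)
  then have "(\<integral>x. pderiv_at i \<psi> x * (\<phi> x * g x) \<partial>lborel)
     = (\<integral>x. pderiv_at i (\<lambda>x. \<psi> x * \<phi> x) x * g x \<partial>lborel) - (\<integral>x. \<psi> x * (pderiv_at i \<phi> x * g x) \<partial>lborel)"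
    using integrable_test_mult(2)[OF test_function_mult[OF psi phi] L(1), of i] integrable_test_mult(1)[OF psi m(2)]
    by simp
  also have "\<dots> = - (\<integral>x. \<psi> x * (\<phi> x * g' x) \<partial>lborel) - (\<integral>x. \<psi> x * (pderiv_at i \<phi> x * g x) \<partial>lborel)"
    using has_weak_pderivD(3)[OF w test_function_mult[OF psi phi]] by (simp add: mult.assoc)
  also have "\<dots> = - (\<integral>x. \<psi> x * (pderiv_at i \<phi> x * g x + \<phi> x * g' x) \<partial>lborel)"
    using integrable_test_mult(1)[OF psi m(2)] integrable_test_mult(1)[OF psi m(3)] by (simp add: distrib_left)
  finally show "(\<integral>x. pderiv_at i \<psi> x *\<^sub>R (\<phi> x * g x) \<partial>lborel) = - (\<integral>x. \<psi> x *\<^sub>R (pderiv_at i \<phi> x * g x + \<phi> x * g' x) \<partial>lborel)"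
    by simp
qed

lemma L1_loc_mult_L2:
  fixes f g :: "real^3 \<Rightarrow> real"
  assumes "L2 f" "L2 g" shows "L1_loc (\<lambda>x. f x * g x)"
  unfolding L1_loc_def
proof (intro conjI allI impI)
  have i: "integrable lborel (\<lambda>x. f x * g x)" using L2_inner_integrable[OF assms] by simp
  then show "(\<lambda>x. f x * g x) \<in> borel_measurable lborel" by simp
  fix K :: "(real^3) set" assume "compact K"
  then show "set_integrable lborel K (\<lambda>x. f x * g x)"
    unfolding set_integrable_def by (intro integrable_mult_indicator i) (simp add: borel_compact)
qed

lemma L2_test_mult:
  fixes g :: "real^3 \<Rightarrow> real"
  assumes "test_function \<phi>" "L2 g"
  shows "L2 (\<lambda>x. \<phi> x * g x)" "L2 (\<lambda>x. pderiv_at i \<phi> x * g x)"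
proof -
  obtain R M where b: "\<And>x. \<bar>\<phi> x\<bar> \<le> M" "\<And>x. \<bar>pderiv_at i \<phi> x\<bar> \<le> M"
    using test_function_bounds[OF assms(1)] by metis
  note [measurable] = test_function_measurable[OF assms(1)] L2_measurable[OF assms(2)]
  show "L2 (\<lambda>x. \<phi> x * g x)" "L2 (\<lambda>x. pderiv_at i \<phi> x * g x)"
    by (rule L2_bound[OF assms(2), where C=M], measurable, simp add: abs_mult b mult_right_mono)+
qed

text \<open>Testing f g with phi is the same as pairing f with phi g, so the claim is integration by
  parts for f against phi g. The product and its derivative are merely integrable, which is enough
  for \<open>has_weak_pderiv\<close>.\<close>

theorem has_weak_pderiv_mult:
  fixes f g :: "real^3 \<Rightarrow> real"
  assumes w: "has_weak_pderiv i f f'" "has_weak_pderiv i g g'" and L: "L2 f" "L2 f'" "L2 g" "L2 g'"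
  shows "has_weak_pderiv i (\<lambda>x. f x * g x) (\<lambda>x. f' x * g x + f x * g' x)"
  unfolding has_weak_pderiv_def
proof (intro conjI allI impI L1_loc_add L1_loc_mult_L2 L)
  fix \<phi> assume phi: "test_function \<phi>"
  note M = L2_test_mult[OF phi L(3)] L2_test_mult[OF phi L(4)]
  have "ip f' (\<lambda>x. \<phi> x * g x) = - ip f (\<lambda>x. pderiv_at i \<phi> x * g x + \<phi> x * g' x)"
    by (rule weak_integration_by_parts_real[OF w(1) has_weak_pderiv_test_mult[OF w(2) phi] L(1,2) M(1) L2_add[OF M(2) M(3)]])
  also have "ip f (\<lambda>x. pderiv_at i \<phi> x * g x + \<phi> x * g' x) = ip f (\<lambda>x. pderiv_at i \<phi> x * g x) + ip f (\<lambda>x. \<phi> x * g' x)"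
    by (rule ip_add_right[OF L(1) M(2) M(3)])
  finally have e: "ip f (\<lambda>x. pderiv_at i \<phi> x * g x) = - (ip f' (\<lambda>x. \<phi> x * g x) + ip f (\<lambda>x. \<phi> x * g' x))" by simp
  have "ip f' (\<lambda>x. \<phi> x * g x) + ip f (\<lambda>x. \<phi> x * g' x) = (\<integral>x. \<phi> x * (f' x * g x + f x * g' x) \<partial>lborel)"
    unfolding ip_def using L2_inner_integrable[OF L(2) M(1)] L2_inner_integrable[OF L(1) M(3)]
    by (subst Bochner_Integration.integral_add[symmetric]) (auto intro!: Bochner_Integration.integral_cong simp: algebra_simps)
  moreover have "ip f (\<lambda>x. pderiv_at i \<phi> x * g x) = (\<integral>x. pderiv_at i \<phi> x * (f x * g x) \<partial>lborel)"
    unfolding ip_def by (intro Bochner_Integration.integral_cong) auto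
  ultimately show "(\<integral>x. pderiv_at i \<phi> x *\<^sub>R (f x * g x) \<partial>lborel) = - (\<integral>x. \<phi> x *\<^sub>R (f' x * g x + f x * g' x) \<partial>lborel)"
    using e by simp
qed

section \<open>Weak convergence of translates to 0, and orthogonality of gradients to
  divergence-free fields\<close>

lemma ip_shift_tendsto_0:
  fixes f g :: "real^3 \<Rightarrow> real"
  assumes f: "L2 f" and g: "L2 g"
  shows "(\<lambda>n. ip f (\<lambda>x. g (x + real n *\<^sub>R ax i))) \<longlonglongrightarrow> 0"
proof -
  \<comment> \<open>Half of the translation length: if |x| < n/2 then |x + n e_i| > n/2, so at every
    point either f or the translate of g is evaluated in its tail, and L2 tails tend to 0.\<close>
  define far where "far n = {x::real^3. real n / 2 \<le> norm x}" for n :: nat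
  have [measurable]: "far n \<in> sets borel" for n
    unfolding far_def by (intro borel_closed closed_Collect_le continuous_intros)
  have tail: "L2 (\<lambda>x. indicator (far n) x * k x)" "(\<lambda>n. L2_norm (\<lambda>x. indicator (far n) x * k x)) \<longlonglongrightarrow> 0"
    if k: "L2 k" for k :: "real^3 \<Rightarrow> real" and n
  proof -
    note [measurable] = L2_measurable[OF k]
    have b: "norm (indicator (far n) x * k x) \<le> norm (k x)" for n x by (simp add: indicator_def)
    show "L2 (\<lambda>x. indicator (far n) x * k x)"
      by (rule L2_bound[OF k, where C=1]) (use b in auto)
    show "(\<lambda>n. L2_norm (\<lambda>x. indicator (far n) x * k x)) \<longlonglongrightarrow> 0"
    proof (rule L2_norm_dominated[OF _ k])
      show "AE x in lborel. norm (indicator (far n) x * k x) \<le> norm (k x)" for n using b by simp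
      have "(\<lambda>n. indicator (far n) x * k x) \<longlonglongrightarrow> 0" for x
      proof (rule tendsto_eventually)
        obtain N where N: "2 * norm x < real N" using reals_Archimedean2 by blast
        have "indicator (far n) x * k x = 0" if "n \<ge> N" for n
        proof -
          have "real N \<le> real n" using that by simp
          then have "x \<notin> far n" using N by (simp add: far_def)
          then show ?thesis by simp
        qed
        then show "eventually (\<lambda>n. indicator (far n) x * k x = 0) sequentially"
          unfolding eventually_sequentially by blast
      qed
      then show "AE x in lborel. (\<lambda>n. indicator (far n) x * k x) \<longlonglongrightarrow> 0" by simp
    qed measurable
  qed
  let ?t = "\<lambda>(k :: real^3 \<Rightarrow> real) n x. indicator (far n) x * k x"
  have le: "\<bar>ip f (\<lambda>x. g (x + real n *\<^sub>R ax i))\<bar> \<le> L2_norm (?t f n) * L2_norm g + 2 * L2_norm f * L2_norm (?t g n)" for n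
  proof -
    let ?s = "real n *\<^sub>R ax i"
    have sg: "L2 (\<lambda>x. g (x + ?s))" "L2_norm (\<lambda>x. g (x + ?s)) = L2_norm g" by (simp_all add: L2_shift L2_norm_shift g)
    have tg: "L2 (\<lambda>x. ?t g n (x + ?s))" "L2_norm (\<lambda>x. ?t g n (x + ?s)) = L2_norm (?t g n)"
      using L2_shift[OF tail(1)[OF g]] L2_norm_shift[OF tail(1)[OF g]] by auto
    have near: "L2 (\<lambda>x. f x - ?t f n x)" by (intro L2_diff f tail(1))
    have nn: "L2_norm (\<lambda>x. f x - ?t f n x) \<le> 1 * L2_norm f"
      by (rule L2_norm_mono[OF f]) (use L2_measurable[OF near] in \<open>auto simp: indicator_def\<close>)
    have eq: "(f x - ?t f n x) * g (x + ?s) = (f x - ?t f n x) * ?t g n (x + ?s)" for x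
    proof (cases "x \<in> far n")
      case False
      then have "norm x < real n / 2" by (simp add: far_def)
      then have "x + ?s \<in> far n"
        using norm_triangle_ineq2[of ?s "- x"] by (simp add: far_def add.commute)
      then show ?thesis by simp
    qed simp
    have e: "ip (\<lambda>x. f x - ?t f n x) (\<lambda>x. g (x + ?s)) = ip (\<lambda>x. f x - ?t f n x) (\<lambda>x. ?t g n (x + ?s))"
      unfolding ip_def inner_real_def by (intro Bochner_Integration.integral_cong refl eq)
    have "ip f (\<lambda>x. g (x + ?s)) = ip (\<lambda>x. f x - ?t f n x) (\<lambda>x. g (x + ?s)) + ip (?t f n) (\<lambda>x. g (x + ?s))"
      using ip_diff_left[OF f tail(1)[OF f] sg(1)] by simp
    moreover have "\<bar>ip (?t f n) (\<lambda>x. g (x + ?s))\<bar> \<le> L2_norm (?t f n) * L2_norm g"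
      using ip_abs_le[OF tail(1)[OF f] sg(1)] sg(2) by simp
    moreover have "\<bar>ip (\<lambda>x. f x - ?t f n x) (\<lambda>x. g (x + ?s))\<bar> \<le> L2_norm (\<lambda>x. f x - ?t f n x) * L2_norm (?t g n)"
      unfolding e using ip_abs_le[OF near tg(1)] tg(2) by simp
    moreover have "L2_norm (\<lambda>x. f x - ?t f n x) * L2_norm (?t g n) \<le> L2_norm f * L2_norm (?t g n)"
      using nn by (intro mult_right_mono L2_norm_nonneg) simp
    moreover have "0 \<le> L2_norm f * L2_norm (?t g n)" by (simp add: L2_norm_nonneg)
    ultimately show ?thesis by linarith
  qed
  have "(\<lambda>n. L2_norm (?t f n) * L2_norm g + 2 * L2_norm f * L2_norm (?t g n)) \<longlonglongrightarrow> 0 * L2_norm g + 2 * L2_norm f * 0"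
    by (intro tendsto_intros tail f g)
  then have lim: "(\<lambda>n. L2_norm (?t f n) * L2_norm g + 2 * L2_norm f * L2_norm (?t g n)) \<longlonglongrightarrow> 0" by simp
  show ?thesis
    by (rule Lim_null_comparison[OF _ lim]) (simp add: le)
qed

text \<open>A divergence-free field changes under translation by a curl, which is orthogonal to gradients.
  Hence the inner product with a gradient is invariant under translation to infinity, where it vanishes.\<close>

theorem gradient_orthogonal_div_free:
  fixes p :: "real^3 \<Rightarrow> real" and G :: "3 \<Rightarrow> real^3 \<Rightarrow> real" and u :: "3 \<Rightarrow> real^3 \<Rightarrow> real"
    and du :: "3 \<Rightarrow> 3 \<Rightarrow> real^3 \<Rightarrow> real"
  assumes p: "\<And>i. has_weak_pderiv i p (G i)" and G: "\<And>i. L2 (G i)"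
    and u: "\<And>i. L2 (u i)" and du: "\<And>i j. has_weak_pderiv j (u i) (du j i)" "\<And>i j. L2 (du j i)"
    and div: "AE x in lborel. (\<Sum>i\<in>UNIV. du i i x) = 0"
  shows "(\<Sum>i\<in>UNIV. ip (G i) (u i)) = 0"
proof -
  let ?j = "1 :: 3"
  define m where "m a = (\<Sum>i\<in>UNIV. ip (G i) (\<lambda>x. u i (x + a *\<^sub>R ax ?j)))" for a
  \<comment> \<open>Symmetry of second derivatives trades the pairing of \<open>G i\<close> with the
    derivative of \<open>u i\<close> in direction 1 for that of \<open>G 1\<close> with the
    derivative of \<open>u i\<close> in direction i; the sum over i contains the divergence.\<close>
  have orth: "(\<Sum>i\<in>UNIV. ip (G i) (\<lambda>x. du ?j i (x + b))) = 0" for b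
  proof -
    have "(\<Sum>i\<in>UNIV. ip (G i) (\<lambda>x. du ?j i (x + b))) = (\<Sum>i\<in>UNIV. ip (G ?j) (\<lambda>x. du i i (x + b)))"
      by (intro sum.cong refl weak_gradient_symmetric[OF p p G G has_weak_pderiv_shift[OF du(1)] has_weak_pderiv_shift[OF du(1)]] L2_shift u du)
    also have "\<dots> = ip (G ?j) (\<lambda>x. \<Sum>i\<in>UNIV. du i i (x + b))"
      by (rule ip_sum_right[symmetric]) (auto intro: L2_shift du G)
    also have "\<dots> = ip (G ?j) (\<lambda>x. 0)"
      by (rule ip_cong_AE) (use AE_shift[OF div, of b] L2_measurable[OF G] L2_measurable[OF L2_sum[of UNIV "\<lambda>i x. du i i (x + b)"]] in \<open>auto intro: L2_shift du\<close>)
    finally show ?thesis by (simp add: ip_zero)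
  qed
  \<comment> \<open>By \<open>orth\<close> the first-order part of the increment drops out, and h
    times the error of the difference quotient remains.\<close>
  have step: "\<bar>m (b + h) - m b\<bar> \<le> h * (\<Sum>i\<in>UNIV. L2_norm (G i) * L2_norm (\<lambda>x. dq ?j h (u i) x - du ?j i x))"
    if h: "h > 0" for b h
  proof -
    let ?b = "b *\<^sub>R ax ?j"
    have L: "L2 (\<lambda>x. dq ?j h (u i) x - du ?j i x)" for i by (intro L2_diff L2_dq_of_L2 u du)
    have i: "ip (G i) (\<lambda>x. u i (x + (b + h) *\<^sub>R ax ?j)) - ip (G i) (\<lambda>x. u i (x + ?b))
        = h * (ip (G i) (\<lambda>x. dq ?j h (u i) (x + ?b) - du ?j i (x + ?b)) + ip (G i) (\<lambda>x. du ?j i (x + ?b)))" for i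
    proof -
      have "(\<lambda>x. u i (x + (b + h) *\<^sub>R ax ?j) - u i (x + ?b)) = (\<lambda>x. h *\<^sub>R dq ?j h (u i) (x + ?b))"
        using h by (auto simp: dq_def scaleR_add_left add.assoc)
      then have "ip (G i) (\<lambda>x. u i (x + (b + h) *\<^sub>R ax ?j)) - ip (G i) (\<lambda>x. u i (x + ?b))
          = h * ip (G i) (\<lambda>x. dq ?j h (u i) (x + ?b))"
        using ip_diff_right[OF G L2_shift[OF u] L2_shift[OF u], of i i "(b + h) *\<^sub>R ax ?j" i ?b]
        by (simp only: ip_scaleR_right)
      moreover have "ip (G i) (\<lambda>x. dq ?j h (u i) (x + ?b) - du ?j i (x + ?b)) = ip (G i) (\<lambda>x. dq ?j h (u i) (x + ?b)) - ip (G i) (\<lambda>x. du ?j i (x + ?b))"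
        by (intro ip_diff_right G L2_shift L2_dq_of_L2 u du)
      ultimately show ?thesis by simp
    qed
    have "m (b + h) - m b = (\<Sum>i\<in>UNIV. ip (G i) (\<lambda>x. u i (x + (b + h) *\<^sub>R ax ?j)) - ip (G i) (\<lambda>x. u i (x + ?b)))"
      unfolding m_def by (simp add: sum_subtractf)
    also have "\<dots> = h * (\<Sum>i\<in>UNIV. ip (G i) (\<lambda>x. dq ?j h (u i) (x + ?b) - du ?j i (x + ?b)))"
      unfolding i sum_distrib_left[symmetric] sum.distrib orth by simp
    also have "\<bar>\<dots>\<bar> \<le> h * (\<Sum>i\<in>UNIV. L2_norm (G i) * L2_norm (\<lambda>x. dq ?j h (u i) x - du ?j i x))"
      unfolding abs_mult abs_of_pos[OF h]
    proof (intro mult_left_mono order_trans[OF sum_abs] sum_mono)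
      show "\<bar>ip (G i) (\<lambda>x. dq ?j h (u i) (x + ?b) - du ?j i (x + ?b))\<bar> \<le> L2_norm (G i) * L2_norm (\<lambda>x. dq ?j h (u i) x - du ?j i x)" for i
        using ip_abs_le[OF G L2_shift[OF L], of i i ?b] L2_norm_shift[OF L, of i ?b] by simp
    qed (use h in simp)
    finally show ?thesis .
  qed
  \<comment> \<open>Telescoping over n + 1 equal steps: the total error is a times the error of the
    difference quotient at step size a / (n + 1), which tends to 0. The one-sided limit of
    \<open>dq_tendsto\<close> is all that this takes.\<close>
  have const: "m a = m 0" if a: "a > 0" for a
  proof -
    let ?E = "\<lambda>h. \<Sum>i\<in>UNIV. L2_norm (G i) * L2_norm (\<lambda>x. dq ?j h (u i) x - du ?j i x)"
    have tele: "\<bar>m (real k * h) - m 0\<bar> \<le> real k * (h * ?E h)" if h: "h > 0" for k h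
    proof (induction k)
      case (Suc k)
      have "\<bar>m (real k * h + h) - m (real k * h)\<bar> \<le> h * ?E h" by (rule step[OF h])
      with Suc show ?case by (simp add: algebra_simps)
    qed simp
    have "\<bar>m a - m 0\<bar> \<le> a * ?E (a / real (Suc n))" for n
      using tele[of "a / real (Suc n)" "Suc n"] a by simp
    moreover have "(\<lambda>n. a * ?E (a / real (Suc n))) \<longlonglongrightarrow> a * (\<Sum>i\<in>UNIV. L2_norm (G i) * 0)"
    proof (intro tendsto_mult tendsto_const tendsto_sum)
      fix i :: 3
      have "filterlim (\<lambda>n. a / real (Suc n)) (at_right 0) sequentially"
      proof -
        have "(\<lambda>n. a * (1 / real (Suc n))) \<longlonglongrightarrow> a * 0"
          by (intro tendsto_mult tendsto_const LIMSEQ_Suc[OF lim_1_over_n])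
        then show ?thesis using a unfolding filterlim_at by (simp add: zero_less_divide_iff del: of_nat_Suc)
      qed
      then show "(\<lambda>n. L2_norm (\<lambda>x. dq ?j (a / real (Suc n)) (u i) x - du ?j i x)) \<longlonglongrightarrow> 0"
        by (rule filterlim_compose[OF dq_tendsto[OF du]])
    qed
    ultimately have "\<bar>m a - m 0\<bar> \<le> 0"
      using LIMSEQ_le_const[of "\<lambda>n. a * ?E (a / real (Suc n))" 0 "\<bar>m a - m 0\<bar>"] by simp
    then show ?thesis by simp
  qed
  have "(\<lambda>n. m (real n)) \<longlonglongrightarrow> (\<Sum>i\<in>(UNIV :: 3 set). 0)"
    unfolding m_def by (intro tendsto_sum ip_shift_tendsto_0 G u)
  moreover have "(\<lambda>n. m (real n)) \<longlonglongrightarrow> m 0"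
    by (rule tendsto_eventually) (auto simp: eventually_sequentially intro!: exI[of _ 1] const)
  ultimately have "m 0 = 0" using LIMSEQ_unique by fastforce
  then show ?thesis by (simp add: m_def)
qed

section \<open>The Ladyzhenskaya inequality\<close>

definition pt :: "real \<Rightarrow> real \<Rightarrow> real \<Rightarrow> real^3" where
  "pt a b c = a *\<^sub>R ax 1 + b *\<^sub>R ax 2 + c *\<^sub>R ax 3"

lemma pt_nth: "pt a b c $ 1 = a" "pt a b c $ 2 = b" "pt a b c $ 3 = c"
  by (simp_all add: pt_def axis_def)

lemma pt_add: "pt a b c + s *\<^sub>R ax 1 = pt (a + s) b c" "pt a b c + s *\<^sub>R ax 2 = pt a (b + s) c"
  "pt a b c + s *\<^sub>R ax 3 = pt a b (c + s)"
  by (simp_all add: pt_def scaleR_add_left)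

lemma measurable_pt [measurable]:
  assumes [measurable]: "f \<in> borel_measurable M" "g \<in> borel_measurable M" "h \<in> borel_measurable M"
  shows "(\<lambda>x. pt (f x) (g x) (h x)) \<in> borel_measurable M"
  unfolding pt_def by measurable

lemma Basis_3: "(Basis :: (real^3) set) = {ax 1, ax 2, ax 3}"
  by (auto simp: Basis_vec_def UNIV_3)

text \<open>The third coordinate is the outermost factor, so that the outer variable is the height
  of a horizontal plane, as the slicing in the L4 estimate requires.\<close>

lemma lborel_R3: "(lborel :: (real^3) measure) = distr (lborel \<Otimes>\<^sub>M (lborel \<Otimes>\<^sub>M lborel)) borel (\<lambda>(c, a, b). pt a b c)"
proof (rule lborel_eqI)
  have m: "(\<lambda>(c, a, b). pt a b c) \<in> borel_measurable (lborel \<Otimes>\<^sub>M (lborel \<Otimes>\<^sub>M lborel))"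
    by measurable
  fix l u :: "real^3" assume le: "\<And>b. b \<in> Basis \<Longrightarrow> l \<bullet> b \<le> u \<bullet> b"
  then have le': "l $ 1 \<le> u $ 1" "l $ 2 \<le> u $ 2" "l $ 3 \<le> u $ 3"
    by (auto simp: Basis_3 cart_eq_inner_axis)
  have "(\<lambda>(c, a, b). pt a b c) -` box l u \<inter> space (lborel \<Otimes>\<^sub>M (lborel \<Otimes>\<^sub>M lborel))
      = {l $ 3 <..< u $ 3} \<times> ({l $ 1 <..< u $ 1} \<times> {l $ 2 <..< u $ 2})"
    by (auto simp: mem_box_cart forall_3 pt_nth space_pair_measure)
  then have "emeasure (distr (lborel \<Otimes>\<^sub>M (lborel \<Otimes>\<^sub>M lborel)) borel (\<lambda>(c, a, b). pt a b c)) (box l u)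
     = emeasure (lborel \<Otimes>\<^sub>M lborel) ({l $ 3 <..< u $ 3} \<times> ({l $ 1 <..< u $ 1} \<times> {l $ 2 <..< u $ 2}))"
    by (subst emeasure_distr[OF m]) (simp_all add: lborel_prod)
  also have "\<dots> = emeasure lborel {l $ 3 <..< u $ 3} * (emeasure lborel {l $ 1 <..< u $ 1} * emeasure lborel {l $ 2 <..< u $ 2})"
    by (subst lborel.emeasure_pair_measure_Times)
      (auto simp: lborel.emeasure_pair_measure_Times borel_prod[symmetric] simp flip: lborel_prod)
  also have "\<dots> = (\<Prod>b\<in>Basis. (u - l) \<bullet> b)"
    using le' unfolding Basis_3
    by (simp add: axis_eq_axis cart_eq_inner_axis[symmetric] inner_diff_left ennreal_mult mult_ac)
  finally show "emeasure (distr (lborel \<Otimes>\<^sub>M (lborel \<Otimes>\<^sub>M lborel)) borel (\<lambda>(c, a, b). pt a b c)) (box l u) = (\<Prod>b\<in>Basis. (u - l) \<bullet> b)" .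
qed simp

lemma nn_integral_R3:
  assumes [measurable]: "f \<in> borel_measurable borel"
  shows "(\<integral>\<^sup>+x. f x \<partial>lborel) = (\<integral>\<^sup>+c. \<integral>\<^sup>+a. \<integral>\<^sup>+b. f (pt a b c) \<partial>lborel \<partial>lborel \<partial>lborel)"
proof -
  have sf: "sigma_finite_measure (lborel \<Otimes>\<^sub>M lborel :: (real \<times> real) measure)"
    unfolding lborel_prod by (rule sigma_finite_lborel)
  have "(\<integral>\<^sup>+x. f x \<partial>lborel) = (\<integral>\<^sup>+y. f (case y of (c, a, b) \<Rightarrow> pt a b c) \<partial>(lborel \<Otimes>\<^sub>M (lborel \<Otimes>\<^sub>M lborel)))"
    by (subst lborel_R3, subst nn_integral_distr) auto
  also have "\<dots> = (\<integral>\<^sup>+c. \<integral>\<^sup>+y. f (case y of (a, b) \<Rightarrow> pt a b c) \<partial>(lborel \<Otimes>\<^sub>M lborel) \<partial>lborel)"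
    by (subst sigma_finite_measure.nn_integral_fst[OF sf, symmetric]) (simp_all add: case_prod_unfold)
  also have "\<dots> = (\<integral>\<^sup>+c. \<integral>\<^sup>+a. \<integral>\<^sup>+b. f (pt a b c) \<partial>lborel \<partial>lborel \<partial>lborel)"
    by (intro nn_integral_cong, subst lborel.nn_integral_fst[symmetric]) simp_all
  finally show ?thesis .
qed

lemma integral_tail_tendsto_0:
  fixes F :: "real^3 \<Rightarrow> real"
  assumes F: "integrable lborel F" "\<And>x. F x \<ge> 0"
  shows "(\<lambda>n. \<integral>\<^sup>+x. ennreal (indicator {x. real n - r \<le> norm x} x * F x) \<partial>lborel) \<longlonglongrightarrow> 0"
proof -
  have [measurable]: "{x::real^3. real n - r \<le> norm x} \<in> sets borel" for n
    by (intro borel_closed closed_Collect_le continuous_intros)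
  have [measurable]: "F \<in> borel_measurable borel" using F(1) by (simp add: borel_measurable_integrable[of lborel, simplified])
  have i: "integrable lborel (\<lambda>x. indicator {x. real n - r \<le> norm x} x * F x)" for n
    by (rule Bochner_Integration.integrable_bound[OF F(1)]) (auto simp: indicator_def)
  have "(\<lambda>n. \<integral>x. indicator {x. real n - r \<le> norm x} x * F x \<partial>lborel) \<longlonglongrightarrow> (\<integral>x. 0 \<partial>(lborel::(real^3) measure))"
  proof (rule integral_dominated_convergence[OF _ _ F(1)])
    have "(\<lambda>n. indicator {x. real n - r \<le> norm x} x * F x) \<longlonglongrightarrow> 0" for x
    proof (rule tendsto_eventually)
      obtain N where N: "norm x + r < real N" using reals_Archimedean2 by blast
      have "indicator {x. real n - r \<le> norm x} x * F x = 0" if "n \<ge> N" for n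
      proof -
        have "real N \<le> real n" using that by simp
        then show ?thesis using N by simp
      qed
      then show "eventually (\<lambda>n. indicator {x. real n - r \<le> norm x} x * F x = 0) sequentially"
        unfolding eventually_sequentially by blast
    qed
    then show "AE x in lborel. (\<lambda>n. indicator {x. real n - r \<le> norm x} x * F x) \<longlonglongrightarrow> 0" by simp
    show "AE x in lborel. norm (indicator {x. real n - r \<le> norm x} x * F x) \<le> F x" for n
      using F(2) by (simp add: indicator_def)
  qed simp_all
  then have "(\<lambda>n. ennreal (\<integral>x. indicator {x. real n - r \<le> norm x} x * F x \<partial>lborel)) \<longlonglongrightarrow> ennreal 0"
    by (intro tendsto_ennrealI) simp
  moreover have "(\<integral>\<^sup>+x. ennreal (indicator {x. real n - r \<le> norm x} x * F x) \<partial>lborel) = ennreal (\<integral>x. indicator {x. real n - r \<le> norm x} x * F x \<partial>lborel)" for n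
    by (intro nn_integral_eq_integral i) (simp add: F(2))
  ultimately show ?thesis by simp
qed

text \<open>F(x) is at most F(x + n e_i) plus the line integral, but an integrable function need not
  tend to 0 along lines. Integration over a ball of radius k helps: translated by n e_i it lies in
  |x| >= n - k, where the integral of F tends to 0.\<close>

lemma weak_pderiv_line_bound:
  fixes F g :: "real^3 \<Rightarrow> real"
  assumes w: "has_weak_pderiv i F g" and F: "integrable lborel F" "\<And>x. F x \<ge> 0"
  shows "AE x in lborel. ennreal (F x) \<le> (\<integral>\<^sup>+s. ennreal \<bar>g (x + s *\<^sub>R ax i)\<bar> \<partial>lborel)"
proof -
  have [measurable]: "F \<in> borel_measurable borel" "g \<in> borel_measurable borel"
    using has_weak_pderivD[OF w] L1_locD(2) by blast+
  define M where "M x = (\<integral>\<^sup>+s. ennreal \<bar>g (x + s *\<^sub>R ax i)\<bar> \<partial>lborel)" for x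
  have [measurable]: "M \<in> borel_measurable borel"
    unfolding M_def using lborel.borel_measurable_nn_integral[of "\<lambda>x s. ennreal \<bar>g (x + s *\<^sub>R ax i)\<bar>" borel] by simp
  \<comment> \<open>Subtraction in \<open>ennreal\<close> is truncated: the claim is trivial where
    \<open>M x\<close> is infinite, and \<open>ennreal (F x) - M x = 0\<close> encodes the desired
    inequality.\<close>
  have step: "AE x in lborel. ennreal (F x) - M x \<le> ennreal (F (x + real n *\<^sub>R ax i))" for n
    using weak_pderiv_shift_integral[OF w of_nat_0_le_iff[of n]]
  proof eventually_elim
    case (elim x)
    show ?case
    proof (cases "M x = \<infinity>")
      case True then show ?thesis by simp
    next
      case False
      let ?W = "\<lambda>s. indicator {0..real n} s * g (x + s *\<^sub>R ax i)"
      have le: "(\<integral>\<^sup>+s. ennreal (norm (?W s)) \<partial>lborel) \<le> M x"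
        unfolding M_def by (intro nn_integral_mono) (simp add: indicator_def)
      moreover have "M x < \<infinity>" using False by (simp add: less_top)
      ultimately have "(\<integral>\<^sup>+s. ennreal (norm (?W s)) \<partial>lborel) < \<infinity>" by (rule order_le_less_trans)
      then have iW: "integrable lborel ?W" unfolding integrable_iff_bounded by simp
      have B: "ennreal (norm (\<integral>s. ?W s \<partial>lborel)) \<le> M x"
        using integral_norm_bound_ennreal[OF iW] le by (rule order_trans)
      have "F x \<le> F (x + real n *\<^sub>R ax i) + norm (\<integral>s. ?W s \<partial>lborel)"
        using elim by (simp only: real_norm_def)
      then have "ennreal (F x) \<le> ennreal (F (x + real n *\<^sub>R ax i)) + ennreal (norm (\<integral>s. ?W s \<partial>lborel))"
        using F(2) by (simp flip: ennreal_plus)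
      also have "\<dots> \<le> ennreal (F (x + real n *\<^sub>R ax i)) + M x" by (rule add_left_mono[OF B])
      finally have "ennreal (F x) \<le> M x + ennreal (F (x + real n *\<^sub>R ax i))" by (simp only: add.commute)
      then show ?thesis by (simp add: ennreal_minus_le_iff)
    qed
  qed
  have z: "(\<integral>\<^sup>+x. (ennreal (F x) - M x) * indicator (cball 0 (real k)) x \<partial>lborel) = 0" for k :: nat
  proof -
    let ?I = "\<integral>\<^sup>+x. (ennreal (F x) - M x) * indicator (cball 0 (real k)) x \<partial>lborel"
    let ?T = "\<lambda>n. \<integral>\<^sup>+x. ennreal (indicator {x. real n - real k \<le> norm x} x * F x) \<partial>lborel"
    have "?I \<le> ?T n" for n
    proof -
      have [measurable]: "{x::real^3. real n - real k \<le> norm x} \<in> sets borel"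
        by (intro borel_closed closed_Collect_le continuous_intros)
      have "?I \<le> (\<integral>\<^sup>+x. ennreal (indicator {x. real n - real k \<le> norm x} (x + real n *\<^sub>R ax i) * F (x + real n *\<^sub>R ax i)) \<partial>lborel)"
      proof (rule nn_integral_mono_AE)
        show "AE x in lborel. (ennreal (F x) - M x) * indicator (cball 0 (real k)) x
            \<le> ennreal (indicator {x. real n - real k \<le> norm x} (x + real n *\<^sub>R ax i) * F (x + real n *\<^sub>R ax i))"
          using step[of n]
        proof eventually_elim
          case (elim x)
          show ?case
          proof (cases "x \<in> cball 0 (real k)")
            case True
            then have "real n - real k \<le> norm (x + real n *\<^sub>R ax i)"
              using norm_triangle_ineq2[of "real n *\<^sub>R ax i" "- x"] by (simp add: add.commute)
            then show ?thesis using elim True by simp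
          qed simp
        qed
      qed
      also have "\<dots> = ?T n"
        by (rule nn_integral_shift[of "\<lambda>x. ennreal (indicator {x. real n - real k \<le> norm x} x * F x)"]) measurable
      finally show ?thesis .
    qed
    then have "?I \<le> 0"
      using LIMSEQ_le_const[OF integral_tail_tendsto_0[OF F, of "real k"], of ?I] by blast
    then show ?thesis by simp
  qed
  have "AE x in lborel. (ennreal (F x) - M x) * indicator (cball 0 (real k)) x = 0" for k :: nat
  proof -
    have [measurable]: "cball 0 (real k) \<in> sets (borel :: (real^3) measure)" by simp
    have m: "(\<lambda>x. (ennreal (F x) - M x) * indicator (cball 0 (real k)) x) \<in> borel_measurable lborel"
      by measurable
    show ?thesis by (rule nn_integral_0_iff_AE[OF m, THEN iffD1, OF z])
  qed
  then have "AE x in lborel. \<forall>k::nat. (ennreal (F x) - M x) * indicator (cball 0 (real k)) x = 0"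
    by (subst AE_all_countable) blast
  then show ?thesis
  proof eventually_elim
    case (elim x)
    obtain k :: nat where "norm x \<le> real k" using real_arch_simple by blast
    then have "x \<in> cball 0 (real k)" by simp
    then have "ennreal (F x) - M x = 0" using spec[OF elim, of k] by simp
    from ennreal_minus_eq_0[OF this] show ?case unfolding M_def .
  qed
qed

text \<open>Along each line \<open>f\<^sup>2\<close> is bounded by \<open>\<integral> 2 \<bar>f \<partial>\<^sub>if\<bar>\<close>; in a horizontal plane the bounds in the first
  two directions are multiplied and integrated separately, and the third one bounds the integral of
  \<open>f\<^sup>2\<close> over the plane.\<close>

theorem ladyzhenskaya_nn:
  fixes f :: "real^3 \<Rightarrow> real" and g :: "3 \<Rightarrow> real^3 \<Rightarrow> real"
  assumes [measurable]: "f \<in> borel_measurable borel" "\<And>i. g i \<in> borel_measurable borel"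
    and b: "\<And>i. AE x in lborel. ennreal ((f x)\<^sup>2) \<le> (\<integral>\<^sup>+s. ennreal \<bar>2 * f (x + s *\<^sub>R ax i) * g i (x + s *\<^sub>R ax i)\<bar> \<partial>lborel)"
  shows "(\<integral>\<^sup>+x. ennreal ((f x)^4) \<partial>lborel)\<^sup>2 \<le> 64 * (\<integral>\<^sup>+x. ennreal ((f x)\<^sup>2) \<partial>lborel)
     * (\<integral>\<^sup>+x. ennreal ((g 1 x)\<^sup>2) \<partial>lborel) * (\<integral>\<^sup>+x. ennreal ((g 2 x)\<^sup>2) \<partial>lborel) * (\<integral>\<^sup>+x. ennreal ((g 3 x)\<^sup>2) \<partial>lborel)"
proof -
  define G where "G i x = ennreal \<bar>2 * f x * g i x\<bar>" for i x
  have [measurable]: "G i \<in> borel_measurable borel" for i unfolding G_def by measurable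
  define m where "m i x = (\<integral>\<^sup>+s. G i (x + s *\<^sub>R ax i) \<partial>lborel)" for i x
  have mm [measurable]: "m i \<in> borel_measurable borel" for i
    unfolding m_def using lborel.borel_measurable_nn_integral[of "\<lambda>x s. G i (x + s *\<^sub>R ax i)" borel] by simp
  have bm: "AE x in lborel. ennreal ((f x)\<^sup>2) \<le> m i x" for i using b[of i] by (simp add: m_def G_def)
  \<comment> \<open>A full line integral does not depend on the coordinate along the line; this will
    separate the product \<open>m 1 * m 2\<close>.\<close>
  have m1: "m 1 (pt a b c) = (\<integral>\<^sup>+s. G 1 (pt s b c) \<partial>lborel)" for a b c
    unfolding m_def pt_add using nn_integral_shift[of "\<lambda>s. G 1 (pt s b c)" a] by (simp add: add.commute)
  have m2: "m 2 (pt a b c) = (\<integral>\<^sup>+s. G 2 (pt a s c) \<partial>lborel)" for a b c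
    unfolding m_def pt_add using nn_integral_shift[of "\<lambda>s. G 2 (pt a s c)" b] by (simp add: add.commute)
  have m3: "m 3 (pt a b c) = (\<integral>\<^sup>+s. G 3 (pt a b s) \<partial>lborel)" for a b c
    unfolding m_def pt_add using nn_integral_shift[of "\<lambda>s. G 3 (pt a b s)" c] by (simp add: add.commute)
  define A where "A h = (\<integral>\<^sup>+x. ennreal ((h x)\<^sup>2) \<partial>lborel)" for h :: "real^3 \<Rightarrow> real"
  define N where "N h c = (\<integral>\<^sup>+a. \<integral>\<^sup>+b. ennreal ((h (pt a b c))\<^sup>2) \<partial>lborel \<partial>lborel)" for h and c
  define P where "P i c = (\<integral>\<^sup>+a. \<integral>\<^sup>+b. G i (pt a b c) \<partial>lborel \<partial>lborel)" for i c
  have [measurable]: "P i \<in> borel_measurable borel" for i unfolding P_def by measurable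
  have Nm [measurable]: "N h \<in> borel_measurable borel" if [measurable]: "h \<in> borel_measurable borel" for h
    unfolding N_def by measurable
  have AN: "A h = (\<integral>\<^sup>+c. N h c \<partial>lborel)" if [measurable]: "h \<in> borel_measurable borel" for h
    unfolding A_def N_def by (rule nn_integral_R3) measurable
  have CS: "(\<integral>\<^sup>+x. G i x \<partial>lborel)\<^sup>2 \<le> 4 * A f * A (g i)" for i
  proof -
    have "(\<integral>\<^sup>+x. G i x \<partial>lborel) = (\<integral>\<^sup>+x. ennreal (2 * \<bar>f x\<bar>) * ennreal \<bar>g i x\<bar> \<partial>lborel)"
      unfolding G_def by (intro nn_integral_cong) (simp add: abs_mult flip: ennreal_mult)
    also have "\<dots>\<^sup>2 \<le> (\<integral>\<^sup>+x. (ennreal (2 * \<bar>f x\<bar>))\<^sup>2 \<partial>lborel) * (\<integral>\<^sup>+x. (ennreal \<bar>g i x\<bar>)\<^sup>2 \<partial>lborel)"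
      by (rule Cauchy_Schwarz_nn_integral) measurable
    also have "(\<integral>\<^sup>+x. (ennreal (2 * \<bar>f x\<bar>))\<^sup>2 \<partial>lborel) = (\<integral>\<^sup>+x. 4 * ennreal ((f x)\<^sup>2) \<partial>lborel)"
      by (intro nn_integral_cong) (simp add: ennreal_power power_mult_distrib ennreal_mult)
    also have "\<dots> = 4 * A f" unfolding A_def by (rule nn_integral_cmult) measurable
    also have "(\<integral>\<^sup>+x. (ennreal \<bar>g i x\<bar>)\<^sup>2 \<partial>lborel) = A (g i)"
      unfolding A_def by (intro nn_integral_cong) (simp add: ennreal_power)
    finally show ?thesis .
  qed
  have CSP: "(P i c)\<^sup>2 \<le> 4 * N f c * N (g i) c" for i c
  proof -
    have e: "P i c = (\<integral>\<^sup>+y. ennreal (2 * \<bar>f (case y of (a, b) \<Rightarrow> pt a b c)\<bar>) * ennreal \<bar>g i (case y of (a, b) \<Rightarrow> pt a b c)\<bar> \<partial>(lborel \<Otimes>\<^sub>M lborel))"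
      unfolding P_def G_def
      by (subst lborel.nn_integral_fst[symmetric]) (simp_all add: abs_mult flip: ennreal_mult)
    have eN: "N h c = (\<integral>\<^sup>+y. ennreal ((h (case y of (a, b) \<Rightarrow> pt a b c))\<^sup>2) \<partial>(lborel \<Otimes>\<^sub>M lborel))"
      if [measurable]: "h \<in> borel_measurable borel" for h
      unfolding N_def by (subst lborel.nn_integral_fst[symmetric]) simp_all
    have "(P i c)\<^sup>2 \<le> (\<integral>\<^sup>+y. (ennreal (2 * \<bar>f (case y of (a, b) \<Rightarrow> pt a b c)\<bar>))\<^sup>2 \<partial>(lborel \<Otimes>\<^sub>M lborel))
        * (\<integral>\<^sup>+y. (ennreal \<bar>g i (case y of (a, b) \<Rightarrow> pt a b c)\<bar>)\<^sup>2 \<partial>(lborel \<Otimes>\<^sub>M lborel))"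
      unfolding e by (rule Cauchy_Schwarz_nn_integral) measurable
    also have "(\<integral>\<^sup>+y. (ennreal (2 * \<bar>f (case y of (a, b) \<Rightarrow> pt a b c)\<bar>))\<^sup>2 \<partial>(lborel \<Otimes>\<^sub>M lborel))
        = (\<integral>\<^sup>+y. 4 * ennreal ((f (case y of (a, b) \<Rightarrow> pt a b c))\<^sup>2) \<partial>(lborel \<Otimes>\<^sub>M lborel))"
      by (intro nn_integral_cong) (simp add: ennreal_power power_mult_distrib ennreal_mult)
    also have "\<dots> = 4 * N f c" by (subst nn_integral_cmult) (simp_all add: eN)
    also have "(\<integral>\<^sup>+y. (ennreal \<bar>g i (case y of (a, b) \<Rightarrow> pt a b c)\<bar>)\<^sup>2 \<partial>(lborel \<Otimes>\<^sub>M lborel)) = N (g i) c"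
      by (subst eN) (auto intro!: nn_integral_cong simp: ennreal_power)
    finally show ?thesis .
  qed
  define K where "K = (\<integral>\<^sup>+x. G 3 x \<partial>lborel)"
  \<comment> \<open>The truncated excess of f^2 over \<open>m 3\<close> vanishes almost everywhere
    in space, hence has integral 0 over almost every horizontal plane. On such a plane f^2
    integrates to at most the integral of \<open>m 3\<close>, which is the integral of
    \<open>G 3\<close> over the whole space, whatever the height.\<close>
  have NK: "AE c in lborel. N f c \<le> K"
  proof -
    let ?D = "\<lambda>x. ennreal ((f x)\<^sup>2) - m 3 x"
    have "(\<integral>\<^sup>+x. ?D x \<partial>lborel) = (\<integral>\<^sup>+x. 0 \<partial>(lborel :: (real^3) measure))"
      by (rule nn_integral_cong_AE) (use bm[of 3] in \<open>auto elim!: eventually_mono simp: diff_eq_0_iff_ennreal\<close>)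
    then have "(\<integral>\<^sup>+c. \<integral>\<^sup>+a. \<integral>\<^sup>+b. ?D (pt a b c) \<partial>lborel \<partial>lborel \<partial>lborel) = 0"
      by (subst (asm) nn_integral_R3) simp_all
    then have "AE c in lborel. (\<integral>\<^sup>+a. \<integral>\<^sup>+b. ?D (pt a b c) \<partial>lborel \<partial>lborel) = 0"
      by (subst (asm) nn_integral_0_iff_AE) simp_all
    then show ?thesis
    proof eventually_elim
      case (elim c)
      have "N f c \<le> (\<integral>\<^sup>+a. \<integral>\<^sup>+b. ?D (pt a b c) + m 3 (pt a b c) \<partial>lborel \<partial>lborel)"
        unfolding N_def by (intro nn_integral_mono) (metis add.commute ennreal_minus_le_iff order_refl top_greatest add_top)
      also have "\<dots> = (\<integral>\<^sup>+a. \<integral>\<^sup>+b. ?D (pt a b c) \<partial>lborel \<partial>lborel) + (\<integral>\<^sup>+a. \<integral>\<^sup>+b. m 3 (pt a b c) \<partial>lborel \<partial>lborel)"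
        by (simp add: nn_integral_add)
      also have "\<dots> = (\<integral>\<^sup>+a. \<integral>\<^sup>+b. \<integral>\<^sup>+s. G 3 (pt a b s) \<partial>lborel \<partial>lborel \<partial>lborel)"
        unfolding elim add_0 unfolding m3 by (rule refl)
      also have "\<dots> = (\<integral>\<^sup>+a. \<integral>\<^sup>+s. \<integral>\<^sup>+b. G 3 (pt a b s) \<partial>lborel \<partial>lborel \<partial>lborel)"
        by (intro nn_integral_cong lborel_pair.Fubini') simp
      also have "\<dots> = (\<integral>\<^sup>+s. \<integral>\<^sup>+a. \<integral>\<^sup>+b. G 3 (pt a b s) \<partial>lborel \<partial>lborel \<partial>lborel)"
        by (intro lborel_pair.Fubini') simp
      also have "\<dots> = K" unfolding K_def by (rule nn_integral_R3[symmetric]) simp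
      finally show ?case .
    qed
  qed
  have P2: "(\<integral>\<^sup>+c. (P i c)\<^sup>2 \<partial>lborel) \<le> 4 * K * A (g i)" for i
  proof -
    have "(\<integral>\<^sup>+c. (P i c)\<^sup>2 \<partial>lborel) \<le> (\<integral>\<^sup>+c. 4 * K * N (g i) c \<partial>lborel)"
    proof (rule nn_integral_mono_AE)
      show "AE c in lborel. (P i c)\<^sup>2 \<le> 4 * K * N (g i) c"
        using NK by eventually_elim (rule order_trans[OF CSP], intro mult_right_mono mult_left_mono, auto)
    qed
    also have "\<dots> = 4 * K * A (g i)" by (subst nn_integral_cmult) (simp_all add: AN)
    finally show ?thesis .
  qed
  have "(\<integral>\<^sup>+x. ennreal ((f x)^4) \<partial>lborel) \<le> (\<integral>\<^sup>+x. m 1 x * m 2 x \<partial>lborel)"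
  proof (rule nn_integral_mono_AE)
    show "AE x in lborel. ennreal ((f x)^4) \<le> m 1 x * m 2 x"
      using bm[of 1] bm[of 2]
    proof eventually_elim
      case (elim x)
      have "ennreal ((f x)^4) = ennreal ((f x)\<^sup>2) * ennreal ((f x)\<^sup>2)"
        by (simp flip: ennreal_mult power_add)
      then show ?case using mult_mono[OF elim] by simp
    qed
  qed
  also have "\<dots> = (\<integral>\<^sup>+c. \<integral>\<^sup>+a. \<integral>\<^sup>+b. m 1 (pt a b c) * m 2 (pt a b c) \<partial>lborel \<partial>lborel \<partial>lborel)"
    by (rule nn_integral_R3) measurable
  \<comment> \<open>In the plane at height c, \<open>m 1\<close> depends on b alone and
    \<open>m 2\<close> on a alone, so the plane integral of their product factors.\<close>
  also have "\<dots> = (\<integral>\<^sup>+c. P 1 c * P 2 c \<partial>lborel)"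
  proof (intro nn_integral_cong)
    fix c :: real
    have "(\<integral>\<^sup>+a. \<integral>\<^sup>+b. m 1 (pt a b c) * m 2 (pt a b c) \<partial>lborel \<partial>lborel)
        = (\<integral>\<^sup>+a. (\<integral>\<^sup>+b. (\<integral>\<^sup>+s. G 1 (pt s b c) \<partial>lborel) \<partial>lborel) * (\<integral>\<^sup>+s. G 2 (pt a s c) \<partial>lborel) \<partial>lborel)"
      unfolding m1 m2 by (intro nn_integral_cong nn_integral_multc) measurable
    also have "\<dots> = (\<integral>\<^sup>+b. (\<integral>\<^sup>+s. G 1 (pt s b c) \<partial>lborel) \<partial>lborel) * P 2 c"
      unfolding P_def by (rule nn_integral_cmult) measurable
    also have "(\<integral>\<^sup>+b. (\<integral>\<^sup>+s. G 1 (pt s b c) \<partial>lborel) \<partial>lborel) = P 1 c"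
      unfolding P_def by (intro lborel_pair.Fubini') simp
    finally show "(\<integral>\<^sup>+a. \<integral>\<^sup>+b. m 1 (pt a b c) * m 2 (pt a b c) \<partial>lborel \<partial>lborel) = P 1 c * P 2 c" .
  qed
  finally have "(\<integral>\<^sup>+x. ennreal ((f x)^4) \<partial>lborel)\<^sup>2 \<le> (\<integral>\<^sup>+c. P 1 c * P 2 c \<partial>lborel)\<^sup>2"
    by (rule power_mono) simp
  also have "\<dots> \<le> (\<integral>\<^sup>+c. (P 1 c)\<^sup>2 \<partial>lborel) * (\<integral>\<^sup>+c. (P 2 c)\<^sup>2 \<partial>lborel)"
    by (rule Cauchy_Schwarz_nn_integral) measurable
  also have "\<dots> \<le> (4 * K * A (g 1)) * (4 * K * A (g 2))"
    by (intro mult_mono P2) auto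
  also have "\<dots> = 16 * K\<^sup>2 * (A (g 1) * A (g 2))" by (simp add: power2_eq_square mult_ac)
  \<comment> \<open>The constant 64 is made up here: a factor 4 K from each of the two planar
    estimates, and another 4 from Cauchy-Schwarz in space applied to K^2.\<close>
  also have "\<dots> \<le> 16 * (4 * A f * A (g 3)) * (A (g 1) * A (g 2))"
    unfolding K_def by (intro mult_right_mono mult_left_mono CS) auto
  also have "\<dots> = (16 * 4) * A f * A (g 1) * A (g 2) * A (g 3)" by (simp only: mult_ac)
  also have "16 * 4 = (64 :: ennreal)" by simp
  finally show ?thesis unfolding A_def .
qed

section \<open>Vector calculus in Sobolev spaces\<close>

text \<open>Used backwards, it rebuilds a field from its components, so that linearity lifts
  componentwise facts to vector fields.\<close>

lemma vec3_expand: "x = (\<Sum>k\<in>UNIV. (x $ k) *\<^sub>R ax k)" for x :: "real^3"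
  by (simp add: vec_eq_iff sum_3 forall_3 axis_def)

lemma measurable_nth: "f \<in> borel_measurable borel \<Longrightarrow> (\<lambda>x. f x $ k) \<in> borel_measurable borel"
  for f :: "real^3 \<Rightarrow> real^3"
  by (rule measurable_compose[OF _ borel_measurable_continuous_onI[OF linear_continuous_on[OF bounded_linear_vec_nth]]])

lemma measurable_vecI:
  fixes f :: "real^3 \<Rightarrow> real^3"
  assumes "\<And>k. (\<lambda>x. f x $ k) \<in> borel_measurable borel"
  shows "f \<in> borel_measurable borel"
proof -
  have "(\<lambda>x. \<Sum>k\<in>UNIV. (f x $ k) *\<^sub>R ax k) \<in> borel_measurable borel"
    by (intro borel_measurable_sum borel_measurable_scaleR assms borel_measurable_const)
  then show ?thesis unfolding vec3_expand[symmetric] .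
qed

lemma L2_vecI:
  fixes f :: "real^3 \<Rightarrow> real^3"
  assumes "\<And>k. L2 (\<lambda>x. f x $ k)" shows "L2 f"
proof -
  have "L2 (\<lambda>x. \<Sum>k\<in>UNIV. (f x $ k) *\<^sub>R ax k)"
    by (intro L2_sum finite L2_bounded_linear[OF bounded_linear_scaleR_left] assms)
  then show ?thesis unfolding vec3_expand[symmetric] .
qed

lemma has_weak_pderiv_nth:
  "has_weak_pderiv i f g \<Longrightarrow> has_weak_pderiv i (\<lambda>x. f x $ k) (\<lambda>x. g x $ k)" for f :: "real^3 \<Rightarrow> real^3"
  by (rule has_weak_pderiv_bounded_linear[OF bounded_linear_vec_nth])

lemma has_weak_pderiv_vecI:
  fixes f g :: "real^3 \<Rightarrow> real^3"
  assumes "\<And>k. has_weak_pderiv i (\<lambda>x. f x $ k) (\<lambda>x. g x $ k)"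
  shows "has_weak_pderiv i f g"
proof -
  have "has_weak_pderiv i (\<lambda>x. \<Sum>k\<in>UNIV. (f x $ k) *\<^sub>R ax k) (\<lambda>x. \<Sum>k\<in>UNIV. (g x $ k) *\<^sub>R ax k)"
    by (intro has_weak_pderiv_sum finite has_weak_pderiv_bounded_linear[OF bounded_linear_scaleR_left] assms)
  then show ?thesis unfolding vec3_expand[symmetric] .
qed

lemma ip_nth: "L2 f \<Longrightarrow> L2 g \<Longrightarrow> ip f g = (\<Sum>k\<in>UNIV. ip (\<lambda>x. f x $ k) (\<lambda>x. g x $ k))"
  for f g :: "real^3 \<Rightarrow> real^3"
proof -
  assume L: "L2 f" "L2 g"
  have i: "integrable lborel (\<lambda>x. f x $ k * g x $ k)" for k
    using L2_inner_integrable[OF L2_nth[OF L(1)] L2_nth[OF L(2)], of k k] by simp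
  show ?thesis unfolding ip_def inner_vec_def by (simp add: sum_3 i)
qed

lemma weak_integration_by_parts:
  fixes f f' g g' :: "real^3 \<Rightarrow> real^3"
  assumes w: "has_weak_pderiv i f f'" "has_weak_pderiv i g g'" and L: "L2 f" "L2 f'" "L2 g" "L2 g'"
  shows "ip f' g = - ip f g'"
  unfolding ip_nth[OF L(2,3)] ip_nth[OF L(1,4)] sum_negf[symmetric]
  by (intro sum.cong refl weak_integration_by_parts_real[OF has_weak_pderiv_nth[OF w(1)] has_weak_pderiv_nth[OF w(2)]] L2_nth L)

section \<open>Closure properties of the Sobolev spaces\<close>

lemma Hk_L2: "Hk k f \<Longrightarrow> L2 f" by (cases k) auto

lemma Hk_measurable: "Hk k f \<Longrightarrow> f \<in> borel_measurable borel" by (simp add: Hk_L2 L2_measurable)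

lemma Hk_cong_AE: "Hk k f \<Longrightarrow> g \<in> borel_measurable borel \<Longrightarrow> AE x in lborel. f x = g x \<Longrightarrow> Hk k g"
proof (cases k)
  case (Suc m)
  assume H: "Hk k f" and g: "g \<in> borel_measurable borel" "AE x in lborel. f x = g x"
  have "\<exists>h. has_weak_pderiv i g h \<and> Hk m h" for i
  proof -
    obtain h where h: "has_weak_pderiv i f h" "Hk m h" using H Suc by auto
    then have "has_weak_pderiv i g h"
      by (intro has_weak_pderiv_cong_AE[OF h(1) g(1) Hk_measurable[OF h(2)] g(2)]) simp
    with h show ?thesis by blast
  qed
  then show ?thesis using Suc H g L2_cong_AE by auto
qed (auto intro: L2_cong_AE)

text \<open>\<open>Hk\<close> only provides some regular weak derivative. By uniqueness the
  representative chosen by \<open>wpderiv\<close> agrees with it almost everywhere and inherits its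
  regularity.\<close>

lemma Hk_wpderiv:
  assumes "Hk (Suc k) f" shows "has_weak_pderiv i f (wpderiv i f)" "Hk k (wpderiv i f)"
proof -
  obtain h where h: "has_weak_pderiv i f h" "Hk k h" using assms by auto
  from h(1) show w: "has_weak_pderiv i f (wpderiv i f)" by (rule wpderiv_works)
  show "Hk k (wpderiv i f)"
    using L1_locD(2)[OF has_weak_pderivD(2)[OF w]] weak_pderiv_unique[OF h(1) w] by (rule Hk_cong_AE[OF h(2)])
qed

lemma Hk_SucI:
  "L2 f \<Longrightarrow> (\<And>i. has_weak_pderiv i f (g i)) \<Longrightarrow> (\<And>i. Hk k (g i)) \<Longrightarrow> Hk (Suc k) f"
  by auto

lemma Hk_Suc_imp_Hk: "Hk (Suc k) f \<Longrightarrow> Hk k f"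
proof (induction k arbitrary: f)
  case (Suc k)
  show ?case
    by (rule Hk_SucI[OF Hk_L2[OF Suc.prems] Hk_wpderiv(1)[OF Suc.prems] Suc.IH[OF Hk_wpderiv(2)[OF Suc.prems]]])
qed simp

lemma Hk_mono: "Hk m f \<Longrightarrow> k \<le> m \<Longrightarrow> Hk k f"
proof (induction m)
  case (Suc m)
  show ?case
  proof (cases "k = Suc m")
    case False
    then show ?thesis using Suc.IH[OF Hk_Suc_imp_Hk[OF Suc.prems(1)]] Suc.prems(2) by linarith
  qed (use Suc.prems in blast)
qed simp

lemma Hk_2_imp_1: "Hk 2 f \<Longrightarrow> Hk 1 f" and Hk_3_imp_2: "Hk 3 f \<Longrightarrow> Hk 2 f"
  by (erule Hk_mono, simp)+

lemma Hk_2_wpderiv: "Hk 2 f \<Longrightarrow> Hk 1 (wpderiv i f)"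
  unfolding numeral_2_eq_2 One_nat_def by (rule Hk_wpderiv(2))

lemma Hk_bounded_linear:
  assumes "bounded_linear A" shows "Hk k f \<Longrightarrow> Hk k (\<lambda>x. A (f x))"
proof (induction k arbitrary: f)
  case 0 then show ?case using L2_bounded_linear[OF assms] by simp
next
  case (Suc k)
  show ?case
    by (rule Hk_SucI[OF L2_bounded_linear[OF assms Hk_L2[OF Suc.prems]]
        has_weak_pderiv_bounded_linear[OF assms Hk_wpderiv(1)[OF Suc.prems]] Suc.IH[OF Hk_wpderiv(2)[OF Suc.prems]]])
qed

lemma Hk_add: "Hk k f \<Longrightarrow> Hk k g \<Longrightarrow> Hk k (\<lambda>x. f x + g x)"
proof (induction k arbitrary: f g)
  case 0 then show ?case by (simp add: L2_add)
next
  case (Suc k)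
  show ?case
    by (rule Hk_SucI[OF L2_add[OF Hk_L2[OF Suc.prems(1)] Hk_L2[OF Suc.prems(2)]]
        has_weak_pderiv_add[OF Hk_wpderiv(1)[OF Suc.prems(1)] Hk_wpderiv(1)[OF Suc.prems(2)]]
        Suc.IH[OF Hk_wpderiv(2)[OF Suc.prems(1)] Hk_wpderiv(2)[OF Suc.prems(2)]]])
qed

lemma Hk_zero: "Hk k (\<lambda>x. 0)"
  by (induction k) (use L2_zero has_weak_pderiv_zero in auto)

lemma Hk_sum: "finite A \<Longrightarrow> (\<And>i. i \<in> A \<Longrightarrow> Hk k (f i)) \<Longrightarrow> Hk k (\<lambda>x. \<Sum>i\<in>A. f i x)"
  by (induction A rule: finite_induct) (auto simp: Hk_zero Hk_add simp del: Hk.simps)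

section \<open>Curl, divergence and Laplacian on Sobolev fields\<close>

lemma bounded_linear_cross3_left: "bounded_linear (\<lambda>x. cross3 x a)"
  and bounded_linear_cross3_right: "bounded_linear (cross3 a)"
  by (simp_all add: linear_conv_bounded_linear[symmetric] linear_iff cross_add_left cross_add_right cross_mult_left cross_mult_right)

text \<open>As a sum of fixed linear images of partial derivatives, the curl inherits regularity,
  commutation and continuity in time from the weak derivatives.\<close>

lemma curl_eq: "curl v x = (\<Sum>i\<in>UNIV. cross3 (ax i) (wpderiv i v x))"
  by (simp add: curl_def sum_3 cross3_simps axis_def forall_3)

lemma curl_AE:
  assumes "\<And>i. has_weak_pderiv i v (dv i)"
  shows "AE x in lborel. curl v x = (\<Sum>i\<in>UNIV. cross3 (ax i) (dv i x))"
proof -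
  have "AE x in lborel. \<forall>i\<in>UNIV. wpderiv i v x = dv i x"
    by (intro AE_finite_allI finite wpderiv_AE assms)
  then show ?thesis by eventually_elim (simp add: curl_eq)
qed

lemma Hk_curl: "Hk (Suc k) v \<Longrightarrow> Hk k (curl v)"
  unfolding curl_eq[abs_def]
  by (intro Hk_sum finite Hk_bounded_linear[OF bounded_linear_cross3_right] Hk_wpderiv(2))

text \<open>Each summand changes sign twice, by integration by parts and by skew-symmetry of the
  cross product.\<close>

lemma curl_symmetric:
  assumes v: "Hk 1 v" and w: "Hk 1 w"
  shows "ip (curl v) w = ip v (curl w)"
proof -
  note v' = v[unfolded One_nat_def] and w' = w[unfolded One_nat_def]
  note L = Hk_L2[OF v] Hk_L2[OF w] Hk_L2[OF Hk_wpderiv(2)[OF v']] Hk_L2[OF Hk_wpderiv(2)[OF w']]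
  have "ip (curl v) w = (\<Sum>i\<in>UNIV. ip (\<lambda>x. cross3 (ax i) (wpderiv i v x)) w)"
    unfolding curl_eq[abs_def] by (intro ip_sum_left finite L2_bounded_linear[OF bounded_linear_cross3_right] L)
  also have "\<dots> = (\<Sum>i\<in>UNIV. ip v (\<lambda>x. cross3 (ax i) (wpderiv i w x)))"
  proof (intro sum.cong refl)
    fix i :: 3
    have "ip (\<lambda>x. cross3 (ax i) (wpderiv i v x)) w = ip (wpderiv i v) (\<lambda>x. cross3 (w x) (ax i))"
      unfolding ip_def by (intro Bochner_Integration.integral_cong refl) (simp add: cross3_simps)
    also have "\<dots> = - ip v (\<lambda>x. cross3 (wpderiv i w x) (ax i))"
      by (intro weak_integration_by_parts[OF Hk_wpderiv(1)[OF v'] has_weak_pderiv_bounded_linear[OF bounded_linear_cross3_left Hk_wpderiv(1)[OF w']]]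
          L L2_bounded_linear[OF bounded_linear_cross3_left])
    also have "\<dots> = ip v (\<lambda>x. cross3 (ax i) (wpderiv i w x))"
      by (simp add: ip_minus_right[symmetric] cross_skew[of "ax i"])
    finally show "ip (\<lambda>x. cross3 (ax i) (wpderiv i v x)) w = ip v (\<lambda>x. cross3 (ax i) (wpderiv i w x))" .
  qed
  also have "\<dots> = ip v (curl w)"
    unfolding curl_eq[abs_def] by (intro ip_sum_right[symmetric] finite L2_bounded_linear[OF bounded_linear_cross3_right] L)
  finally show ?thesis .
qed

lemma Hk2D: "Hk 2 v \<Longrightarrow> Hk (Suc (Suc 0)) v" by (simp only: numeral_2_eq_2)

lemma L2_laplacian: "Hk 2 v \<Longrightarrow> L2 (laplacian v)"
  unfolding laplacian_def[abs_def]
  by (intro L2_sum finite Hk_L2[of 0] Hk_wpderiv(2)) (simp only: numeral_2_eq_2)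

lemma ip_laplacian:
  assumes v: "Hk 2 v" and w: "Hk 1 w"
  shows "ip (laplacian v) w = - (\<Sum>i\<in>UNIV. ip (wpderiv i v) (wpderiv i w))"
proof -
  note v2 = Hk2D[OF v] and w' = w[unfolded One_nat_def]
  note vd = Hk_wpderiv(2)[OF v2]
  have L: "L2 (wpderiv i v)" "L2 (wpderiv i (wpderiv i v))" "L2 w" "L2 (wpderiv i w)" for i
    using Hk_L2[OF vd] Hk_L2[OF Hk_wpderiv(2)[OF vd]] Hk_L2[OF w] Hk_L2[OF Hk_wpderiv(2)[OF w']] by auto
  have "ip (laplacian v) w = (\<Sum>i\<in>UNIV. ip (wpderiv i (wpderiv i v)) w)"
    unfolding laplacian_def[abs_def] by (intro ip_sum_left finite L)
  also have "\<dots> = (\<Sum>i\<in>UNIV. - ip (wpderiv i v) (wpderiv i w))"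
    by (intro sum.cong refl weak_integration_by_parts[OF Hk_wpderiv(1)[OF vd] Hk_wpderiv(1)[OF w']] L)
  finally show ?thesis by (simp add: sum_negf)
qed

lemma weak_pderiv_commute:
  fixes v :: "real^3 \<Rightarrow> real^3"
  assumes v: "Hk 2 v"
  shows "has_weak_pderiv i (wpderiv j v) (wpderiv j (wpderiv i v))"
proof (rule has_weak_pderiv_vecI)
  fix k
  note v2 = Hk2D[OF v]
  note vd = Hk_wpderiv(2)[OF v2]
  show "has_weak_pderiv i (\<lambda>x. wpderiv j v x $ k) (\<lambda>x. wpderiv j (wpderiv i v) x $ k)"
    by (rule weak_pderiv_commute_real[OF has_weak_pderiv_nth[OF Hk_wpderiv(1)[OF v2, of i]] has_weak_pderiv_nth[OF Hk_wpderiv(1)[OF v2, of j]]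
          has_weak_pderiv_nth[OF Hk_wpderiv(1)[OF vd]]])
      (intro L2_nth Hk_L2[OF v] Hk_L2[OF vd] Hk_L2[OF Hk_wpderiv(2)[OF vd]])+
qed

lemma wpderiv_commute_AE:
  fixes v :: "real^3 \<Rightarrow> real^3"
  assumes v: "Hk 2 v"
  shows "AE x in lborel. \<forall>i j. wpderiv i (wpderiv j v) x = wpderiv j (wpderiv i v) x"
proof -
  have "AE x in lborel. \<forall>i\<in>UNIV. \<forall>j\<in>UNIV. wpderiv i (wpderiv j v) x = wpderiv j (wpderiv i v) x"
    by (intro AE_finite_allI finite wpderiv_AE weak_pderiv_commute v)
  then show ?thesis by simp
qed

lemma has_weak_pderiv_curl:
  assumes v: "Hk 2 v" shows "has_weak_pderiv j (curl v) (curl (wpderiv j v))"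
proof -
  note v2 = Hk2D[OF v]
  note vd = Hk_wpderiv(2)[OF v2]
  have w: "has_weak_pderiv j (curl v) (\<lambda>x. \<Sum>i\<in>UNIV. cross3 (ax i) (wpderiv j (wpderiv i v) x))"
    unfolding curl_eq[abs_def]
    by (intro has_weak_pderiv_sum finite has_weak_pderiv_bounded_linear[OF bounded_linear_cross3_right] Hk_wpderiv(1)[OF vd])
  show ?thesis
  proof (rule has_weak_pderiv_cong_AE[OF w])
    show "curl v \<in> borel_measurable borel" by (rule Hk_measurable[OF Hk_curl[OF v2]])
    show "curl (wpderiv j v) \<in> borel_measurable borel" by (rule Hk_measurable[OF Hk_curl[OF vd]])
    show "AE x in lborel. (\<Sum>i\<in>UNIV. cross3 (ax i) (wpderiv j (wpderiv i v) x)) = curl (wpderiv j v) x"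
      using wpderiv_commute_AE[OF v] by eventually_elim (simp add: curl_eq)
  qed simp
qed

lemma divergence_AE:
  assumes "\<And>i. has_weak_pderiv i v (dv i)"
  shows "AE x in lborel. divergence v x = (\<Sum>i\<in>UNIV. dv i x $ i)"
proof -
  have "AE x in lborel. \<forall>i\<in>UNIV. wpderiv i v x = dv i x"
    by (intro AE_finite_allI finite wpderiv_AE assms)
  then show ?thesis by eventually_elim (simp add: divergence_def)
qed

lemma divergence_curl: "Hk 2 v \<Longrightarrow> AE x in lborel. divergence (curl v) x = 0"
proof -
  assume v: "Hk 2 v"
  show ?thesis
    using divergence_AE[OF has_weak_pderiv_curl[OF v]] wpderiv_commute_AE[OF v]
  proof eventually_elim
    case (elim x)
    have e: "wpderiv 2 (wpderiv 1 v) x = wpderiv 1 (wpderiv 2 v) x" "wpderiv 3 (wpderiv 1 v) x = wpderiv 1 (wpderiv 3 v) x"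
      "wpderiv 3 (wpderiv 2 v) x = wpderiv 2 (wpderiv 3 v) x" using elim(2) by blast+
    show ?case unfolding elim(1) by (simp add: sum_3 curl_def e)
  qed
qed

lemma divergence_add:
  assumes "Hk 1 v" "Hk 1 w"
  shows "AE x in lborel. divergence (\<lambda>x. v x + w x) x = divergence v x + divergence w x"
  using divergence_AE[OF has_weak_pderiv_add[OF Hk_wpderiv(1)[OF assms(1)[unfolded One_nat_def]] Hk_wpderiv(1)[OF assms(2)[unfolded One_nat_def]]]]
  by eventually_elim (simp add: divergence_def sum.distrib)

text \<open>In curl curl = grad div - Laplacian the gradient drops out: the weak derivatives of a
  divergence that is 0 almost everywhere are 0 by uniqueness.\<close>

lemma curl_curl_div_free:
  assumes v: "Hk 2 v" and div: "AE x in lborel. divergence v x = 0"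
  shows "AE x in lborel. curl (curl v) x = - laplacian v x"
proof -
  note v2 = Hk2D[OF v]
  note vd = Hk_wpderiv(2)[OF v2]
  have "AE x in lborel. (\<Sum>k\<in>UNIV. wpderiv j (wpderiv k v) x $ k) = 0" for j
  proof -
    have w: "has_weak_pderiv j (\<lambda>x. divergence v x) (\<lambda>x. \<Sum>k\<in>UNIV. wpderiv j (wpderiv k v) x $ k)"
      unfolding divergence_def by (intro has_weak_pderiv_sum finite has_weak_pderiv_nth Hk_wpderiv(1)[OF vd])
    have "has_weak_pderiv j (\<lambda>x. 0) (\<lambda>x. \<Sum>k\<in>UNIV. wpderiv j (wpderiv k v) x $ k)"
      by (rule has_weak_pderiv_cong_AE[OF w _ L1_locD(2)[OF has_weak_pderivD(2)[OF w]] div]) auto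
    from weak_pderiv_unique[OF this has_weak_pderiv_zero] show ?thesis .
  qed
  then have "AE x in lborel. \<forall>j\<in>UNIV. (\<Sum>k\<in>UNIV. wpderiv j (wpderiv k v) x $ k) = 0"
    by (intro AE_finite_allI finite)
  with curl_AE[OF has_weak_pderiv_curl[OF v]] show ?thesis
  proof eventually_elim
    case (elim x)
    have e: "wpderiv j (wpderiv 1 v) x $ 1 + wpderiv j (wpderiv 2 v) x $ 2 + wpderiv j (wpderiv 3 v) x $ 3 = 0" for j
      using elim(2) by (simp add: sum_3)
    show ?case
      using e[of 1] e[of 2] e[of 3] unfolding elim(1)
      by (simp add: vec_eq_iff forall_3 sum_3 cross3_def axis_def curl_def laplacian_def)
  qed
qed

text \<open>Pair v with curl curl v = - Laplacian v and integrate by parts. For the velocity this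
  recovers the whole gradient from curl u = W - B.\<close>

lemma grad_norm_eq_curl_norm:
  assumes v: "Hk 2 v" and div: "AE x in lborel. divergence v x = 0"
  shows "(\<Sum>i\<in>UNIV. (L2_norm (wpderiv i v))\<^sup>2) = (L2_norm (curl v))\<^sup>2"
proof -
  have v1: "Hk 1 v" by (rule Hk_2_imp_1[OF v])
  have c: "Hk 1 (curl v)" using Hk_curl[OF Hk2D[OF v]] by (simp only: One_nat_def)
  have "(L2_norm (curl v))\<^sup>2 = ip v (curl (curl v))"
    unfolding L2_norm_sq by (rule curl_symmetric[OF v1 c])
  also have "\<dots> = ip v (\<lambda>x. - laplacian v x)"
    by (rule ip_cong_AE)
      (use curl_curl_div_free[OF v div] Hk_measurable[OF v] L2_measurable[OF L2_laplacian[OF v]]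
        Hk_measurable[OF Hk_curl[OF c[unfolded One_nat_def]]] in auto)
  also have "\<dots> = (\<Sum>i\<in>UNIV. ip (wpderiv i v) (wpderiv i v))"
    using ip_laplacian[OF v v1] by (simp add: ip_minus_right ip_commute)
  finally show ?thesis by (simp add: L2_norm_sq)
qed

lemma has_weak_pderiv_cross3:
  fixes v w :: "real^3 \<Rightarrow> real^3"
  assumes d: "has_weak_pderiv i v v'" "has_weak_pderiv i w w'" and L: "L2 v" "L2 v'" "L2 w" "L2 w'"
  shows "has_weak_pderiv i (\<lambda>x. cross3 (v x) (w x)) (\<lambda>x. cross3 (v' x) (w x) + cross3 (v x) (w' x))"
proof (rule has_weak_pderiv_vecI)
  fix k :: 3
  have m: "has_weak_pderiv i (\<lambda>x. v x $ a * w x $ b - v x $ c * w x $ e)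
     (\<lambda>x. (v' x $ a * w x $ b + v x $ a * w' x $ b) - (v' x $ c * w x $ e + v x $ c * w' x $ e))" for a b c e
    by (intro has_weak_pderiv_diff has_weak_pderiv_mult has_weak_pderiv_nth d L2_nth L)
  have "k = 1 \<or> k = 2 \<or> k = 3" by (rule exhaust_3)
  then show "has_weak_pderiv i (\<lambda>x. cross3 (v x) (w x) $ k) (\<lambda>x. (cross3 (v' x) (w x) + cross3 (v x) (w' x)) $ k)"
    using m[of 2 3 3 2] m[of 3 1 1 3] m[of 1 2 2 1]
    by (auto simp: cross3_def algebra_simps)
qed

lemma has_weak_pderiv_inner:
  fixes v w :: "real^3 \<Rightarrow> real^3"
  assumes d: "has_weak_pderiv i v v'" "has_weak_pderiv i w w'" and L: "L2 v" "L2 v'" "L2 w" "L2 w'"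
  shows "has_weak_pderiv i (\<lambda>x. v x \<bullet> w x) (\<lambda>x. v' x \<bullet> w x + v x \<bullet> w' x)"
proof -
  have "has_weak_pderiv i (\<lambda>x. \<Sum>k\<in>UNIV. v x $ k * w x $ k) (\<lambda>x. \<Sum>k\<in>UNIV. (v' x $ k * w x $ k + v x $ k * w' x $ k))"
    by (intro has_weak_pderiv_sum finite has_weak_pderiv_mult has_weak_pderiv_nth d L2_nth L)
  then show ?thesis by (simp add: inner_vec_def sum.distrib)
qed

section \<open>The embedding of H^1 into L4, and products of H^1 fields\<close>

lemma L4_real:
  fixes f :: "real^3 \<Rightarrow> real"
  assumes w: "\<And>i. has_weak_pderiv i f (g i)" and L: "L2 f" "\<And>i. L2 (g i)"
  shows "integrable lborel (\<lambda>x. (f x)^4)"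
    "(\<integral>x. (f x)^4 \<partial>lborel) \<le> 8 * L2_norm f * L2_norm (g 1) * L2_norm (g 2) * L2_norm (g 3)"
proof -
  note [measurable] = L2_measurable[OF L(1)] L2_measurable[OF L(2)]
  let ?I = "\<integral>\<^sup>+x. ennreal ((f x)^4) \<partial>lborel"
  \<comment> \<open>8 is the square root of the constant 64 in
    \<open>ladyzhenskaya_nn\<close>.\<close>
  let ?R = "8 * L2_norm f * L2_norm (g 1) * L2_norm (g 2) * L2_norm (g 3)"
  have b: "AE x in lborel. ennreal ((f x)\<^sup>2) \<le> (\<integral>\<^sup>+s. ennreal \<bar>2 * f (x + s *\<^sub>R ax i) * g i (x + s *\<^sub>R ax i)\<bar> \<partial>lborel)" for i
  proof -
    \<comment> \<open>The line bound is applied to f^2, which is nonnegative and integrable.\<close>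
    have "has_weak_pderiv i (\<lambda>x. (f x)\<^sup>2) (\<lambda>x. 2 * f x * g i x)"
      using has_weak_pderiv_mult[OF w w L(1) L(2) L(1) L(2), of i] by (simp add: power2_eq_square algebra_simps)
    then show ?thesis
      by (rule weak_pderiv_line_bound) (use L2_integrable[OF L(1)] in simp_all)
  qed
  have n: "(\<integral>\<^sup>+x. ennreal ((h x)\<^sup>2) \<partial>lborel) = ennreal ((L2_norm h)\<^sup>2)" if "L2 h" for h :: "real^3 \<Rightarrow> real"
    using nn_integral_L2[OF that] by simp
  have R0: "0 \<le> ?R" by (simp add: L2_norm_nonneg)
  have "?I\<^sup>2 \<le> 64 * ennreal ((L2_norm f)\<^sup>2) * ennreal ((L2_norm (g 1))\<^sup>2) * ennreal ((L2_norm (g 2))\<^sup>2) * ennreal ((L2_norm (g 3))\<^sup>2)"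
    using ladyzhenskaya_nn[OF _ _ b] by (simp add: n L)
  also have "\<dots> = ennreal (?R\<^sup>2)"
    by (simp add: ennreal_mult power_mult_distrib flip: ennreal_numeral)
  finally have I2: "?I\<^sup>2 \<le> ennreal (?R\<^sup>2)" .
  then have "?I\<^sup>2 < top" using ennreal_less_top by (rule le_less_trans)
  then have fin: "?I < \<infinity>" by (auto simp: power2_eq_square ennreal_mult_less_top)
  show i: "integrable lborel (\<lambda>x. (f x)^4)"
    unfolding integrable_iff_bounded using fin by simp
  have "?I = ennreal (\<integral>x. (f x)^4 \<partial>lborel)" by (intro nn_integral_eq_integral i) simp
  with I2 have "(\<integral>x. (f x)^4 \<partial>lborel)\<^sup>2 \<le> ?R\<^sup>2" by (simp add: ennreal_power)
  then show "(\<integral>x. (f x)^4 \<partial>lborel) \<le> ?R" using R0 by (rule power2_le_imp_le)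
qed

lemma L2_norm_nth_le: "L2 v \<Longrightarrow> L2_norm (\<lambda>x. v x $ k) \<le> L2_norm v" for v :: "real^3 \<Rightarrow> real^3"
  using L2_norm_mono[of v "\<lambda>x. v x $ k" 1] by (simp add: L2_measurable L2_nth component_le_norm_cart)

lemma grad_L2_norm_ge: "L2_norm (wpderiv i v) \<le> grad_L2_norm v"
  unfolding grad_L2_norm_def
  by (rule real_le_rsqrt) (rule member_le_sum, auto)

text \<open>72 = 3 * 3 * 8: squaring a sum of three terms costs a factor 3, and each of the three
  components contributes 8, its norms being bounded by those of v.\<close>

theorem ladyzhenskaya:
  assumes v: "Hk 1 v"
  shows "integrable lborel (\<lambda>x. (norm (v x))^4)"
    "(\<integral>x. (norm (v x))^4 \<partial>lborel) \<le> 72 * L2_norm v * (grad_L2_norm v)^3"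
proof -
  note v' = v[unfolded One_nat_def]
  note Lv = Hk_L2[OF v] and Ld = Hk_L2[OF Hk_wpderiv(2)[OF v']]
  note L4 = L4_real[OF has_weak_pderiv_nth[OF Hk_wpderiv(1)[OF v']] L2_nth[OF Lv] L2_nth[OF Ld]]
  have le: "(norm (v x))^4 \<le> 3 * (\<Sum>k\<in>UNIV. (v x $ k)^4)" for x
  proof -
    have "(norm (v x))^4 = ((norm (v x))\<^sup>2)\<^sup>2" by simp
    also have "(norm (v x))\<^sup>2 = (\<Sum>k\<in>UNIV. (v x $ k)\<^sup>2)"
      unfolding power2_norm_eq_inner inner_vec_def by (simp add: power2_eq_square)
    also have "\<dots>\<^sup>2 \<le> 3 * (\<Sum>k\<in>UNIV. ((v x $ k)\<^sup>2)\<^sup>2)"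
      using Cauchy_Schwarz_ineq_sum[of "\<lambda>_. 1" "\<lambda>k. (v x $ k)\<^sup>2" "UNIV :: 3 set"] by simp
    finally show ?thesis by simp
  qed
  have i3: "integrable lborel (\<lambda>x. 3 * (\<Sum>k\<in>UNIV. (v x $ k)^4))"
    by (intro integrable_mult_right Bochner_Integration.integrable_sum L4)
  show i: "integrable lborel (\<lambda>x. (norm (v x))^4)"
    by (rule Bochner_Integration.integrable_bound[OF i3])
      (use Hk_measurable[OF v] order_trans[OF le abs_ge_self] in auto)
  have k: "(\<integral>x. (v x $ k)^4 \<partial>lborel) \<le> 8 * L2_norm v * (grad_L2_norm v)^3" for k
  proof -
    have g: "L2_norm (\<lambda>x. wpderiv i v x $ k) \<le> grad_L2_norm v" for i
      using L2_norm_nth_le[OF Ld] grad_L2_norm_ge by (rule order_trans)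
    have "(\<integral>x. (v x $ k)^4 \<partial>lborel) \<le> 8 * L2_norm (\<lambda>x. v x $ k) * L2_norm (\<lambda>x. wpderiv 1 v x $ k)
        * L2_norm (\<lambda>x. wpderiv 2 v x $ k) * L2_norm (\<lambda>x. wpderiv 3 v x $ k)" by (rule L4)
    also have "\<dots> \<le> 8 * L2_norm v * grad_L2_norm v * grad_L2_norm v * grad_L2_norm v"
      by (intro mult_mono mult_left_mono g L2_norm_nth_le Lv mult_nonneg_nonneg L2_norm_nonneg order_trans[OF L2_norm_nonneg g]) auto
    finally show ?thesis by (simp add: power3_eq_cube mult_ac)
  qed
  have "(\<integral>x. (norm (v x))^4 \<partial>lborel) \<le> (\<integral>x. 3 * (\<Sum>k\<in>UNIV. (v x $ k)^4) \<partial>lborel)"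
    by (rule integral_mono[OF i i3 le])
  also have "\<dots> = 3 * (\<Sum>k\<in>UNIV. \<integral>x. (v x $ k)^4 \<partial>lborel)"
    using L4(1) by (simp add: Bochner_Integration.integral_sum)
  also have "\<dots> \<le> 72 * L2_norm v * (grad_L2_norm v)^3"
    using k[of 1] k[of 2] k[of 3] by (simp add: sum_3)
  finally show "(\<integral>x. (norm (v x))^4 \<partial>lborel) \<le> 72 * L2_norm v * (grad_L2_norm v)^3" .
qed

text \<open>H^1 fields are in L4, so whatever is dominated by the product of two of them is in L2.
  The quadratic terms of the equations are covered in this way.\<close>

lemma L2_product:
  fixes v w :: "real^3 \<Rightarrow> real^3" and q :: "real^3 \<Rightarrow> 'b::euclidean_space"
  assumes v: "Hk 1 v" and w: "Hk 1 w" and q: "q \<in> borel_measurable borel"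
    and b: "\<And>x. norm (q x) \<le> norm (v x) * norm (w x)"
  shows "L2 q"
  unfolding L2_def
proof
  show "q \<in> borel_measurable lborel" using q by simp
  show "integrable lborel (\<lambda>x. (norm (q x))\<^sup>2)"
  proof (rule Bochner_Integration.integrable_bound)
    show "integrable lborel (\<lambda>x. (norm (v x))^4 + (norm (w x))^4)"
      by (intro Bochner_Integration.integrable_add ladyzhenskaya v w)
    have "(norm (q x))\<^sup>2 \<le> (norm (v x))^4 + (norm (w x))^4" for x
    proof -
      have "(norm (q x))\<^sup>2 \<le> (norm (v x) * norm (w x))\<^sup>2" by (intro power_mono b) simp
      also have "\<dots> = (norm (v x))\<^sup>2 * (norm (w x))\<^sup>2" by (rule power_mult_distrib)
      also have "\<dots> \<le> (norm (v x))^4 + (norm (w x))^4"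
      proof -
        have p: "2 * ((norm (v x))\<^sup>2 * (norm (w x))\<^sup>2) \<le> ((norm (v x))\<^sup>2)\<^sup>2 + ((norm (w x))\<^sup>2)\<^sup>2"
          using sum_squares_bound[of "(norm (v x))\<^sup>2" "(norm (w x))\<^sup>2"] by (simp only: mult.assoc)
        have n: "0 \<le> (norm (v x))\<^sup>2 * (norm (w x))\<^sup>2" by simp
        have e: "((norm z)\<^sup>2)\<^sup>2 = (norm z)^4" for z :: "real^3" by (simp flip: power_mult)
        show ?thesis using p n unfolding e by linarith
      qed
      finally show ?thesis .
    qed
    then show "AE x in lborel. norm ((norm (q x))\<^sup>2) \<le> norm ((norm (v x))^4 + (norm (w x))^4)" by simp
  qed (use q in measurable)
qed

lemma norm_cross3_le: "norm (cross3 x y) \<le> norm x * norm y"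
  by (rule power2_le_imp_le) (simp_all add: norm_cross power_mult_distrib)

lemma measurable_cross3:
  fixes v w :: "real^3 \<Rightarrow> real^3"
  assumes "v \<in> borel_measurable borel" "w \<in> borel_measurable borel"
  shows "(\<lambda>x. cross3 (v x) (w x)) \<in> borel_measurable borel"
proof (rule measurable_vecI)
  fix k :: 3
  note [measurable] = measurable_nth[OF assms(1)] measurable_nth[OF assms(2)]
  have m: "(\<lambda>x. v x $ a * w x $ b - v x $ c * w x $ e) \<in> borel_measurable borel" for a b c e by measurable
  show "(\<lambda>x. cross3 (v x) (w x) $ k) \<in> borel_measurable borel"
    using exhaust_3[of k] m[of 2 3 3 2] m[of 3 1 1 3] m[of 1 2 2 1] by (auto simp: cross3_def)
qed

lemma L2_cross3: "Hk 1 v \<Longrightarrow> Hk 1 w \<Longrightarrow> L2 (\<lambda>x. cross3 (v x) (w x))"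
  by (rule L2_product[of v w]) (simp_all add: measurable_cross3 Hk_measurable norm_cross3_le del: One_nat_def)

lemma Hk_cross3:
  assumes v: "Hk 2 v" and w: "Hk 2 w" shows "Hk 1 (\<lambda>x. cross3 (v x) (w x))"
proof -
  note v2 = Hk2D[OF v] and w2 = Hk2D[OF w]
  have 1: "Hk 1 v" "Hk 1 w" "Hk 1 (wpderiv i v)" "Hk 1 (wpderiv i w)" for i
    by (intro Hk_2_imp_1 Hk_2_wpderiv v w)+
  show ?thesis unfolding One_nat_def
    by (rule Hk_SucI[OF L2_cross3[OF 1(1,2)] has_weak_pderiv_cross3[OF Hk_wpderiv(1)[OF v2] Hk_wpderiv(1)[OF w2]
            Hk_L2[OF 1(1)] Hk_L2[OF 1(3)] Hk_L2[OF 1(2)] Hk_L2[OF 1(4)]]])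
      (simp add: L2_add L2_cross3 1 del: One_nat_def)
qed

text \<open>Lagrange's formula produces these two terms and two multiples of the divergences. It
  turns the transport and stretching terms of the magnetic equation into - curl (u x B).\<close>

lemma curl_cross3_AE:
  assumes v: "Hk 2 v" and w: "Hk 2 w" and div: "AE x in lborel. divergence v x = 0" "AE x in lborel. divergence w x = 0"
  shows "AE x in lborel. curl (\<lambda>x. cross3 (v x) (w x)) x = advect w v x - advect v w x"
proof -
  note v2 = Hk2D[OF v] and w2 = Hk2D[OF w]
  have L: "L2 v" "L2 w" "L2 (wpderiv i v)" "L2 (wpderiv i w)" for i
    using Hk_L2[OF v] Hk_L2[OF w] Hk_L2[OF Hk_wpderiv(2)[OF v2]] Hk_L2[OF Hk_wpderiv(2)[OF w2]] by auto
  have "AE x in lborel. curl (\<lambda>x. cross3 (v x) (w x)) x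
      = (\<Sum>i\<in>UNIV. cross3 (ax i) (cross3 (wpderiv i v x) (w x) + cross3 (v x) (wpderiv i w x)))"
    by (rule curl_AE[OF has_weak_pderiv_cross3[OF Hk_wpderiv(1)[OF v2] Hk_wpderiv(1)[OF w2] L(1) L(3) L(2) L(4)]])
  with div show ?thesis
  proof eventually_elim
    case (elim x)
    have "(\<Sum>i\<in>UNIV. cross3 (ax i) (cross3 (wpderiv i v x) (w x) + cross3 (v x) (wpderiv i w x)))
       = advect w v x - divergence v x *\<^sub>R w x + divergence w x *\<^sub>R v x - advect v w x"
    proof -
      have l: "cross3 (ax i) (cross3 a b) = (b $ i) *\<^sub>R a - (a $ i) *\<^sub>R b" for i and a b :: "real^3"
        by (simp add: Lagrange cart_eq_inner_axis inner_commute)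
      show ?thesis
        unfolding cross_add_right l
        by (simp add: advect_def divergence_def sum.distrib sum_subtractf scaleR_sum_left)
    qed
    then show ?case using elim by simp
  qed
qed

text \<open>The Lamb form of convection: the last term is the gradient of |u|^2 / 2, to be absorbed
  into the pressure.\<close>

lemma advect_self: "advect u u x = cross3 (curl u x) (u x) + (\<chi> i. wpderiv i u x \<bullet> u x)"
proof -
  have l: "cross3 (cross3 (ax i) a) b = (b $ i) *\<^sub>R a - (a \<bullet> b) *\<^sub>R ax i" for i and a b :: "real^3"
    by (subst cross_skew) (simp add: Lagrange cart_eq_inner_axis inner_commute)
  have "cross3 (curl u x) (u x) = (\<Sum>i\<in>UNIV. cross3 (cross3 (ax i) (wpderiv i u x)) (u x))"
    by (simp add: curl_eq sum_3 cross_add_left)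
  then show ?thesis unfolding l
    by (simp add: advect_def sum_subtractf) (simp add: vec_eq_iff forall_3 sum_3 axis_def)
qed

text \<open>By symmetry of second derivatives the terms of the pairing cancel in pairs. Arguing with
  first derivatives of w keeps the requirement at H^1.\<close>

lemma gradient_orthogonal_curl:
  fixes p :: "real^3 \<Rightarrow> real"
  assumes p: "\<And>i. has_weak_pderiv i p (G i)" and G: "\<And>i. L2 (G i)" and w: "Hk 1 w"
  shows "ip (\<lambda>x. \<chi> i. G i x) (curl w) = 0"
proof -
  note w' = w[unfolded One_nat_def]
  note Lw = Hk_L2[OF w] and Ld = Hk_L2[OF Hk_wpderiv(2)[OF w']]
  have s: "ip (G i) (\<lambda>x. wpderiv j w x $ k) = ip (G j) (\<lambda>x. wpderiv i w x $ k)" for i j k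
    by (intro weak_gradient_symmetric[OF p p G G has_weak_pderiv_nth[OF Hk_wpderiv(1)[OF w']] has_weak_pderiv_nth[OF Hk_wpderiv(1)[OF w']]] L2_nth Lw Ld)
  have "ip (\<lambda>x. \<chi> i. G i x) (curl w) = (\<Sum>k\<in>UNIV. ip (G k) (\<lambda>x. curl w x $ k))"
    by (subst ip_nth) (auto intro!: L2_vecI G Hk_L2[OF Hk_curl[OF w']])
  also have "\<dots> = 0"
    by (simp add: sum_3 curl_def ip_diff_right G L2_nth Ld s[of 2 1] s[of 3 1] s[of 3 2])
  finally show ?thesis .
qed

lemma gradient_orthogonal:
  fixes p :: "real^3 \<Rightarrow> real"
  assumes p: "\<And>i. has_weak_pderiv i p (G i)" and G: "\<And>i. L2 (G i)" and u: "Hk 1 u"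
    and div: "AE x in lborel. divergence u x = 0"
  shows "ip (\<lambda>x. \<chi> i. G i x) u = 0"
proof -
  note u' = u[unfolded One_nat_def]
  note Lu = Hk_L2[OF u] and Ld = Hk_L2[OF Hk_wpderiv(2)[OF u']]
  have "(\<Sum>i\<in>UNIV. ip (G i) (\<lambda>x. u x $ i)) = 0"
    by (rule gradient_orthogonal_div_free[OF p G L2_nth[OF Lu] has_weak_pderiv_nth[OF Hk_wpderiv(1)[OF u']] L2_nth[OF Ld] div[unfolded divergence_def]])
  then show ?thesis by (subst ip_nth) (auto intro!: L2_vecI G Lu)
qed

section \<open>Energy identities at a fixed time\<close>

lemma grad_L2_norm_sq: "(grad_L2_norm v)\<^sup>2 = (\<Sum>i\<in>UNIV. (L2_norm (wpderiv i v))\<^sup>2)"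
  by (simp add: grad_L2_norm_def sum_nonneg)

lemma grad_L2_norm_nonneg: "0 \<le> grad_L2_norm v"
  by (simp add: grad_L2_norm_def sum_nonneg)

lemma sum_ip_le_grad:
  assumes v: "Hk 1 v" and w: "Hk 1 w"
  shows "\<bar>\<Sum>i\<in>UNIV. ip (wpderiv i v) (wpderiv i w)\<bar> \<le> grad_L2_norm v * grad_L2_norm w"
proof -
  have L: "L2 (wpderiv i v)" "L2 (wpderiv i w)" for i
    using Hk_L2[OF Hk_wpderiv(2)[OF v[unfolded One_nat_def]]] Hk_L2[OF Hk_wpderiv(2)[OF w[unfolded One_nat_def]]] by auto
  have "\<bar>\<Sum>i\<in>UNIV. ip (wpderiv i v) (wpderiv i w)\<bar> \<le> (\<Sum>i\<in>UNIV. L2_norm (wpderiv i v) * L2_norm (wpderiv i w))"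
    by (rule order_trans[OF sum_abs]) (intro sum_mono ip_abs_le L)
  also have "\<dots> \<le> grad_L2_norm v * grad_L2_norm w"
  proof (rule power2_le_imp_le)
    show "(\<Sum>i\<in>UNIV. L2_norm (wpderiv i v) * L2_norm (wpderiv i w))\<^sup>2 \<le> (grad_L2_norm v * grad_L2_norm w)\<^sup>2"
      unfolding power_mult_distrib grad_L2_norm_sq by (rule Cauchy_Schwarz_ineq_sum)
  qed (simp add: grad_L2_norm_nonneg)
  finally show ?thesis .
qed

lemma L2_advect: 
  assumes "Hk 1 v" "Hk 2 w" shows "L2 (advect v w)"
  unfolding advect_def[abs_def]
proof (intro L2_sum finite)
  fix i :: 3
  have d: "Hk 1 (wpderiv i w)" by (rule Hk_2_wpderiv[OF assms(2)])
  show "L2 (\<lambda>x. v x $ i *\<^sub>R wpderiv i w x)"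
    by (rule L2_product[OF assms(1) d])
      (auto intro!: borel_measurable_scaleR measurable_nth Hk_measurable[OF assms(1)] Hk_measurable[OF d] mult_right_mono component_le_norm_cart)
qed

lemma has_weak_pderiv_half_norm_sq:
  fixes w :: "real^3 \<Rightarrow> real^3"
  assumes w: "Hk 1 w"
  shows "has_weak_pderiv i (\<lambda>x. (1/2) *\<^sub>R (w x \<bullet> w x)) (\<lambda>x. wpderiv i w x \<bullet> w x)"
proof -
  note w' = Hk_wpderiv[OF w[unfolded One_nat_def]]
  have "has_weak_pderiv i (\<lambda>x. (1/2) *\<^sub>R (w x \<bullet> w x)) (\<lambda>x. (1/2) *\<^sub>R (wpderiv i w x \<bullet> w x + w x \<bullet> wpderiv i w x))"
    by (intro has_weak_pderiv_scaleR has_weak_pderiv_inner w'(1) Hk_L2[OF w] Hk_L2[OF w'(2)])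
  moreover have "(1/2) *\<^sub>R (wpderiv i w x \<bullet> w x + w x \<bullet> wpderiv i w x) = wpderiv i w x \<bullet> w x" for x
    using inner_commute[of "w x" "wpderiv i w x"] by simp
  ultimately show ?thesis by (simp only:)
qed

text \<open>(u.grad w).w is the inner product of u with the gradient of |w|^2 / 2, and a
  divergence-free field is orthogonal to square integrable gradients.\<close>

lemma ip_advect_self:
  assumes u: "Hk 1 u" and w: "Hk 2 w" and div: "AE x in lborel. divergence u x = 0"
  shows "ip (advect u w) w = 0"
proof -
  have w1: "Hk 1 w" "Hk 1 (wpderiv i w)" for i
    by (intro Hk_2_imp_1 Hk_2_wpderiv w)+
  define G where "G i x = wpderiv i w x \<bullet> w x" for i x
  have wk: "has_weak_pderiv i (\<lambda>x. (1 / 2) *\<^sub>R (w x \<bullet> w x)) (G i)" for i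
    unfolding G_def[abs_def] by (rule has_weak_pderiv_half_norm_sq[OF w1(1)])
  have G: "L2 (G i)" for i
    by (rule L2_product[OF w1(2)[of i] w1(1) L1_locD(2)[OF has_weak_pderivD(2)[OF wk]]]) (simp add: G_def Cauchy_Schwarz_ineq2)
  have "ip (\<lambda>x. \<chi> i. G i x) u = 0" by (rule gradient_orthogonal[OF wk G u div])
  moreover have "ip (advect u w) w = ip (\<lambda>x. \<chi> i. G i x) u"
    unfolding ip_def
  proof (intro Bochner_Integration.integral_cong refl)
    fix x
    have "(\<chi> i. G i x) \<bullet> u x = (\<Sum>i\<in>UNIV. u x $ i * G i x)"
      by (simp add: inner_vec_def mult.commute)
    also have "\<dots> = advect u w x \<bullet> w x"
      by (simp only: advect_def inner_sum_left inner_scaleR_left G_def)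
    finally show "advect u w x \<bullet> w x = (\<chi> i. G i x) \<bullet> u x" by simp
  qed
  ultimately show ?thesis by simp
qed

text \<open>By symmetry of the curl the left pairing is that of w.grad u - u.grad w with w. The
  second part vanishes, so the derivative falls on u, and Cauchy-Schwarz leaves |grad u| times the
  square of the L4 norm of w. The fourth power avoids roots; 5184 = 72^2.\<close>

theorem trilinear_bound:
  assumes u: "Hk 2 u" and w: "Hk 2 w"
    and div: "AE x in lborel. divergence u x = 0" "AE x in lborel. divergence w x = 0"
  shows "(ip (\<lambda>x. cross3 (u x) (w x)) (curl w))^4 \<le> 5184 * (grad_L2_norm u)^4 * (L2_norm w)\<^sup>2 * (grad_L2_norm w)^6"
proof -
  have 1: "Hk 1 w" "Hk 1 u" "Hk 1 (wpderiv i u)" for i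
    by (intro Hk_2_imp_1 Hk_2_wpderiv u w)+
  have c: "Hk 1 (\<lambda>x. cross3 (u x) (w x))" by (rule Hk_cross3[OF u w])
  \<comment> \<open>The fields w_i w, whose squared lengths add up to |w|^4.\<close>
  define q where "q i x = w x $ i *\<^sub>R w x" for i x
  have qm: "q i \<in> borel_measurable borel" for i
    unfolding q_def by (intro borel_measurable_scaleR measurable_nth Hk_measurable[OF w])
  have q: "L2 (q i)" for i
    by (rule L2_product[OF 1(1) 1(1) qm]) (simp add: q_def mult_right_mono component_le_norm_cart)
  have Ld: "L2 (wpderiv i u)" for i by (rule Hk_L2[OF 1(3)])
  have "ip (\<lambda>x. cross3 (u x) (w x)) (curl w) = ip (curl (\<lambda>x. cross3 (u x) (w x))) w"
    by (rule curl_symmetric[OF c 1(1), symmetric])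
  also have "\<dots> = ip (\<lambda>x. advect w u x - advect u w x) w"
    by (rule ip_cong_AE[OF _ _ _ _ curl_cross3_AE[OF u w div]])
      (auto intro!: Hk_measurable[OF Hk_curl[OF c[unfolded One_nat_def]]] L2_measurable[OF L2_diff[OF L2_advect[OF 1(1) u] L2_advect[OF 1(2) w]]] Hk_measurable[OF w])
  also have "\<dots> = ip (advect w u) w - ip (advect u w) w"
    by (intro ip_diff_left L2_advect 1 u w Hk_L2[OF w])
  also have "ip (advect u w) w = 0" by (rule ip_advect_self[OF 1(2) w div(1)])
  also have "ip (advect w u) w = (\<Sum>i\<in>UNIV. ip (\<lambda>x. w x $ i *\<^sub>R wpderiv i u x) w)"
    unfolding advect_def[abs_def]
  proof (intro ip_sum_left finite)
    show "L2 (\<lambda>x. w x $ i *\<^sub>R wpderiv i u x)" for i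
      by (rule L2_product[OF 1(1) 1(3)[of i]])
        (auto intro!: borel_measurable_scaleR measurable_nth Hk_measurable[OF w] Hk_measurable[OF 1(3)] mult_right_mono component_le_norm_cart)
  qed (rule Hk_L2[OF w])
  also have "(\<Sum>i\<in>UNIV. ip (\<lambda>x. w x $ i *\<^sub>R wpderiv i u x) w) = (\<Sum>i\<in>UNIV. ip (wpderiv i u) (q i))"
    unfolding ip_def q_def by (intro sum.cong Bochner_Integration.integral_cong refl) simp
  finally have e: "ip (\<lambda>x. cross3 (u x) (w x)) (curl w) = (\<Sum>i\<in>UNIV. ip (wpderiv i u) (q i))" by simp
  have Q: "(\<Sum>i\<in>UNIV. (L2_norm (q i))\<^sup>2) = (\<integral>x. (norm (w x))^4 \<partial>lborel)"
  proof -
    have "(\<Sum>i\<in>UNIV. (L2_norm (q i))\<^sup>2) = (\<Sum>i\<in>UNIV. \<integral>x. (norm (q i x))\<^sup>2 \<partial>lborel)"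
      by (simp add: L2_norm_def)
    also have "\<dots> = (\<integral>x. (\<Sum>i\<in>UNIV. (norm (q i x))\<^sup>2) \<partial>lborel)"
      by (rule Bochner_Integration.integral_sum[symmetric]) (rule L2_integrable[OF q])
    also have "\<dots> = (\<integral>x. (norm (w x))^4 \<partial>lborel)"
    proof (intro Bochner_Integration.integral_cong refl)
      fix x
      have "(\<Sum>i\<in>UNIV. (norm (q i x))\<^sup>2) = (\<Sum>i\<in>UNIV. (w x $ i)\<^sup>2) * (norm (w x))\<^sup>2"
        by (simp add: q_def power_mult_distrib sum_distrib_right)
      also have "(\<Sum>i\<in>UNIV. (w x $ i)\<^sup>2) = (norm (w x))\<^sup>2"
        unfolding power2_norm_eq_inner inner_vec_def by (simp add: power2_eq_square)
      finally show "(\<Sum>i\<in>UNIV. (norm (q i x))\<^sup>2) = (norm (w x))^4" by (simp flip: power_add)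
    qed
    finally show ?thesis .
  qed
  have "(ip (\<lambda>x. cross3 (u x) (w x)) (curl w))\<^sup>2 \<le> (\<Sum>i\<in>UNIV. L2_norm (wpderiv i u) * L2_norm (q i))\<^sup>2"
    unfolding e abs_le_square_iff[symmetric]
    using order_trans[OF sum_abs sum_mono[OF ip_abs_le[OF Ld q]]] abs_ge_self by (rule order_trans)
  also have "\<dots> \<le> (grad_L2_norm u)\<^sup>2 * (\<integral>x. (norm (w x))^4 \<partial>lborel)"
    unfolding grad_L2_norm_sq Q[symmetric] by (rule Cauchy_Schwarz_ineq_sum)
  also have "\<dots> \<le> (grad_L2_norm u)\<^sup>2 * (72 * L2_norm w * (grad_L2_norm w)^3)"
    by (intro mult_left_mono ladyzhenskaya 1) simp
  finally have "((ip (\<lambda>x. cross3 (u x) (w x)) (curl w))\<^sup>2)\<^sup>2 \<le> ((grad_L2_norm u)\<^sup>2 * (72 * L2_norm w * (grad_L2_norm w)^3))\<^sup>2"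
    by (intro power_mono) auto
  then show ?thesis by (simp add: power_mult_distrib mult_ac flip: power_mult)
qed

text \<open>Young's inequality with exponents 4 and 4/3, constants not optimised. If a <= e^4 D then
  t <= e D; otherwise t <= a / e^3.\<close>

lemma young_four_thirds:
  fixes t :: real
  assumes t: "t^4 \<le> a * D^3" and "a \<ge> 0" "D \<ge> 0" "e > 0"
  shows "t \<le> e * D + a / e^3"
proof (cases "a \<le> e^4 * D")
  case True
  have "t^4 \<le> (e^4 * D) * D^3" using t mult_right_mono[OF True, of "D^3"] assms by simp
  also have "\<dots> = (e * D)^4" by (simp add: power_mult_distrib power4_eq_xxxx power3_eq_cube)
  finally have "t \<le> e * D" using assms by (intro power_le_imp_le_base[of t 3 "e * D"]) auto
  then show ?thesis using assms by (simp add: add_increasing2)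
next
  case False
  then have "D \<le> a / e^4" using assms by (simp add: field_simps)
  then have "D^3 \<le> (a / e^4)^3" using assms by (intro power_mono)
  then have "a * D^3 \<le> a * (a / e^4)^3" using assms by (intro mult_left_mono)
  also have "\<dots> = (a / e^3)^4" using assms by (simp add: power_divide power4_eq_xxxx power3_eq_cube flip: power_mult)
  finally have "t^4 \<le> (a / e^3)^4" using t by linarith
  then have "t \<le> a / e^3" using assms by (intro power_le_imp_le_base[of t 3 "a / e^3"]) auto
  then show ?thesis using assms by (simp add: add_increasing)
qed

text \<open>The solution frozen at one instant, with the time derivatives reduced to L2 functions.
  The spatial identities are proved here; the dependence on time is treated separately.\<close>

locale hall_mhd_instant =
  fixes \<nu> \<eta> :: real and u B u' B' :: "real^3 \<Rightarrow> real^3" and p :: "real^3 \<Rightarrow> real"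
  assumes u3: "Hk 3 u" and B3: "Hk 3 B"
    and div_u: "AE x in lborel. divergence u x = 0" and div_B: "AE x in lborel. divergence B x = 0"
    and p_weak: "\<And>i. \<exists>g. has_weak_pderiv i p g"
    and L2u': "L2 u'" and L2B': "L2 B'"
    and velocity: "AE x in lborel. u' x - \<nu> *\<^sub>R laplacian u x + advect u u x - cross3 (curl B x) (B x) + gradient p x = 0"
    and magnetic: "AE x in lborel. B' x - \<eta> *\<^sub>R laplacian B x + advect u B x - advect B u x
        + curl (\<lambda>y. cross3 (curl B y) (B y)) x = 0"
begin

definition W :: "real^3 \<Rightarrow> real^3" where "W x = B x + curl u x"

lemma Hk_uB: "Hk 2 u" "Hk 1 u" "Hk 2 B" "Hk 1 B"
  by (intro Hk_2_imp_1 Hk_3_imp_2 u3 B3)+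

lemma Hk_curls: "Hk 2 (curl u)" "Hk 1 (curl u)" "Hk 2 (curl B)" "Hk 1 (curl B)"
proof -
  show c: "Hk 2 (curl u)" "Hk 2 (curl B)"
    using Hk_curl[of 2 u] Hk_curl[of 2 B] u3 B3 by (simp_all only: numeral_3_eq_3 numeral_2_eq_2)
  show "Hk 1 (curl u)" "Hk 1 (curl B)" by (intro Hk_2_imp_1 c)+
qed

lemma Hk_W: "Hk 2 W" "Hk 1 W"
proof -
  show w: "Hk 2 W" unfolding W_def[abs_def] by (intro Hk_add Hk_uB Hk_curls)
  show "Hk 1 W" by (rule Hk_2_imp_1[OF w])
qed

lemma Hk_curl_W: "Hk 1 (curl W)"
  using Hk_curl[OF Hk2D[OF Hk_W(1)]] by (simp only: One_nat_def)

lemma div_W: "AE x in lborel. divergence W x = 0"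
  using divergence_add[OF Hk_uB(4) Hk_curls(2)] div_B divergence_curl[OF Hk_uB(1)]
  unfolding W_def[abs_def] by eventually_elim simp

text \<open>The partial derivatives of the Bernoulli pressure p + |u|^2 / 2.\<close>

definition G :: "3 \<Rightarrow> real^3 \<Rightarrow> real" where "G i x = wpderiv i p x + wpderiv i u x \<bullet> u x"

lemma G_weak: "has_weak_pderiv i (\<lambda>x. p x + (1/2) *\<^sub>R (u x \<bullet> u x)) (G i)"
proof -
  obtain g where "has_weak_pderiv i p g" using p_weak by blast
  then have p: "has_weak_pderiv i p (wpderiv i p)" by (rule wpderiv_works)
  have "has_weak_pderiv i (\<lambda>x. (1/2) *\<^sub>R (u x \<bullet> u x)) (\<lambda>x. wpderiv i u x \<bullet> u x)"
    by (rule has_weak_pderiv_half_norm_sq[OF Hk_uB(2)])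
  from has_weak_pderiv_add[OF p this] show ?thesis by (simp add: G_def[abs_def])
qed

lemma velocity': "AE x in lborel. u' x = \<nu> *\<^sub>R laplacian u x - cross3 (curl u x) (u x) + cross3 (curl B x) (B x) - (\<chi> i. G i x)"
  using velocity
proof eventually_elim
  case (elim x)
  have "(\<chi> i. G i x) = gradient p x + (\<chi> i. wpderiv i u x \<bullet> u x)"
    by (simp add: vec_eq_iff G_def gradient_def)
  then show ?case using elim advect_self[of u x] by (simp add: algebra_simps)
qed

lemma L2_terms: "L2 (laplacian u)" "L2 (laplacian B)" "L2 (\<lambda>x. cross3 (curl u x) (u x))"
  "L2 (\<lambda>x. cross3 (curl B x) (B x))" "L2 (\<lambda>x. cross3 (u x) (B x))"
  "L2 (curl (\<lambda>x. cross3 (u x) (B x)))" "L2 (curl (\<lambda>x. cross3 (curl B x) (B x)))"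
proof -
  show "L2 (laplacian u)" "L2 (laplacian B)" "L2 (\<lambda>x. cross3 (curl u x) (u x))"
    "L2 (\<lambda>x. cross3 (curl B x) (B x))" "L2 (\<lambda>x. cross3 (u x) (B x))"
    by (intro L2_laplacian L2_cross3 Hk_uB Hk_curls)+
  show "L2 (curl (\<lambda>x. cross3 (u x) (B x)))"
    by (rule Hk_L2[OF Hk_curl[OF Hk_cross3[OF Hk_uB(1,3), unfolded One_nat_def]]])
  show "L2 (curl (\<lambda>x. cross3 (curl B x) (B x)))"
    by (rule Hk_L2[OF Hk_curl[OF Hk_cross3[OF Hk_curls(3) Hk_uB(3), unfolded One_nat_def]]])
qed

text \<open>Square integrability of this gradient is not part of the solution concept; the velocity
  equation expresses it through terms known to be in L2.\<close>

lemma L2_G: "L2 (\<lambda>x. \<chi> i. G i x)"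
proof (rule L2_cong_AE)
  show "L2 (\<lambda>x. \<nu> *\<^sub>R laplacian u x - cross3 (curl u x) (u x) + cross3 (curl B x) (B x) - u' x)"
    by (intro L2_diff L2_add L2_cmult L2_terms L2u')
  show "(\<lambda>x. \<chi> i. G i x) \<in> borel_measurable borel"
    by (rule measurable_vecI) (simp add: L1_locD(2)[OF has_weak_pderivD(2)[OF G_weak]])
  show "AE x in lborel. \<nu> *\<^sub>R laplacian u x - cross3 (curl u x) (u x) + cross3 (curl B x) (B x) - u' x = (\<chi> i. G i x)"
    using velocity' by eventually_elim simp
qed

lemma L2_Gi: "L2 (G i)" using L2_nth[OF L2_G, of i] by simp

lemma ip_velocity:
  assumes "L2 \<phi>"
  shows "ip u' \<phi> = \<nu> * ip (laplacian u) \<phi> - ip (\<lambda>x. cross3 (curl u x) (u x)) \<phi>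
    + ip (\<lambda>x. cross3 (curl B x) (B x)) \<phi> - ip (\<lambda>x. \<chi> i. G i x) \<phi>"
proof -
  have L: "L2 (\<lambda>x. \<nu> *\<^sub>R laplacian u x)" by (intro L2_cmult L2_terms)
  have "ip u' \<phi> = ip (\<lambda>x. \<nu> *\<^sub>R laplacian u x - cross3 (curl u x) (u x) + cross3 (curl B x) (B x) - (\<chi> i. G i x)) \<phi>"
    by (rule ip_cong_AE[OF _ _ _ _ velocity'])
      (auto intro!: L2_measurable L2u' assms L2_diff L2_add L L2_terms L2_G)
  also have "\<dots> = ip (\<lambda>x. \<nu> *\<^sub>R laplacian u x) \<phi> - ip (\<lambda>x. cross3 (curl u x) (u x)) \<phi>
    + ip (\<lambda>x. cross3 (curl B x) (B x)) \<phi> - ip (\<lambda>x. \<chi> i. G i x) \<phi>"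
    using assms L L2_terms L2_G by (simp only: ip_diff_left ip_add_left L2_diff L2_add)
  finally show ?thesis by (simp only: ip_scaleR_left)
qed

lemma ip_magnetic:
  assumes "L2 \<phi>"
  shows "ip B' \<phi> = \<eta> * ip (laplacian B) \<phi> + ip (curl (\<lambda>x. cross3 (u x) (B x))) \<phi>
    - ip (curl (\<lambda>x. cross3 (curl B x) (B x))) \<phi>"
proof -
  have L: "L2 (\<lambda>x. \<eta> *\<^sub>R laplacian B x)" by (intro L2_cmult L2_terms)
  have ae: "AE x in lborel. B' x = \<eta> *\<^sub>R laplacian B x + curl (\<lambda>x. cross3 (u x) (B x)) x - curl (\<lambda>x. cross3 (curl B x) (B x)) x"
    using magnetic curl_cross3_AE[OF Hk_uB(1,3) div_u div_B]
  proof eventually_elim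
    case (elim x)
    show ?case unfolding elim(2) using elim(1) by (simp add: algebra_simps)
  qed
  have "ip B' \<phi> = ip (\<lambda>x. \<eta> *\<^sub>R laplacian B x + curl (\<lambda>x. cross3 (u x) (B x)) x - curl (\<lambda>x. cross3 (curl B x) (B x)) x) \<phi>"
    by (rule ip_cong_AE[OF _ _ _ _ ae])
      (auto intro!: L2_measurable L2B' assms L2_diff L2_add L L2_terms)
  also have "\<dots> = ip (\<lambda>x. \<eta> *\<^sub>R laplacian B x) \<phi> + ip (curl (\<lambda>x. cross3 (u x) (B x))) \<phi>
    - ip (curl (\<lambda>x. cross3 (curl B x) (B x))) \<phi>"
    using assms L L2_terms by (simp only: ip_diff_left ip_add_left L2_diff L2_add)
  finally show ?thesis by (simp only: ip_scaleR_left)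
qed

text \<open>The Lorentz force and the induction term exchange energy, as (curl B x B).u = - (u x
  B).curl B pointwise. The Hall term and the Lamb vector vanish because curl B x B is orthogonal to
  curl B, and curl u x u to u.\<close>

theorem energy_identity:
  "ip u' u + ip B' B = - \<nu> * (grad_L2_norm u)\<^sup>2 - \<eta> * (grad_L2_norm B)\<^sup>2"
proof -
  have 1: "ip (laplacian v) v = - (grad_L2_norm v)\<^sup>2" if "Hk 2 v" for v
    using ip_laplacian[OF that Hk_2_imp_1[OF that]] by (simp add: grad_L2_norm_sq L2_norm_sq)
  have 2: "ip (\<lambda>x. cross3 (curl u x) (u x)) u = 0"
    by (simp add: ip_def dot_cross_self)
  have 3: "ip (\<lambda>x. \<chi> i. G i x) u = 0"
    by (rule gradient_orthogonal[OF G_weak L2_Gi Hk_uB(2) div_u])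
  have 4: "ip (curl (\<lambda>x. cross3 (u x) (B x))) B = ip (\<lambda>x. cross3 (u x) (B x)) (curl B)"
    by (rule curl_symmetric[OF Hk_cross3[OF Hk_uB(1,3)] Hk_uB(4)])
  have "ip (curl (\<lambda>x. cross3 (curl B x) (B x))) B = ip (\<lambda>x. cross3 (curl B x) (B x)) (curl B)"
    by (rule curl_symmetric[OF Hk_cross3[OF Hk_curls(3) Hk_uB(3)] Hk_uB(4)])
  then have 5: "ip (curl (\<lambda>x. cross3 (curl B x) (B x))) B = 0"
    by (simp add: ip_def inner_commute[of _ "curl B _"] dot_cross_self)
  have "ip (\<lambda>x. cross3 (curl B x) (B x)) u = ip (\<lambda>x. - cross3 (u x) (B x)) (curl B)"
    unfolding ip_def by (intro Bochner_Integration.integral_cong refl) (simp add: cross3_simps)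
  then have 6: "ip (\<lambda>x. cross3 (curl B x) (B x)) u = - ip (\<lambda>x. cross3 (u x) (B x)) (curl B)"
    by (simp only: ip_minus_left)
  show ?thesis
    unfolding ip_velocity[OF Hk_L2[OF u3]] ip_magnetic[OF Hk_L2[OF B3]] 1[OF Hk_uB(1)] 1[OF Hk_uB(3)] 2 3 4 5 6
    by simp
qed

text \<open>The viscous term is tested with \<open>curl W\<close>. Commuting the curl with the
  partial derivatives and using its symmetry moves it onto u, which puts the term in the same form
  as the resistive one.\<close>

lemma ip_laplacian_curl:
  "ip (laplacian u) (curl W) = - (\<Sum>i\<in>UNIV. ip (wpderiv i (curl u)) (wpderiv i W))"
proof -
  have d1: "Hk 1 (wpderiv i u)" "Hk 1 (wpderiv i W)" for i
    by (intro Hk_2_wpderiv Hk_uB Hk_W)+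
  have m: "curl (wpderiv i v) \<in> borel_measurable borel" "wpderiv i (curl v) \<in> borel_measurable borel" if "Hk 2 v" for v i
    using has_weak_pderiv_curl[OF that] wpderiv_works L1_locD(2) has_weak_pderivD(2) by blast+
  have "ip (wpderiv i u) (wpderiv i (curl W)) = ip (wpderiv i (curl u)) (wpderiv i W)" for i
  proof -
    have "ip (wpderiv i u) (wpderiv i (curl W)) = ip (wpderiv i u) (curl (wpderiv i W))"
      by (rule ip_cong_AE[OF _ _ m(2)[OF Hk_W(1)] m(1)[OF Hk_W(1)] _ wpderiv_AE[OF has_weak_pderiv_curl[OF Hk_W(1)]]])
        (simp_all add: Hk_measurable[OF d1(1)])
    also have "\<dots> = ip (curl (wpderiv i u)) (wpderiv i W)"
      by (rule curl_symmetric[OF d1, symmetric])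
    also have "\<dots> = ip (wpderiv i (curl u)) (wpderiv i W)"
    proof (rule ip_cong_AE[OF m(1)[OF Hk_uB(1)] m(2)[OF Hk_uB(1)]])
      show "AE x in lborel. curl (wpderiv i u) x = wpderiv i (curl u) x"
        using wpderiv_AE[OF has_weak_pderiv_curl[OF Hk_uB(1)], of i] by eventually_elim simp
    qed (simp_all add: Hk_measurable[OF d1(2)])
    finally show ?thesis .
  qed
  then show ?thesis using ip_laplacian[OF Hk_uB(1) Hk_curl_W] by simp
qed

text \<open>The Hall term \<open>curl (curl B \<times> B)\<close> of the magnetic equation cancels against the curl of the
  Lorentz force of the velocity equation.\<close>

theorem vorticity_identity:
  "ip B' W + ip u' (curl W) = - \<eta> * (\<Sum>i\<in>UNIV. ip (wpderiv i B) (wpderiv i W))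
    - \<nu> * (\<Sum>i\<in>UNIV. ip (wpderiv i (curl u)) (wpderiv i W)) + ip (\<lambda>x. cross3 (u x) (W x)) (curl W)"
proof -
  note LW = Hk_L2[OF Hk_W(1)] and LcW = Hk_L2[OF Hk_curl_W]
  have 1: "ip (curl (\<lambda>x. cross3 (u x) (B x))) W = ip (\<lambda>x. cross3 (u x) (B x)) (curl W)"
    by (rule curl_symmetric[OF Hk_cross3[OF Hk_uB(1,3)] Hk_W(2)])
  have 2: "ip (curl (\<lambda>x. cross3 (curl B x) (B x))) W = ip (\<lambda>x. cross3 (curl B x) (B x)) (curl W)"
    by (rule curl_symmetric[OF Hk_cross3[OF Hk_curls(3) Hk_uB(3)] Hk_W(2)])
  have 3: "ip (\<lambda>x. \<chi> i. G i x) (curl W) = 0"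
    by (rule gradient_orthogonal_curl[OF G_weak L2_Gi Hk_W(2)])
  \<comment> \<open>With W = B + curl u, the term u x B of the induction and - curl u x u of the
    Lamb form add up to u x W.\<close>
  have "(\<lambda>x. cross3 (u x) (W x)) = (\<lambda>x. cross3 (u x) (B x) - cross3 (curl u x) (u x))"
    by (rule ext) (simp add: W_def cross_add_right cross_skew[of "curl u _"])
  then have 4: "ip (\<lambda>x. cross3 (u x) (W x)) (curl W) = ip (\<lambda>x. cross3 (u x) (B x)) (curl W) - ip (\<lambda>x. cross3 (curl u x) (u x)) (curl W)"
    using ip_diff_left[OF L2_terms(5) L2_terms(3) LcW] by simp
  show ?thesis
    unfolding ip_velocity[OF LcW] ip_magnetic[OF LW] 1 2 3 4 ip_laplacian_curl ip_laplacian[OF Hk_uB(3) Hk_W(2)]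
    by simp
qed

text \<open>Inserting curl u = W - B in the viscous term leaves - nu |grad W|^2, a mixed term with
  factor nu - eta and the trilinear term. With s = nu + eta, closeness of nu and eta gives nu >=
  7/16 s; Young's inequality spends 1/8 s on the trilinear and 1/16 s on the mixed term, and the
  remaining 1/4 s doubles to s / 2. The last constant is 2 * 8^3 * 5184.\<close>

theorem vorticity_inequality:
  assumes pos: "\<nu> > 0" "\<eta> > 0" and close: "\<bar>\<nu> - \<eta>\<bar> / (\<nu> + \<eta>) \<le> 1 / 8"
  shows "2 * (ip B' W + ip u' (curl W)) + (\<nu> + \<eta>) / 2 * (grad_L2_norm W)\<^sup>2
    \<le> 8 * (\<nu> - \<eta>)\<^sup>2 / (\<nu> + \<eta>) * (grad_L2_norm B)\<^sup>2
      + 5308416 * (grad_L2_norm u)^4 * (L2_norm W)\<^sup>2 / (\<nu> + \<eta>)^3"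
proof -
  define s where "s = \<nu> + \<eta>"
  define d where "d = grad_L2_norm W"
  define b where "b = grad_L2_norm B"
  define t where "t = ip (\<lambda>x. cross3 (u x) (W x)) (curl W)"
  define a where "a = 5184 * (grad_L2_norm u)^4 * (L2_norm W)\<^sup>2"
  define m where "m = (\<Sum>i\<in>UNIV. ip (wpderiv i B) (wpderiv i W))"
  have s: "s > 0" using pos by (simp add: s_def)
  have cl: "\<bar>\<nu> - \<eta>\<bar> \<le> s / 8" using close s by (simp add: s_def field_simps)
  have nu: "\<nu> \<ge> 7 / 16 * s" using abs_le_D2[OF cl] by (simp add: s_def)
  have d0: "d \<ge> 0" "b \<ge> 0" by (simp_all add: d_def b_def grad_L2_norm_nonneg)
  have a0: "a \<ge> 0" by (simp add: a_def)
  have "t^4 \<le> a * (d\<^sup>2)^3"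
    using trilinear_bound[OF Hk_uB(1) Hk_W(1) div_u div_W] unfolding t_def a_def d_def by (simp flip: power_mult)
  then have "t \<le> s / 8 * d\<^sup>2 + a / (s / 8)^3"
    by (rule young_four_thirds) (use a0 s in auto)
  then have t: "t \<le> s / 8 * d\<^sup>2 + 512 * a / s^3" by (simp add: power_divide)
  have "\<bar>m\<bar> \<le> b * d" unfolding m_def b_def d_def by (rule sum_ip_le_grad[OF Hk_uB(4) Hk_W(2)])
  then have "\<bar>(\<nu> - \<eta>) * m\<bar> \<le> \<bar>\<nu> - \<eta>\<bar> * (b * d)" unfolding abs_mult by (intro mult_left_mono) auto
  also have "\<dots> \<le> s / 16 * d\<^sup>2 + 4 * (\<nu> - \<eta>)\<^sup>2 / s * b\<^sup>2"
  proof -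
    have "q * (b * d) \<le> s / 16 * d\<^sup>2 + 4 * q\<^sup>2 / s * b\<^sup>2" for q :: real
    proof -
      have "0 \<le> (s * d - 8 * q * b)\<^sup>2 / (16 * s)" using s by simp
      also have "\<dots> = s / 16 * d\<^sup>2 + 4 * q\<^sup>2 / s * b\<^sup>2 - q * (b * d)"
        using s by (simp add: power2_diff power_mult_distrib field_simps power2_eq_square)
      finally show ?thesis by simp
    qed
    from this[of "\<bar>\<nu> - \<eta>\<bar>"] show ?thesis by simp
  qed
  finally have m: "(\<nu> - \<eta>) * m \<le> s / 16 * d\<^sup>2 + 4 * (\<nu> - \<eta>)\<^sup>2 / s * b\<^sup>2" by linarith
  have S: "(\<Sum>i\<in>UNIV. ip (wpderiv i (curl u)) (wpderiv i W)) = d\<^sup>2 - m"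
  proof -
    note W2 = Hk2D[OF Hk_W(1)]
    note w = Hk_wpderiv(1)[OF Hk2D[OF Hk_uB(3)]] Hk_wpderiv(1)[OF Hk2D[OF Hk_curls(1)]]
    note L = Hk_L2[OF Hk_wpderiv(2)[OF Hk2D[OF Hk_uB(3)]]] Hk_L2[OF Hk_wpderiv(2)[OF Hk2D[OF Hk_curls(1)]]] Hk_L2[OF Hk_wpderiv(2)[OF W2]]
    have "ip (wpderiv i W) (wpderiv i W) = ip (wpderiv i B) (wpderiv i W) + ip (wpderiv i (curl u)) (wpderiv i W)" for i
    proof -
      have "AE x in lborel. wpderiv i W x = wpderiv i B x + wpderiv i (curl u) x"
        unfolding W_def[abs_def] by (rule wpderiv_AE[OF has_weak_pderiv_add[OF w]])
      then have "ip (wpderiv i W) (wpderiv i W) = ip (\<lambda>x. wpderiv i B x + wpderiv i (curl u) x) (wpderiv i W)"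
        by (intro ip_cong_AE L2_measurable L2_add L) auto
      then show ?thesis by (simp add: ip_add_left L)
    qed
    then show ?thesis unfolding d_def m_def grad_L2_norm_sq L2_norm_sq by (simp add: sum.distrib)
  qed
  have "ip B' W + ip u' (curl W) = - \<nu> * d\<^sup>2 + (\<nu> - \<eta>) * m + t"
    unfolding vorticity_identity S m_def[symmetric] t_def[symmetric] by (simp add: algebra_simps)
  moreover have "7 / 16 * (s * d\<^sup>2) \<le> \<nu> * d\<^sup>2"
    using mult_right_mono[OF nu, of "d\<^sup>2"] by (simp add: mult.assoc)
  moreover have "x \<le> - R + M + t' \<Longrightarrow> 7 / 16 * Y \<le> R \<Longrightarrow> M \<le> Y / 16 + Q \<Longrightarrow> t' \<le> Y / 8 + N \<Longrightarrow> 2 * x + Y / 2 \<le> 2 * Q + 2 * N"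
    for x R M t' Y Q N :: real by linarith
  ultimately have "2 * (ip B' W + ip u' (curl W)) + (s * d\<^sup>2) / 2 \<le> 2 * (4 * (\<nu> - \<eta>)\<^sup>2 / s * b\<^sup>2) + 2 * (512 * a / s^3)"
    using m t by simp
  then have "2 * (ip B' W + ip u' (curl W)) + s / 2 * d\<^sup>2 \<le> 2 * (4 * (\<nu> - \<eta>)\<^sup>2 / s * b\<^sup>2) + 2 * (512 * a / s^3)" by simp
  also have "\<dots> = 8 * (\<nu> - \<eta>)\<^sup>2 / s * b\<^sup>2 + 5308416 * (grad_L2_norm u)^4 * (L2_norm W)\<^sup>2 / s^3"
    by (simp add: a_def)
  finally show ?thesis unfolding s_def d_def b_def .
qed

end

section \<open>The differential inequality\<close>

text \<open>Derivatives are wanted at interior times, since the equations are imposed only for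
  positive times; continuity up to the endpoints does the rest.\<close>

lemma integral_has_derivative_interior:
  fixes h :: "real \<Rightarrow> real"
  assumes h: "continuous_on {0..t} h"
  shows "continuous_on {0..t} (\<lambda>r. integral {0..r} h)"
    "\<And>r. 0 < r \<Longrightarrow> r < t \<Longrightarrow> ((\<lambda>r. integral {0..r} h) has_real_derivative h r) (at r)"
proof -
  have d: "((\<lambda>r. integral {0..r} h) has_real_derivative h r) (at r within {0..t})" if "r \<in> {0..t}" for r
    by (rule integral_has_real_derivative[OF h that])
  show "continuous_on {0..t} (\<lambda>r. integral {0..r} h)"
    by (rule DERIV_continuous_on[OF d])
  show "((\<lambda>r. integral {0..r} h) has_real_derivative h r) (at r)" if "0 < r" "r < t" for r
  proof -
    have i: "r \<in> interior {0..t}" using that by simp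
    from d[OF interior_subset[THEN subsetD, OF i]] show ?thesis
      unfolding at_within_interior[OF i] .
  qed
qed

lemma nonincreasing_of_derivative:
  fixes Z :: "real \<Rightarrow> real"
  assumes "0 \<le> r" and c: "continuous_on {0..r} Z"
    and d: "\<And>x. 0 < x \<Longrightarrow> x < r \<Longrightarrow> (Z has_real_derivative Z' x) (at x)"
    and n: "\<And>x. 0 < x \<Longrightarrow> x < r \<Longrightarrow> Z' x \<le> 0"
  shows "Z r \<le> Z 0"
  by (rule DERIV_nonpos_imp_decreasing_open[OF assms(1) _ c]) (use d n in blast)

text \<open>With V = X + k int D, the function V exp (- int A) - int b is nonincreasing: as A >= 0,
  the term A X may be enlarged to A V. Keeping the dissipation inside V lets one Gronwall estimate
  bound both quantities.\<close>

lemma gronwall_with_dissipation: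
  fixes X D b A :: "real \<Rightarrow> real"
  assumes r: "0 \<le> r" and X: "continuous_on {0..r} X" and D: "continuous_on {0..r} D" "\<And>x. x \<in> {0..r} \<Longrightarrow> 0 \<le> D x"
    and A: "continuous_on {0..r} A" "\<And>x. x \<in> {0..r} \<Longrightarrow> 0 \<le> A x" and b: "continuous_on {0..r} b" "\<And>x. x \<in> {0..r} \<Longrightarrow> 0 \<le> b x"
    and k: "0 \<le> k"
    and dX: "\<And>x. 0 < x \<Longrightarrow> x < r \<Longrightarrow> (X has_real_derivative X' x) (at x)"
    and le: "\<And>x. 0 < x \<Longrightarrow> x < r \<Longrightarrow> X' x + k * D x \<le> A x * X x + b x"
  shows "X r + k * integral {0..r} D \<le> (X 0 + integral {0..r} b) * exp (integral {0..r} A)"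
proof -
  note iD = integral_has_derivative_interior[OF D(1)] and iA = integral_has_derivative_interior[OF A(1)]
    and ib = integral_has_derivative_interior[OF b(1)]
  have nn: "0 \<le> integral {0..x} h" if "continuous_on {0..r} h" "\<And>x. x \<in> {0..r} \<Longrightarrow> 0 \<le> h x" "x \<le> r" for h :: "real \<Rightarrow> real" and x
    using that by (intro Henstock_Kurzweil_Integration.integral_nonneg integrable_continuous_interval continuous_on_subset[OF that(1)]) auto
  define V where "V x = X x + k * integral {0..x} D" for x
  define Z where "Z x = V x * exp (- integral {0..x} A) - integral {0..x} b" for x
  define Z' where "Z' x = (X' x + k * D x) * exp (- integral {0..x} A) + (exp (- integral {0..x} A) * (- A x)) * V x - b x" for x
  have "Z r \<le> Z 0"
  proof (rule nonincreasing_of_derivative[OF r, of Z Z'])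
    show "continuous_on {0..r} Z" unfolding Z_def V_def by (intro continuous_intros X iD iA ib)
    show "(Z has_real_derivative Z' x) (at x)" if x: "0 < x" "x < r" for x
      unfolding Z_def[abs_def] V_def[abs_def] Z'_def V_def
      by (intro DERIV_diff DERIV_mult DERIV_add DERIV_cmult DERIV_fun_exp DERIV_minus dX iD(2) iA(2) ib(2) x)
    show "Z' x \<le> 0" if x: "0 < x" "x < r" for x
    proof -
      have e: "exp (- integral {0..x} A) \<le> 1" using nn[OF A, of x] x by simp
      have "X' x + k * D x - A x * V x \<le> b x"
      proof -
        have "A x * X x \<le> A x * V x"
          using A(2)[of x] x k nn[OF D, of x] by (intro mult_left_mono) (auto simp: V_def)
        then show ?thesis using le[OF x] by linarith
      qed
      then have "(X' x + k * D x - A x * V x) * exp (- integral {0..x} A) \<le> b x * exp (- integral {0..x} A)"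
        by (intro mult_right_mono) auto
      also have "\<dots> \<le> b x" using b(2)[of x] x e by (intro mult_left_le) auto
      finally show ?thesis by (simp add: Z'_def algebra_simps)
    qed
  qed
  then have "V r * exp (- integral {0..r} A) \<le> X 0 + integral {0..r} b"
    by (simp add: Z_def V_def)
  then have "V r * exp (- integral {0..r} A) * exp (integral {0..r} A) \<le> (X 0 + integral {0..r} b) * exp (integral {0..r} A)"
    by (intro mult_right_mono) auto
  then show ?thesis by (simp add: V_def mult.assoc flip: exp_add)
qed

text \<open>The bound holds as long as \<open>X \<le> 1\<close>, and it keeps \<open>X\<close> below 1.\<close>

lemma energy_bootstrap:
  fixes X D b A E :: "real \<Rightarrow> real"
  assumes t: "0 \<le> t" and nu: "\<nu> > 0" and eta: "\<eta> > 0" and close: "\<bar>\<nu> - \<eta>\<bar> / (\<nu> + \<eta>) \<le> 1 / 8"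
    and X: "continuous_on {0..t} X" "\<And>x. x \<in> {0..t} \<Longrightarrow> 0 \<le> X x"
    and D: "continuous_on {0..t} D" "\<And>x. x \<in> {0..t} \<Longrightarrow> 0 \<le> D x"
    and A: "continuous_on {0..t} A" "\<And>x. x \<in> {0..t} \<Longrightarrow> 0 \<le> A x"
    and b: "continuous_on {0..t} b" "\<And>x. x \<in> {0..t} \<Longrightarrow> 0 \<le> b x"
    and E: "continuous_on {0..t} E" "\<And>x. x \<in> {0..t} \<Longrightarrow> 0 \<le> E x"
    and dE: "\<And>x. 0 < x \<Longrightarrow> x < t \<Longrightarrow> (E has_real_derivative - 2 * \<nu> * A x - 2 * \<eta> * b x) (at x)"
    and dX: "\<And>x. 0 < x \<Longrightarrow> x < t \<Longrightarrow> (X has_real_derivative X' x) (at x)"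
    and le: "\<And>x. 0 < x \<Longrightarrow> x < t \<Longrightarrow> X' x + (\<nu> + \<eta>) / 2 * D x
        \<le> 8 * (\<nu> - \<eta>)\<^sup>2 / (\<nu> + \<eta>) * b x + 5308416 * (A x)\<^sup>2 * X x / (\<nu> + \<eta>)^3"
    and AX: "\<And>x. x \<in> {0..t} \<Longrightarrow> A x \<le> 2 * (X x + E x)"
    and C0: "C0 = (X 0 + 10 * E 0 * ((\<nu> - \<eta>)\<^sup>2 / (\<nu> + \<eta>)\<^sup>2)) * exp (20000000 * (E 0 + (E 0)\<^sup>2) / (\<nu> + \<eta>)^4)"
    and C0_less: "C0 < 1"
  shows "X t + (\<nu> + \<eta>) / 2 * integral {0..t} D \<le> C0"
proof -
  define s where "s = \<nu> + \<eta>"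
  have s: "s > 0" using nu eta by (simp add: s_def)
  have cl: "\<bar>\<nu> - \<eta>\<bar> \<le> s / 8" using close s by (simp add: s_def field_simps)
  have nu7: "7 * s \<le> 16 * \<nu>" and eta7: "7 * s \<le> 16 * \<eta>"
    using abs_le_D1[OF cl] abs_le_D2[OF cl] by (auto simp: s_def)
  have E0: "0 \<le> E 0" and X0: "0 \<le> X 0" using E(2)[of 0] X(2)[of 0] t by auto
  have sub: "continuous_on {0..r} h" if "continuous_on {0..t} h" "r \<le> t" for h :: "real \<Rightarrow> real" and r
    using that by (auto intro: continuous_on_subset)
  have nn: "0 \<le> integral {0..x} h" if "continuous_on {0..t} h" "\<And>x. x \<in> {0..t} \<Longrightarrow> 0 \<le> h x" "x \<le> t" for h :: "real \<Rightarrow> real" and x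
    using that by (intro Henstock_Kurzweil_Integration.integral_nonneg integrable_continuous_interval sub[OF that(1)]) auto
  note iA = integral_has_derivative_interior[OF A(1)] and ib = integral_has_derivative_interior[OF b(1)]
  have energy: "E r + 2 * \<nu> * integral {0..r} A + 2 * \<eta> * integral {0..r} b \<le> E 0" if r: "0 \<le> r" "r \<le> t" for r
  proof -
    have "E r + 2 * \<nu> * integral {0..r} A + 2 * \<eta> * integral {0..r} b
      \<le> E 0 + 2 * \<nu> * integral {0..0} A + 2 * \<eta> * integral {0..0} b"
    proof (rule nonincreasing_of_derivative[OF r(1), where Z'="\<lambda>x. (- 2 * \<nu> * A x - 2 * \<eta> * b x) + (2 * \<nu>) * A x + (2 * \<eta>) * b x"])
      show "continuous_on {0..r} (\<lambda>x. E x + 2 * \<nu> * integral {0..x} A + 2 * \<eta> * integral {0..x} b)"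
        by (intro continuous_intros sub[OF E(1)] sub[OF iA(1)] sub[OF ib(1)] r)
      show "((\<lambda>x. E x + 2 * \<nu> * integral {0..x} A + 2 * \<eta> * integral {0..x} b) has_real_derivative
         (- 2 * \<nu> * A x - 2 * \<eta> * b x) + (2 * \<nu>) * A x + (2 * \<eta>) * b x) (at x)" if x: "0 < x" "x < r" for x
        using x r by (intro DERIV_add DERIV_cmult dE iA(2) ib(2)) auto
    qed simp
    then show ?thesis by simp
  qed
  have Ele: "E r \<le> E 0" if r: "0 \<le> r" "r \<le> t" for r
    using energy[OF r] mult_nonneg_nonneg[OF less_imp_le[OF nu] nn[OF A r(2)]] mult_nonneg_nonneg[OF less_imp_le[OF eta] nn[OF b r(2)]]
    by linarith
  \<comment> \<open>From 2 nu int A <= E 0 and 7 s <= 16 nu, and in the same way for b with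
    eta.\<close>
  have Aint: "7 * s * integral {0..r} A \<le> 8 * E 0" and bint: "7 * s * integral {0..r} b \<le> 8 * E 0" if r: "0 \<le> r" "r \<le> t" for r
    using energy[OF r] E(2)[of r] r
      mult_right_mono[OF nu7 nn[OF A r(2)]] mult_right_mono[OF eta7 nn[OF b r(2)]]
      mult_nonneg_nonneg[OF less_imp_le[OF nu] nn[OF A r(2)]] mult_nonneg_nonneg[OF less_imp_le[OF eta] nn[OF b r(2)]]
    by auto
  \<comment> \<open>Where X <= 1, the assumption \<open>AX\<close> and the decay of E give A <= 2 (1
    + E 0), so one of the two factors A becomes a constant and the inequality is linear in X with an
    integrable coefficient: 10616832 = 2 * 5308416.\<close>
  define K where "K = 10616832 * (1 + E 0) / s^3"
  define g where "g = 8 * (\<nu> - \<eta>)\<^sup>2 / s"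
  have K0: "0 \<le> K" and g0: "0 \<le> g" using s E0 by (simp_all add: K_def g_def)
  have main: "X r + s / 2 * integral {0..r} D \<le> C0"
    if r: "0 \<le> r" "r \<le> t" and small: "\<And>x. x \<in> {0..r} \<Longrightarrow> X x \<le> 1" for r
  proof -
    have "X r + s / 2 * integral {0..r} D \<le> (X 0 + integral {0..r} (\<lambda>x. g * b x)) * exp (integral {0..r} (\<lambda>x. K * A x))"
    proof (rule gronwall_with_dissipation[OF r(1)])
      show "X' x + s / 2 * D x \<le> K * A x * X x + g * b x" if x: "0 < x" "x < r" for x
      proof -
        have xt: "0 < x" "x < t" "x \<in> {0..t}" using x r by auto
        have "A x \<le> 2 * (1 + E 0)" using AX[OF xt(3)] small[of x] Ele[of x] x xt by auto
        then have "A x * (A x * X x) \<le> 2 * (1 + E 0) * (A x * X x)"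
          using A(2)[OF xt(3)] X(2)[OF xt(3)] by (intro mult_right_mono) auto
        then have "5308416 * (A x * (A x * X x)) \<le> 5308416 * (2 * (1 + E 0) * (A x * X x))"
          by (rule mult_left_mono) simp
        moreover have "5308416 * (A x * (A x * X x)) = 5308416 * (A x)\<^sup>2 * X x"
          by (simp add: power2_eq_square)
        moreover have "5308416 * (2 * (1 + E 0) * (A x * X x)) = 10616832 * (1 + E 0) * (A x * X x)"
          by simp
        ultimately have "5308416 * (A x)\<^sup>2 * X x \<le> 10616832 * (1 + E 0) * (A x * X x)"
          by (simp only:)
        then have "5308416 * (A x)\<^sup>2 * X x / s^3 \<le> 10616832 * (1 + E 0) * (A x * X x) / s^3"
          using s by (intro divide_right_mono) auto
        also have "\<dots> = K * A x * X x" by (simp add: K_def)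
        finally show ?thesis using le[OF xt(1,2)] by (simp add: s_def g_def)
      qed
    qed (use r K0 g0 s A b D in \<open>auto intro!: continuous_intros sub[OF X(1)] sub[OF D(1)] sub[OF A(1)] sub[OF b(1)] dX\<close>)
    also have "\<dots> = (X 0 + g * integral {0..r} b) * exp (K * integral {0..r} A)" by simp
    also have "\<dots> \<le> C0"
    proof -
      have "g * integral {0..r} b = (8 * (\<nu> - \<eta>)\<^sup>2 / (7 * s\<^sup>2)) * (7 * s * integral {0..r} b)"
        using s by (simp add: g_def power2_eq_square)
      also have "\<dots> \<le> (8 * (\<nu> - \<eta>)\<^sup>2 / (7 * s\<^sup>2)) * (8 * E 0)"
        by (intro mult_left_mono bint r) simp
      also have "\<dots> = (64 / 7) * (E 0 * ((\<nu> - \<eta>)\<^sup>2 / s\<^sup>2))" by simp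
      \<comment> \<open>64 / 7 < 10 accounts for the first constant of
        \<open>hall_C0\<close>.\<close>
      also have "\<dots> \<le> 10 * (E 0 * ((\<nu> - \<eta>)\<^sup>2 / s\<^sup>2))" using E0 by (intro mult_right_mono) auto
      finally have p1: "g * integral {0..r} b \<le> 10 * E 0 * ((\<nu> - \<eta>)\<^sup>2 / s\<^sup>2)" by simp
      have "K * integral {0..r} A = (10616832 * (1 + E 0) / (7 * s^4)) * (7 * s * integral {0..r} A)"
        using s by (simp add: K_def power4_eq_xxxx power3_eq_cube)
      also have "\<dots> \<le> (10616832 * (1 + E 0) / (7 * s^4)) * (8 * E 0)"
        using E0 by (intro mult_left_mono Aint r) simp
      also have "\<dots> = (84934656 / 7) * ((E 0 + (E 0)\<^sup>2) / s^4)" by (simp add: power2_eq_square algebra_simps)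
      \<comment> \<open>84934656 / 7 is about 1.2 * 10^7, rounded up generously to the second
        constant of \<open>hall_C0\<close>.\<close>
      also have "\<dots> \<le> 20000000 * ((E 0 + (E 0)\<^sup>2) / s^4)" using E0 by (intro mult_right_mono) auto
      finally have p2: "exp (K * integral {0..r} A) \<le> exp (20000000 * (E 0 + (E 0)\<^sup>2) / s^4)" by simp
      show ?thesis
        unfolding C0 s_def[symmetric] by (rule mult_mono) (use p1 p2 X0 E0 in auto)
    qed
    finally show ?thesis .
  qed
  have X0_less: "X 0 < 1"
  proof -
    have "X 0 * 1 \<le> C0" unfolding C0 using E0 X0 s by (intro mult_mono) (auto simp: s_def)
    then show ?thesis using C0_less by simp
  qed
  have less: "X r < 1" if r: "r \<in> {0..t}" for r
  proof (rule ccontr)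
    assume "\<not> X r < 1"
    then have ge: "1 \<le> X r" by simp
    have cr: "continuous_on {0..r} X" using sub[OF X(1)] r by simp
    \<comment> \<open>At the least time q with X = 1 the bound \<open>main\<close> applies, because
      by the intermediate value theorem X cannot exceed 1 earlier; it yields 1 = X q <= C0 <
      1.\<close>
    define S where "S = {x \<in> {0..r}. X x = 1}"
    have r0: "0 \<le> r" using r by simp
    obtain z where "0 \<le> z" "z \<le> r" "X z = 1"
      using IVT'[OF less_imp_le[OF X0_less] ge r0 cr] by blast
    then have "z \<in> S" by (simp add: S_def)
    then have ne: "S \<noteq> {}" by blast
    have "closed S" unfolding S_def by (rule continuous_closed_preimage_constant[OF cr closed_atLeastAtMost])
    then have cp: "compact S" by (intro compact_eq_bounded_closed[THEN iffD2] conjI bounded_subset[OF bounded_closed_interval[of 0 r]]) (auto simp: S_def)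
    obtain q where q: "q \<in> S" "\<And>x. x \<in> S \<Longrightarrow> q \<le> x" using compact_attains_inf[OF cp ne] by blast
    have q': "0 \<le> q" "q \<le> r" "X q = 1" using q(1) by (auto simp: S_def)
    have small: "X x \<le> 1" if x: "x \<in> {0..q}" for x
    proof (rule ccontr)
      assume "\<not> X x \<le> 1"
      then have xq: "X x > 1" "x \<noteq> q" using q' by auto
      have cx: "continuous_on {0..x} X" using sub[OF X(1)] x q' r by simp
      have x0: "0 \<le> x" using x by simp
      obtain y where "0 \<le> y" "y \<le> x" "X y = 1"
        using IVT'[OF less_imp_le[OF X0_less] less_imp_le[OF xq(1)] x0 cx] by blast
      then have "y \<in> S" using x q' by (auto simp: S_def)
      then show False using q(2)[of y] \<open>y \<le> x\<close> x xq(2) by auto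
    qed
    have "X q + s / 2 * integral {0..q} D \<le> C0" by (rule main) (use q' r small in auto)
    moreover have "0 \<le> s / 2 * integral {0..q} D" using s nn[OF D, of q] q' r by simp
    ultimately show False using q'(3) C0_less by linarith
  qed
  show ?thesis using main[OF t order_refl] less t unfolding s_def by force
qed

section \<open>Dependence on time\<close>

text \<open>Equality of the predicates themselves: the choice operator in \<open>wpderiv\<close>
  then returns literally the same function for arguments that agree almost everywhere.\<close>

lemma has_weak_pderiv_cong_eq:
  assumes m: "f \<in> borel_measurable borel" "f' \<in> borel_measurable borel" and ae: "AE x in lborel. f x = f' x"
  shows "has_weak_pderiv i f = has_weak_pderiv i f'"
proof (intro ext iffI)
  fix g
  show "has_weak_pderiv i f' g" if w: "has_weak_pderiv i f g"
    by (rule has_weak_pderiv_cong_AE[OF w m(2) L1_locD(2)[OF has_weak_pderivD(2)[OF w]] ae]) simp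
  have ae': "AE x in lborel. f' x = f x" using ae by eventually_elim simp
  show "has_weak_pderiv i f g" if w: "has_weak_pderiv i f' g"
    by (rule has_weak_pderiv_cong_AE[OF w m(1) L1_locD(2)[OF has_weak_pderivD(2)[OF w]] ae']) simp
qed

lemma wpderiv_cong_eq:
  assumes "f \<in> borel_measurable borel" "f' \<in> borel_measurable borel" "AE x in lborel. f x = f' x"
  shows "wpderiv i f = wpderiv i f'"
  unfolding wpderiv_def has_weak_pderiv_cong_eq[OF assms, of i] ..

lemma Hk_norm_sq_cong_AE:
  assumes "f \<in> borel_measurable borel" "f' \<in> borel_measurable borel" "AE x in lborel. f x = f' x"
  shows "Hk_norm_sq k f = Hk_norm_sq k f'"
  using L2_norm_cong_AE[OF assms] wpderiv_cong_eq[OF assms] by (cases k) simp_all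

lemma Hk_norm_sq_nonneg: "0 \<le> Hk_norm_sq k f"
  by (induction k arbitrary: f) (auto intro!: add_nonneg_nonneg sum_nonneg)

lemma L2_norm_le_Hk_norm: "L2_norm f \<le> Hk_norm k f"
  unfolding Hk_norm_def by (rule real_le_rsqrt) (cases k, auto intro!: sum_nonneg Hk_norm_sq_nonneg)

lemma Hk_norm_wpderiv_le: "Hk_norm k (wpderiv i f) \<le> Hk_norm (Suc k) f"
  unfolding Hk_norm_def
proof (rule real_sqrt_le_mono)
  have "Hk_norm_sq k (wpderiv i f) \<le> (\<Sum>i\<in>UNIV. Hk_norm_sq k (wpderiv i f))"
    by (rule member_le_sum) (auto intro: Hk_norm_sq_nonneg)
  then show "Hk_norm_sq k (wpderiv i f) \<le> Hk_norm_sq (Suc k) f" by (simp add: add_increasing)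
qed

lemma Hk_norm_nonneg: "0 \<le> Hk_norm k f"
  by (simp add: Hk_norm_def Hk_norm_sq_nonneg)

lemma continuous_into_Hk_wpderiv:
  assumes "continuous_into_Hk (Suc k) T v"
  shows "continuous_into_Hk k T (\<lambda>t. wpderiv i (v t))"
  unfolding continuous_into_Hk_def
proof (intro ballI conjI)
  fix t assume t: "t \<in> time_interval T"
  have H: "Hk (Suc k) (v s)" if "s \<in> time_interval T" for s
    using assms that unfolding continuous_into_Hk_def by blast
  show "Hk k (wpderiv i (v t))" by (rule Hk_wpderiv(2)[OF H[OF t]])
  have lim: "((\<lambda>s. Hk_norm (Suc k) (\<lambda>x. v s x - v t x)) \<longlongrightarrow> 0) (at t within time_interval T)"
    using assms t unfolding continuous_into_Hk_def by blast
  show "((\<lambda>s. Hk_norm k (\<lambda>x. wpderiv i (v s) x - wpderiv i (v t) x)) \<longlongrightarrow> 0) (at t within time_interval T)"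
  proof (rule Lim_null_comparison[OF _ lim])
    have "norm (Hk_norm k (\<lambda>x. wpderiv i (v s) x - wpderiv i (v t) x)) \<le> Hk_norm (Suc k) (\<lambda>x. v s x - v t x)"
      if s: "s \<in> time_interval T" for s
    proof -
      note w = has_weak_pderiv_diff[OF Hk_wpderiv(1)[OF H[OF s], of i] Hk_wpderiv(1)[OF H[OF t], of i]]
      \<comment> \<open>The difference of the chosen representatives is the representative of the
        difference only almost everywhere.\<close>
      have ae: "AE x in lborel. wpderiv i (v s) x - wpderiv i (v t) x = wpderiv i (\<lambda>x. v s x - v t x) x"
        using wpderiv_AE[OF w] by eventually_elim simp
      have "Hk_norm k (\<lambda>x. wpderiv i (v s) x - wpderiv i (v t) x) = Hk_norm k (wpderiv i (\<lambda>x. v s x - v t x))"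
        unfolding Hk_norm_def
        using Hk_norm_sq_cong_AE[OF L1_locD(2)[OF has_weak_pderivD(2)[OF w]] L1_locD(2)[OF has_weak_pderivD(2)[OF wpderiv_works[OF w]]] ae] by simp
      then show ?thesis
        using Hk_norm_wpderiv_le[of k i "\<lambda>x. v s x - v t x"] Hk_norm_nonneg[of k "wpderiv i (\<lambda>x. v s x - v t x)"] by simp
    qed
    then show "\<forall>\<^sub>F s in at t within time_interval T. norm (Hk_norm k (\<lambda>x. wpderiv i (v s) x - wpderiv i (v t) x)) \<le> Hk_norm (Suc k) (\<lambda>x. v s x - v t x)"
      by (simp add: eventually_at_filter)
  qed
qed

section \<open>Continuity in time with values in L2, and derivatives of squared norms\<close>

definition L2_cont :: "real set \<Rightarrow> (real \<Rightarrow> real^3 \<Rightarrow> real^3) \<Rightarrow> bool" where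
  "L2_cont I v \<longleftrightarrow> (\<forall>t\<in>I. L2 (v t) \<and> ((\<lambda>s. L2_norm (\<lambda>x. v s x - v t x)) \<longlongrightarrow> 0) (at t within I))"

lemma L2_contD: "L2_cont I v \<Longrightarrow> t \<in> I \<Longrightarrow> L2 (v t)"
  "L2_cont I v \<Longrightarrow> t \<in> I \<Longrightarrow> ((\<lambda>s. L2_norm (\<lambda>x. v s x - v t x)) \<longlongrightarrow> 0) (at t within I)"
  by (auto simp: L2_cont_def)

lemma L2_cont_bound:
  assumes L: "\<And>t. t \<in> I \<Longrightarrow> L2 (w t)"
    and b: "\<And>s t. s \<in> I \<Longrightarrow> t \<in> I \<Longrightarrow> L2_norm (\<lambda>x. w s x - w t x) \<le> h s t"
    and h: "\<And>t. t \<in> I \<Longrightarrow> ((\<lambda>s. h s t) \<longlongrightarrow> 0) (at t within I)"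
  shows "L2_cont I w"
  unfolding L2_cont_def
proof (intro ballI conjI L)
  fix t assume t: "t \<in> I"
  show "((\<lambda>s. L2_norm (\<lambda>x. w s x - w t x)) \<longlongrightarrow> 0) (at t within I)"
  proof (rule Lim_null_comparison[OF _ h[OF t]])
    show "\<forall>\<^sub>F s in at t within I. norm (L2_norm (\<lambda>x. w s x - w t x)) \<le> h s t"
      using b t by (simp add: eventually_at_filter L2_norm_nonneg)
  qed
qed

lemma L2_cont_of_Hk: "continuous_into_Hk k T v \<Longrightarrow> L2_cont (time_interval T) v"
  by (rule L2_cont_bound[where h="\<lambda>s t. Hk_norm k (\<lambda>x. v s x - v t x)"])
    (auto simp: continuous_into_Hk_def intro: Hk_L2 L2_norm_le_Hk_norm)

lemma L2_cont_add:
  assumes v: "L2_cont I v" and w: "L2_cont I w" shows "L2_cont I (\<lambda>t x. v t x + w t x)"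
proof (rule L2_cont_bound)
  show "L2 (\<lambda>x. v t x + w t x)" if "t \<in> I" for t using that v w by (intro L2_add) (auto dest: L2_contD)
  show "L2_norm (\<lambda>x. (v s x + w s x) - (v t x + w t x)) \<le> L2_norm (\<lambda>x. v s x - v t x) + L2_norm (\<lambda>x. w s x - w t x)"
    if "s \<in> I" "t \<in> I" for s t
    using L2_norm_add[OF L2_diff[OF L2_contD(1)[OF v that(1)] L2_contD(1)[OF v that(2)]] L2_diff[OF L2_contD(1)[OF w that(1)] L2_contD(1)[OF w that(2)]]]
    by (simp add: add_diff_add)
  show "((\<lambda>s. L2_norm (\<lambda>x. v s x - v t x) + L2_norm (\<lambda>x. w s x - w t x)) \<longlongrightarrow> 0) (at t within I)" if "t \<in> I" for t
    using tendsto_add[OF L2_contD(2)[OF v that] L2_contD(2)[OF w that]] by simp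
qed

lemma L2_cont_zero: "L2_cont I (\<lambda>t x. 0)"
  by (auto simp: L2_cont_def L2_zero L2_norm_def)

lemma L2_cont_sum: "finite J \<Longrightarrow> (\<And>j. j \<in> J \<Longrightarrow> L2_cont I (v j)) \<Longrightarrow> L2_cont I (\<lambda>t x. \<Sum>j\<in>J. v j t x)"
  by (induction J rule: finite_induct) (auto simp: L2_cont_zero L2_cont_add)

lemma L2_cont_bounded_linear:
  assumes A: "bounded_linear A" and v: "L2_cont I v" shows "L2_cont I (\<lambda>t x. A (v t x))"
proof -
  obtain K where K: "K > 0" "\<And>x. norm (A x) \<le> norm x * K" using bounded_linear.pos_bounded[OF A] by blast
  show ?thesis
  proof (rule L2_cont_bound)
    show L: "L2 (\<lambda>x. A (v t x))" if "t \<in> I" for t by (rule L2_bounded_linear[OF A L2_contD(1)[OF v that]])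
    show "L2_norm (\<lambda>x. A (v s x) - A (v t x)) \<le> K * L2_norm (\<lambda>x. v s x - v t x)" if "s \<in> I" "t \<in> I" for s t
    proof (rule L2_norm_mono)
      show "L2 (\<lambda>x. v s x - v t x)" by (intro L2_diff L2_contD(1)[OF v] that)
      show "(\<lambda>x. A (v s x) - A (v t x)) \<in> borel_measurable borel" by (intro L2_measurable L2_diff L that)
      show "AE x in lborel. norm (A (v s x) - A (v t x)) \<le> K * norm (v s x - v t x)"
        using K(2)[of "v s _ - v t _"] by (simp add: bounded_linear.linear[OF A] linear_diff mult.commute)
    qed (use K in simp)
    show "((\<lambda>s. K * L2_norm (\<lambda>x. v s x - v t x)) \<longlongrightarrow> 0) (at t within I)" if "t \<in> I" for t
      using tendsto_mult_left[OF L2_contD(2)[OF v that], of K] by simp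
  qed
qed

text \<open>Bridges explicit sums of derivatives and the representatives chosen by
  \<open>wpderiv\<close>.\<close>

lemma L2_cont_cong_AE:
  assumes v: "L2_cont I v" and m: "\<And>t. t \<in> I \<Longrightarrow> w t \<in> borel_measurable borel"
    and ae: "\<And>t. t \<in> I \<Longrightarrow> AE x in lborel. v t x = w t x"
  shows "L2_cont I w"
proof (rule L2_cont_bound[where h="\<lambda>s t. L2_norm (\<lambda>x. v s x - v t x)"])
  show L: "L2 (w t)" if "t \<in> I" for t by (rule L2_cong_AE[OF L2_contD(1)[OF v that] m[OF that] ae[OF that]])
  show "L2_norm (\<lambda>x. w s x - w t x) \<le> L2_norm (\<lambda>x. v s x - v t x)" if st: "s \<in> I" "t \<in> I" for s t
  proof -
    have "AE x in lborel. w s x - w t x = v s x - v t x"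
      using ae[OF st(1)] ae[OF st(2)] by eventually_elim simp
    then have "L2_norm (\<lambda>x. w s x - w t x) = L2_norm (\<lambda>x. v s x - v t x)"
      by (intro L2_norm_cong_AE L2_measurable L2_diff L L2_contD(1)[OF v] st)
    then show ?thesis by simp
  qed
qed (rule L2_contD(2)[OF v])

lemma L2_cont_curl:
  assumes "\<And>i. L2_cont I (\<lambda>t. wpderiv i (v t))"
  shows "L2_cont I (\<lambda>t. curl (v t))"
proof -
  have "L2_cont I (\<lambda>t x. \<Sum>i\<in>UNIV. cross3 (ax i) (wpderiv i (v t) x))"
    by (intro L2_cont_sum finite L2_cont_bounded_linear[OF bounded_linear_cross3_right] assms)
  then show ?thesis by (simp add: curl_eq[abs_def])
qed

lemma continuous_on_ip:
  assumes v: "L2_cont I v" and w: "L2_cont I w"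
  shows "continuous_on I (\<lambda>t. ip (v t) (w t))"
  unfolding continuous_on_def
proof
  fix t assume t: "t \<in> I"
  show "((\<lambda>t. ip (v t) (w t)) \<longlongrightarrow> ip (v t) (w t)) (at t within I)"
    by (rule ip_tendsto[OF L2_contD(2)[OF v t] L2_contD(2)[OF w t]])
      (use L2_contD(1)[OF v] L2_contD(1)[OF w] t in \<open>auto simp: eventually_at_filter\<close>)
qed

lemma continuous_on_L2_norm_sq: "L2_cont I v \<Longrightarrow> continuous_on I (\<lambda>t. (L2_norm (v t))\<^sup>2)"
  unfolding L2_norm_sq by (rule continuous_on_ip)

lemma continuous_on_grad_L2_norm_sq:
  "(\<And>i. L2_cont I (\<lambda>t. wpderiv i (v t))) \<Longrightarrow> continuous_on I (\<lambda>t. (grad_L2_norm (v t))\<^sup>2)"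
  unfolding grad_L2_norm_sq by (intro continuous_intros continuous_on_L2_norm_sq)

text \<open>The summand \<open>curl u\<close> need not have a time derivative in \<open>L\<^sup>2\<close>; symmetry of the curl moves the derivative
  onto the continuous factor.\<close>

lemma has_derivative_norm_sq_of_curl:
  assumes O: "open O'" "t \<in> O'" "O' \<subseteq> I"
    and B: "L2_cont I B" "has_L2_time_deriv B B' t" and u: "L2_cont I u" "has_L2_time_deriv u u' t"
    and Hu: "\<And>s. s \<in> I \<Longrightarrow> Hk 1 (u s)" and HW: "\<And>s. s \<in> I \<Longrightarrow> Hk 1 (\<lambda>x. B s x + curl (u s) x)"
    and W: "L2_cont I (\<lambda>s x. B s x + curl (u s) x)" and cW: "L2_cont I (\<lambda>s. curl (\<lambda>x. B s x + curl (u s) x))"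
  shows "((\<lambda>s. (L2_norm (\<lambda>x. B s x + curl (u s) x))\<^sup>2) has_real_derivative
    2 * (ip B' (\<lambda>x. B t x + curl (u t) x) + ip u' (curl (\<lambda>x. B t x + curl (u t) x)))) (at t)"
proof -
  define w where "w s x = B s x + curl (u s) x" for s x
  have t: "t \<in> I" using O by blast
  have at: "at t within I = at t"
    by (rule at_within_nhd[OF O(2,1)]) (use O in auto)
  have ev: "eventually (\<lambda>s. s \<in> I) (at t)"
    using eventually_at_in_open'[OF O(1,2)] by eventually_elim (use O in blast)
  have L: "L2 (B s)" "L2 (u s)" "L2 (w s)" "L2 (curl (w s))" "L2 (curl (u s))" if "s \<in> I" for s
    using L2_contD(1)[OF B(1) that] L2_contD(1)[OF u(1) that] L2_contD(1)[OF W that] L2_contD(1)[OF cW that]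
      Hk_L2[OF Hk_curl[OF Hu[OF that, unfolded One_nat_def]]]
    by (simp_all add: w_def[abs_def])
  have lw: "((\<lambda>s. L2_norm (\<lambda>x. w s x - w t x)) \<longlongrightarrow> 0) (at t)"
    and lc: "((\<lambda>s. L2_norm (\<lambda>x. curl (w s) x - curl (w t) x)) \<longlongrightarrow> 0) (at t)"
    using L2_contD(2)[OF W t] L2_contD(2)[OF cW t] unfolding at by (simp_all add: w_def[abs_def])
  have dB: "L2 B'" "((\<lambda>s. L2_norm (\<lambda>x. (B s x - B t x) /\<^sub>R (s - t) - B' x)) \<longlongrightarrow> 0) (at t)"
    and du: "L2 u'" "((\<lambda>s. L2_norm (\<lambda>x. (u s x - u t x) /\<^sub>R (s - t) - u' x)) \<longlongrightarrow> 0) (at t)"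
    using B(2) u(2) unfolding has_L2_time_deriv_def by auto
  \<comment> \<open>A symmetrised quotient: |w s|^2 - |w t|^2 is the pairing of w s - w t with w s +
    w t. Once the curl has been moved to the second factor, the quotients fall on B and u, which do
    have time derivatives, and the other factors converge by continuity.\<close>
  have lim: "((\<lambda>s. (ip (\<lambda>x. (B s x - B t x) /\<^sub>R (s - t)) (w s) + ip (\<lambda>x. (B s x - B t x) /\<^sub>R (s - t)) (w t))
      + (ip (\<lambda>x. (u s x - u t x) /\<^sub>R (s - t)) (curl (w s)) + ip (\<lambda>x. (u s x - u t x) /\<^sub>R (s - t)) (curl (w t))))
     \<longlongrightarrow> (ip B' (w t) + ip B' (w t)) + (ip u' (curl (w t)) + ip u' (curl (w t)))) (at t)"
  proof (intro tendsto_add)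
    have e: "eventually (\<lambda>s. L2 (\<lambda>x. (B s x - B t x) /\<^sub>R (s - t))) (at t)"
      "eventually (\<lambda>s. L2 (\<lambda>x. (u s x - u t x) /\<^sub>R (s - t))) (at t)"
      "eventually (\<lambda>s. L2 (w s)) (at t)" "eventually (\<lambda>s. L2 (curl (w s))) (at t)"
      by (rule eventually_mono[OF ev], (intro L2_cmult L2_diff L t; assumption))+
    have z: "((\<lambda>s. L2_norm (\<lambda>x. k x - k x)) \<longlongrightarrow> 0) (at t)" for k :: "real^3 \<Rightarrow> real^3"
      by (simp add: L2_norm_def)
    show "((\<lambda>s. ip (\<lambda>x. (B s x - B t x) /\<^sub>R (s - t)) (w s)) \<longlongrightarrow> ip B' (w t)) (at t)"
      by (rule ip_tendsto[OF dB(2) lw e(1) e(3) dB(1) L(3)[OF t]])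
    show "((\<lambda>s. ip (\<lambda>x. (B s x - B t x) /\<^sub>R (s - t)) (w t)) \<longlongrightarrow> ip B' (w t)) (at t)"
      by (rule ip_tendsto[OF dB(2) z e(1) _ dB(1) L(3)[OF t]]) (simp add: L t)
    show "((\<lambda>s. ip (\<lambda>x. (u s x - u t x) /\<^sub>R (s - t)) (curl (w s))) \<longlongrightarrow> ip u' (curl (w t))) (at t)"
      by (rule ip_tendsto[OF du(2) lc e(2) e(4) du(1) L(4)[OF t]])
    show "((\<lambda>s. ip (\<lambda>x. (u s x - u t x) /\<^sub>R (s - t)) (curl (w t))) \<longlongrightarrow> ip u' (curl (w t))) (at t)"
      by (rule ip_tendsto[OF du(2) z e(2) _ du(1) L(4)[OF t]]) (simp add: L t)
  qed
  have "((\<lambda>s. (ip (w s) (w s) - ip (w t) (w t)) / (s - t))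
     \<longlongrightarrow> (ip B' (w t) + ip B' (w t)) + (ip u' (curl (w t)) + ip u' (curl (w t)))) (at t)"
  proof (rule Lim_transform_eventually[OF lim])
    show "eventually (\<lambda>s. (ip (\<lambda>x. (B s x - B t x) /\<^sub>R (s - t)) (w s) + ip (\<lambda>x. (B s x - B t x) /\<^sub>R (s - t)) (w t))
      + (ip (\<lambda>x. (u s x - u t x) /\<^sub>R (s - t)) (curl (w s)) + ip (\<lambda>x. (u s x - u t x) /\<^sub>R (s - t)) (curl (w t)))
      = (ip (w s) (w s) - ip (w t) (w t)) / (s - t)) (at t)"
      using ev
    proof eventually_elim
      case (elim s)
      have d: "ip (\<lambda>x. (v s x - v t x) /\<^sub>R (s - t)) k = (ip (v s) k - ip (v t) k) / (s - t)"
        if "L2 (v s)" "L2 (v t)" "L2 k" for v :: "real \<Rightarrow> real^3 \<Rightarrow> real^3" and k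
        using ip_diff_left[OF that] by (simp only: ip_scaleR_left divide_inverse mult.commute)
      have sy: "ip (u a) (curl (w b)) = ip (curl (u a)) (w b)" if "a \<in> I" "b \<in> I" for a b
        using curl_symmetric[OF Hu[OF that(1)] HW[OF that(2)]] by (simp add: w_def[abs_def])
      have ex: "ip (w a) k = ip (B a) k + ip (curl (u a)) k" if "a \<in> I" "L2 k" for a k
        unfolding w_def[abs_def] using that L by (simp add: ip_add_left)
      have "ip (w s) (w s) - ip (w t) (w t) = (ip (B s) (w s) - ip (B t) (w s)) + (ip (B s) (w t) - ip (B t) (w t))
        + ((ip (u s) (curl (w s)) - ip (u t) (curl (w s))) + (ip (u s) (curl (w t)) - ip (u t) (curl (w t))))"
        using ex[OF elim L(3)[OF elim]] ex[OF t L(3)[OF t]] ex[OF elim L(3)[OF t]] ex[OF t L(3)[OF elim]] ip_commute[of "w s" "w t"]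
        unfolding sy[OF elim elim] sy[OF elim t] sy[OF t elim] sy[OF t t] by (simp add: algebra_simps)
      then show ?case using L[OF elim] L[OF t] by (simp add: d add_divide_distrib)
    qed
  qed
  then show ?thesis unfolding L2_norm_sq has_field_derivative_iff w_def[abs_def] by (simp add: algebra_simps)
qed

lemma has_derivative_norm_sq:
  assumes O: "open O'" "t \<in> O'" "O' \<subseteq> I" and v: "L2_cont I v" "has_L2_time_deriv v v' t"
  shows "((\<lambda>s. (L2_norm (v s))\<^sup>2) has_real_derivative 2 * ip v' (v t)) (at t)"
proof -
  have t: "t \<in> I" using O by blast
  have at: "at t within I = at t"
    by (rule at_within_nhd[OF O(2,1)]) (use O in auto)
  have ev: "eventually (\<lambda>s. s \<in> I) (at t)"
    using eventually_at_in_open'[OF O(1,2)] by eventually_elim (use O in blast)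
  note L = L2_contD(1)[OF v(1)]
  have d: "L2 v'" "((\<lambda>s. L2_norm (\<lambda>x. (v s x - v t x) /\<^sub>R (s - t) - v' x)) \<longlongrightarrow> 0) (at t)"
    using v(2) unfolding has_L2_time_deriv_def by auto
  have e: "eventually (\<lambda>s. L2 (\<lambda>x. (v s x - v t x) /\<^sub>R (s - t))) (at t)" "eventually (\<lambda>s. L2 (\<lambda>x. v s x + v t x)) (at t)"
    by (rule eventually_mono[OF ev], (intro L2_cmult L2_diff L2_add L t; assumption))+
  have l: "((\<lambda>s. L2_norm (\<lambda>x. (v s x + v t x) - (v t x + v t x))) \<longlongrightarrow> 0) (at t)"
    using L2_contD(2)[OF v(1) t] unfolding at by simp
  have "((\<lambda>s. ip (\<lambda>x. (v s x - v t x) /\<^sub>R (s - t)) (\<lambda>x. v s x + v t x)) \<longlongrightarrow> ip v' (\<lambda>x. v t x + v t x)) (at t)"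
    by (rule ip_tendsto[OF d(2) l e d(1) L2_add[OF L[OF t] L[OF t]]])
  then have "((\<lambda>s. (ip (v s) (v s) - ip (v t) (v t)) / (s - t)) \<longlongrightarrow> ip v' (\<lambda>x. v t x + v t x)) (at t)"
  proof (rule Lim_transform_eventually)
    show "eventually (\<lambda>s. ip (\<lambda>x. (v s x - v t x) /\<^sub>R (s - t)) (\<lambda>x. v s x + v t x) = (ip (v s) (v s) - ip (v t) (v t)) / (s - t)) (at t)"
      using ev
    proof eventually_elim
      case (elim s)
      have "ip (\<lambda>x. v s x - v t x) (\<lambda>x. v s x + v t x) = ip (v s) (v s) - ip (v t) (v t)"
        using L[OF elim] L[OF t] by (simp add: ip_diff_left ip_add_right L2_add ip_commute[of "v t" "v s"])
      then show ?case by (simp only: ip_scaleR_left divide_inverse mult.commute)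
    qed
  qed
  moreover have "ip v' (\<lambda>x. v t x + v t x) = 2 * ip v' (v t)"
    using ip_add_right[OF d(1) L[OF t] L[OF t]] by simp
  ultimately show ?thesis unfolding L2_norm_sq has_field_derivative_iff by simp
qed

section \<open>The solution\<close>

text \<open>Here |grad u| = |curl u| and curl u = W - B; the factor 2 is that of (a + b)^2 <= 2 (a^2
  + b^2).\<close>

lemma grad_velocity_le:
  assumes u: "Hk 2 u" and B: "L2 B" and div: "AE x in lborel. divergence u x = 0"
  shows "(grad_L2_norm u)\<^sup>2 \<le> 2 * ((L2_norm (\<lambda>x. B x + curl u x))\<^sup>2 + (L2_norm B)\<^sup>2)"
proof -
  let ?W = "\<lambda>x. B x + curl u x"
  have W: "L2 ?W" by (rule L2_add[OF B Hk_L2[OF Hk_curl[OF Hk2D[OF u]]]])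
  have "L2_norm (curl u) = L2_norm (\<lambda>x. ?W x - B x)" by simp
  also have "\<dots> \<le> L2_norm ?W + L2_norm B" by (rule L2_norm_diff[OF W B])
  finally have "(L2_norm (curl u))\<^sup>2 \<le> (L2_norm ?W + L2_norm B)\<^sup>2" by (intro power_mono L2_norm_nonneg)
  also have "\<dots> \<le> 2 * ((L2_norm ?W)\<^sup>2 + (L2_norm B)\<^sup>2)"
    using sum_squares_bound[of "L2_norm ?W" "L2_norm B"] by (simp add: power2_sum)
  finally show ?thesis using grad_norm_eq_curl_norm[OF u div] by (simp add: grad_L2_norm_sq)
qed

text \<open>The estimate at one time t of the lifespan. Continuity of the dissipation is recorded as
  well, since the passage to the Lebesgue integral relies on it.\<close>

theorem hall_mhd_vorticity_bound:
  assumes nu: "\<nu> > 0" and eta: "\<eta> > 0" and close: "\<bar>\<nu> - \<eta>\<bar> / (\<nu> + \<eta>) \<le> 1 / 8"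
    and u0: "Hk 3 u\<^sub>0" and B0: "Hk 3 B\<^sub>0" and sol: "hall_mhd_solution \<nu> \<eta> u\<^sub>0 B\<^sub>0 T u B"
    and small: "hall_C0 10 20000000 \<nu> \<eta> u\<^sub>0 B\<^sub>0 < 1" and t: "t \<in> time_interval T"
  shows "continuous_on {0..t} (\<lambda>s. (grad_L2_norm (\<lambda>x. B s x + curl (u s) x))\<^sup>2)"
    and "(L2_norm (\<lambda>x. B t x + curl (u t) x))\<^sup>2
      + (\<nu> + \<eta>) / 2 * integral {0..t} (\<lambda>s. (grad_L2_norm (\<lambda>x. B s x + curl (u s) x))\<^sup>2) \<le> hall_C0 10 20000000 \<nu> \<eta> u\<^sub>0 B\<^sub>0"
proof -
  let ?I = "time_interval T"
  define W where "W s x = B s x + curl (u s) x" for s x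
  have cu: "continuous_into_Hk (Suc (Suc 1)) T u" and cB: "continuous_into_Hk (Suc (Suc 1)) T B"
    using sol unfolding hall_mhd_solution_def by (simp_all add: numeral_3_eq_3)
  have Hu: "Hk 3 (u s)" and HB: "Hk 3 (B s)" if "s \<in> ?I" for s
    using sol that unfolding hall_mhd_solution_def continuous_into_Hk_def by blast+
  have div: "AE x in lborel. divergence (u s) x = 0" "AE x in lborel. divergence (B s) x = 0" if "s \<in> ?I" for s
    using sol that unfolding hall_mhd_solution_def by blast+
  have sub: "{0..t} \<subseteq> ?I"
    using t by (auto simp: time_interval_def intro: order_le_less_trans[of "ereal _" "ereal t" T])
  have t0: "0 \<le> t" using t by (simp add: time_interval_def)
  have H1: "Hk 1 (u s)" "Hk 1 (B s)" "Hk 2 (u s)" "Hk 2 (B s)" if "s \<in> ?I" for s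
    by (intro Hk_2_imp_1 Hk_3_imp_2 Hu HB that)+
  have HW: "Hk 1 (W s)" if "s \<in> ?I" for s
    unfolding W_def[abs_def] One_nat_def
    by (intro Hk_add Hk_curl H1(2)[OF that, unfolded One_nat_def] Hk2D[OF H1(3)[OF that]])
  note Lu = L2_cont_of_Hk[OF cu] and LB = L2_cont_of_Hk[OF cB]
  note cdu = continuous_into_Hk_wpderiv[OF cu] and cdB = continuous_into_Hk_wpderiv[OF cB]
  note Ldu = L2_cont_of_Hk[OF cdu] and LdB = L2_cont_of_Hk[OF cdB]
  note Lddu = L2_cont_of_Hk[OF continuous_into_Hk_wpderiv[OF cdu]]
  have LW: "L2_cont ?I W" unfolding W_def[abs_def] by (intro L2_cont_add LB L2_cont_curl Ldu)
  \<comment> \<open>The derivatives of \<open>W s\<close> are written through first derivatives of B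
    and second derivatives of u, whose continuity in L2 follows from continuity into H^3.\<close>
  have LdW: "L2_cont ?I (\<lambda>s. wpderiv j (W s))" for j
  proof (rule L2_cont_cong_AE)
    show "L2_cont ?I (\<lambda>s x. wpderiv j (B s) x + (\<Sum>i\<in>UNIV. cross3 (ax i) (wpderiv j (wpderiv i (u s)) x)))"
      by (intro L2_cont_add LdB L2_cont_sum finite L2_cont_bounded_linear[OF bounded_linear_cross3_right] Lddu)
    fix s assume s: "s \<in> ?I"
    have w: "has_weak_pderiv j (W s) (\<lambda>x. wpderiv j (B s) x + (\<Sum>i\<in>UNIV. cross3 (ax i) (wpderiv j (wpderiv i (u s)) x)))"
      unfolding W_def[abs_def] curl_eq[abs_def]
      by (intro has_weak_pderiv_add has_weak_pderiv_sum finite has_weak_pderiv_bounded_linear[OF bounded_linear_cross3_right]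
          Hk_wpderiv(1)[OF H1(2)[OF s, unfolded One_nat_def]] Hk_wpderiv(1)[OF Hk_wpderiv(2)[OF Hk2D[OF H1(3)[OF s]]]])
    show "wpderiv j (W s) \<in> borel_measurable borel"
      by (rule L1_locD(2)[OF has_weak_pderivD(2)[OF wpderiv_works[OF w]]])
    show "AE x in lborel. wpderiv j (B s) x + (\<Sum>i\<in>UNIV. cross3 (ax i) (wpderiv j (wpderiv i (u s)) x)) = wpderiv j (W s) x"
      using wpderiv_AE[OF w] by eventually_elim simp
  qed
  note LcW = L2_cont_curl[OF LdW]
  define X where "X s = (L2_norm (W s))\<^sup>2" for s
  define D where "D s = (grad_L2_norm (W s))\<^sup>2" for s
  define A where "A s = (grad_L2_norm (u s))\<^sup>2" for s
  define b where "b s = (grad_L2_norm (B s))\<^sup>2" for s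
  define E where "E s = (L2_norm (u s))\<^sup>2 + (L2_norm (B s))\<^sup>2" for s
  have c: "continuous_on ?I X" "continuous_on ?I D" "continuous_on ?I A" "continuous_on ?I b" "continuous_on ?I E"
    unfolding X_def D_def A_def b_def E_def
    by (intro continuous_intros continuous_on_L2_norm_sq continuous_on_grad_L2_norm_sq LW LdW Ldu LdB Lu LB)+
  note cont = c[THEN continuous_on_subset, OF sub]
  obtain p where p: "\<And>s. s \<in> ?I - {0} \<Longrightarrow> (\<forall>i. \<exists>g. has_weak_pderiv i (p s) g) \<and>
        (\<exists>u' B'. has_L2_time_deriv u u' s \<and> has_L2_time_deriv B B' s \<and>
           (AE x in lborel. u' x - \<nu> *\<^sub>R laplacian (u s) x + advect (u s) (u s) x
                - cross3 (curl (B s) x) (B s x) + gradient (p s) x = 0) \<and>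
           (AE x in lborel. B' x - \<eta> *\<^sub>R laplacian (B s) x + advect (u s) (B s) x - advect (B s) (u s) x
                + curl (\<lambda>y. cross3 (curl (B s) y) (B s y)) x = 0))"
    using sol unfolding hall_mhd_solution_def by blast
  have deriv: "(E has_real_derivative - 2 * \<nu> * A s - 2 * \<eta> * b s) (at s) \<and>
      (\<exists>d. (X has_real_derivative d) (at s) \<and> d + (\<nu> + \<eta>) / 2 * D s
        \<le> 8 * (\<nu> - \<eta>)\<^sup>2 / (\<nu> + \<eta>) * b s + 5308416 * (A s)\<^sup>2 * X s / (\<nu> + \<eta>)^3)"
    if s: "0 < s" "s < t" for s
  proof -
    \<comment> \<open>An open interval that avoids time 0, where the equations are not
      imposed.\<close>
    have O: "open {0<..<t}" "s \<in> {0<..<t}" "{0<..<t} \<subseteq> ?I" using s sub by auto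
    have sI: "s \<in> ?I" "s \<in> ?I - {0}" using O s by auto
    obtain u' B' where d: "has_L2_time_deriv u u' s" "has_L2_time_deriv B B' s"
      and eqs: "AE x in lborel. u' x - \<nu> *\<^sub>R laplacian (u s) x + advect (u s) (u s) x
                - cross3 (curl (B s) x) (B s x) + gradient (p s) x = 0"
        "AE x in lborel. B' x - \<eta> *\<^sub>R laplacian (B s) x + advect (u s) (B s) x - advect (B s) (u s) x
                + curl (\<lambda>y. cross3 (curl (B s) y) (B s y)) x = 0"
      using p[OF sI(2)] by blast
    interpret inst: hall_mhd_instant \<nu> \<eta> "u s" "B s" u' B' "p s"
    proof
      show "\<exists>g. has_weak_pderiv i (p s) g" for i using p[OF sI(2)] by blast
      show "L2 u'" "L2 B'" using d by (auto simp: has_L2_time_deriv_def)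
    qed (use Hu HB div sI eqs in blast)+
    have iW: "inst.W = W s" by (rule ext) (simp add: inst.W_def W_def)
    have "(E has_real_derivative 2 * ip u' (u s) + 2 * ip B' (B s)) (at s)"
      unfolding E_def[abs_def] by (intro DERIV_add has_derivative_norm_sq[OF O] Lu LB d)
    moreover have "2 * ip u' (u s) + 2 * ip B' (B s) = - 2 * \<nu> * A s - 2 * \<eta> * b s"
      using inst.energy_identity by (simp add: A_def b_def)
    moreover have "(X has_real_derivative 2 * (ip B' (W s) + ip u' (curl (W s)))) (at s)"
      unfolding X_def[abs_def] W_def[abs_def]
      by (rule has_derivative_norm_sq_of_curl[OF O LB d(2) Lu d(1) H1(1) HW[unfolded W_def[abs_def]] LW[unfolded W_def[abs_def]] LcW[unfolded W_def[abs_def]]])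
    moreover have "2 * (ip B' (W s) + ip u' (curl (W s))) + (\<nu> + \<eta>) / 2 * D s
        \<le> 8 * (\<nu> - \<eta>)\<^sup>2 / (\<nu> + \<eta>) * b s + 5308416 * (A s)\<^sup>2 * X s / (\<nu> + \<eta>)^3"
      using inst.vorticity_inequality[OF nu eta close] unfolding iW D_def b_def A_def X_def
      by (simp flip: power_mult)
    ultimately show ?thesis by auto
  qed
  have zero: "0 \<in> ?I" using sub t0 by auto
  then have m0: "u 0 \<in> borel_measurable borel" "B 0 \<in> borel_measurable borel"
    using Hk_measurable[OF Hu] Hk_measurable[OF HB] by blast+
  have ae: "AE x in lborel. u 0 x = u\<^sub>0 x" "AE x in lborel. B 0 x = B\<^sub>0 x"
    using sol unfolding hall_mhd_solution_def by blast+
  \<comment> \<open>The initial data agree with the solution at time 0 only almost everywhere, yet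
    the curls are equal as functions, by \<open>wpderiv_cong_eq\<close>.\<close>
  have "curl (u 0) = curl u\<^sub>0"
    unfolding curl_def[abs_def] wpderiv_cong_eq[OF m0(1) Hk_measurable[OF u0] ae(1)] ..
  moreover have "curl (u 0) \<in> borel_measurable borel"
    using L2_contD(1)[OF L2_cont_curl[OF Ldu] zero] by (rule L2_measurable)
  ultimately have X0: "(L2_norm (\<lambda>x. B\<^sub>0 x + curl u\<^sub>0 x))\<^sup>2 = X 0"
    unfolding X_def W_def[abs_def] using m0 Hk_measurable[OF B0] ae(2)
    by (subst L2_norm_cong_AE[of _ "\<lambda>x. B 0 x + curl (u 0) x"]) (auto elim!: eventually_mono)
  have E0: "energy u\<^sub>0 B\<^sub>0 = E 0"
    unfolding energy_def E_def
    using L2_norm_cong_AE[OF m0(1) Hk_measurable[OF u0] ae(1)] L2_norm_cong_AE[OF m0(2) Hk_measurable[OF B0] ae(2)] by simp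
  have "X t + (\<nu> + \<eta>) / 2 * integral {0..t} D \<le> hall_C0 10 20000000 \<nu> \<eta> u\<^sub>0 B\<^sub>0"
  \<comment> \<open>The fact \<open>deriv\<close> gives the derivative of X existentially at each
    time; the function \<open>deriv X\<close> collects these values.\<close>
  proof (rule energy_bootstrap[OF t0 nu eta close cont(1) _ cont(2) _ cont(3) _ cont(4) _ cont(5), where X'="deriv X"])
    show "0 \<le> X s" "0 \<le> D s" "0 \<le> A s" "0 \<le> b s" "0 \<le> E s" for s
      by (simp_all add: X_def D_def A_def b_def E_def)
    fix s assume s: "0 < s" "s < t"
    show "(E has_real_derivative - 2 * \<nu> * A s - 2 * \<eta> * b s) (at s)" using deriv[OF s] by blast
    obtain d where d: "(X has_real_derivative d) (at s)" "d + (\<nu> + \<eta>) / 2 * D s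
        \<le> 8 * (\<nu> - \<eta>)\<^sup>2 / (\<nu> + \<eta>) * b s + 5308416 * (A s)\<^sup>2 * X s / (\<nu> + \<eta>)^3"
      using deriv[OF s] by blast
    have "deriv X s = d" by (rule DERIV_imp_deriv[OF d(1)])
    with d show "(X has_real_derivative deriv X s) (at s)"
      "deriv X s + (\<nu> + \<eta>) / 2 * D s \<le> 8 * (\<nu> - \<eta>)\<^sup>2 / (\<nu> + \<eta>) * b s + 5308416 * (A s)\<^sup>2 * X s / (\<nu> + \<eta>)^3"
      by simp_all
  next
    fix s assume "s \<in> {0..t}"
    then have s: "s \<in> ?I" using sub by blast
    have "A s \<le> 2 * (X s + (L2_norm (B s))\<^sup>2)"
      unfolding A_def X_def W_def[abs_def] by (rule grad_velocity_le[OF H1(3)[OF s] Hk_L2[OF HB[OF s]] div(1)[OF s]])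
    also have "\<dots> \<le> 2 * (X s + E s)" by (simp add: E_def)
    finally show "A s \<le> 2 * (X s + E s)" .
  next
    show "hall_C0 10 20000000 \<nu> \<eta> u\<^sub>0 B\<^sub>0 = (X 0 + 10 * E 0 * ((\<nu> - \<eta>)\<^sup>2 / (\<nu> + \<eta>)\<^sup>2)) * exp (20000000 * (E 0 + (E 0)\<^sup>2) / (\<nu> + \<eta>)^4)"
      unfolding hall_C0_def X0 E0 ..
  qed (rule small)
  then show "(L2_norm (\<lambda>x. B t x + curl (u t) x))\<^sup>2
      + (\<nu> + \<eta>) / 2 * integral {0..t} (\<lambda>s. (grad_L2_norm (\<lambda>x. B s x + curl (u s) x))\<^sup>2) \<le> hall_C0 10 20000000 \<nu> \<eta> u\<^sub>0 B\<^sub>0"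
    unfolding X_def D_def[abs_def] W_def[abs_def] .
  show "continuous_on {0..t} (\<lambda>s. (grad_L2_norm (\<lambda>x. B s x + curl (u s) x))\<^sup>2)"
    using cont(2) unfolding D_def[abs_def] W_def[abs_def] .
qed

text \<open>Links the gauge integral of the differential inequality to the extended nonnegative
  integral of the final estimate, in which a divergent integral would be infinite and not default to
  0.\<close>

lemma nn_integral_Icc_continuous:
  fixes h :: "real \<Rightarrow> real"
  assumes h: "continuous_on {0..t} h" and nn: "\<And>s. 0 \<le> h s"
  shows "(\<integral>\<^sup>+ s\<in>{0..t}. ennreal (h s) \<partial>lborel) = ennreal (integral {0..t} h)"
proof -
  have i: "set_integrable lborel {0..t} h" by (rule borel_integrable_atLeastAtMost') (rule h)
  have "(\<integral>\<^sup>+ s\<in>{0..t}. ennreal (h s) \<partial>lborel) = (\<integral>\<^sup>+ s. ennreal (indicator {0..t} s *\<^sub>R h s) \<partial>lborel)"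
    by (intro nn_integral_cong) (simp add: indicator_def)
  also have "\<dots> = ennreal (\<integral>s. indicator {0..t} s *\<^sub>R h s \<partial>lborel)"
    using i nn unfolding set_integrable_def by (intro nn_integral_eq_integral) auto
  also have "(\<integral>s. indicator {0..t} s *\<^sub>R h s \<partial>lborel) = integral {0..t} h"
    using set_borel_integral_eq_integral(2)[OF i] by (simp add: set_lebesgue_integral_def)
  finally show ?thesis .
qed

text \<open>The supremum is that of |W(t)|^2 plus the dissipation accumulated up to the same t,
  which is what the Gronwall argument controls. It bounds the supremum of |W|^2 and, as t tends to
  T, the whole dissipation integral, each separately by C_0.\<close>

theorem corollary1p1:
  shows "\<exists>C\<^sub>1 > 0. \<exists>C\<^sub>2 > 0.
    \<forall>(\<nu>::real) (\<eta>::real) (u\<^sub>0 :: real^3 \<Rightarrow> real^3) (B\<^sub>0 :: real^3 \<Rightarrow> real^3)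
      (T :: ereal) (u :: real \<Rightarrow> real^3 \<Rightarrow> real^3) (B :: real \<Rightarrow> real^3 \<Rightarrow> real^3).
      \<nu> > 0 \<longrightarrow> \<eta> > 0 \<longrightarrow> \<bar>\<nu> - \<eta>\<bar> / (\<nu> + \<eta>) \<le> 1 / 8 \<longrightarrow>
      Hk 3 u\<^sub>0 \<longrightarrow> Hk 3 B\<^sub>0 \<longrightarrow>
      (AE x in lborel. divergence u\<^sub>0 x = 0) \<longrightarrow> (AE x in lborel. divergence B\<^sub>0 x = 0) \<longrightarrow>
      maximal_hall_mhd_solution \<nu> \<eta> u\<^sub>0 B\<^sub>0 T u B \<longrightarrow>
      hall_C0 C\<^sub>1 C\<^sub>2 \<nu> \<eta> u\<^sub>0 B\<^sub>0 < 1 \<longrightarrow>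
      (SUP t\<in>time_interval T.
          ennreal ((L2_norm (\<lambda>x. B t x + curl (u t) x))\<^sup>2)
          + ennreal ((\<nu> + \<eta>) / 2)
            * (\<integral>\<^sup>+ s\<in>{0..t}. ennreal ((grad_L2_norm (\<lambda>x. B s x + curl (u s) x))\<^sup>2) \<partial>lborel))
      \<le> ennreal (hall_C0 C\<^sub>1 C\<^sub>2 \<nu> \<eta> u\<^sub>0 B\<^sub>0)"
\<comment> \<open>The witnesses are the numerical constants accumulated in
  \<open>energy_bootstrap\<close>.\<close>
proof (rule exI[of _ "10 :: real"], rule conjI, simp, rule exI[of _ "20000000 :: real"], intro conjI allI impI SUP_least)
  fix \<nu> \<eta> :: real and u\<^sub>0 B\<^sub>0 :: "real^3 \<Rightarrow> real^3" and T :: ereal and u B :: "real \<Rightarrow> real^3 \<Rightarrow> real^3" and t :: real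
  assume pos: "\<nu> > 0" "\<eta> > 0" and close: "\<bar>\<nu> - \<eta>\<bar> / (\<nu> + \<eta>) \<le> 1 / 8" and H: "Hk 3 u\<^sub>0" "Hk 3 B\<^sub>0"
    and sol: "maximal_hall_mhd_solution \<nu> \<eta> u\<^sub>0 B\<^sub>0 T u B" and small: "hall_C0 10 20000000 \<nu> \<eta> u\<^sub>0 B\<^sub>0 < 1"
    and t: "t \<in> time_interval T"
  have "hall_mhd_solution \<nu> \<eta> u\<^sub>0 B\<^sub>0 T u B" using sol by (simp add: maximal_hall_mhd_solution_def)
  note bound = hall_mhd_vorticity_bound[OF pos close H this small t]
  have nn: "0 \<le> integral {0..t} (\<lambda>s. (grad_L2_norm (\<lambda>x. B s x + curl (u s) x))\<^sup>2)"
    by (intro Henstock_Kurzweil_Integration.integral_nonneg integrable_continuous_interval bound(1)) simp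
  have m: "ennreal ((\<nu> + \<eta>) / 2) * ennreal (integral {0..t} (\<lambda>s. (grad_L2_norm (\<lambda>x. B s x + curl (u s) x))\<^sup>2))
      = ennreal ((\<nu> + \<eta>) / 2 * integral {0..t} (\<lambda>s. (grad_L2_norm (\<lambda>x. B s x + curl (u s) x))\<^sup>2))"
    by (rule ennreal_mult[symmetric]) (use pos nn in simp_all)
  have a: "ennreal r + ennreal ((\<nu> + \<eta>) / 2 * integral {0..t} (\<lambda>s. (grad_L2_norm (\<lambda>x. B s x + curl (u s) x))\<^sup>2))
      = ennreal (r + (\<nu> + \<eta>) / 2 * integral {0..t} (\<lambda>s. (grad_L2_norm (\<lambda>x. B s x + curl (u s) x))\<^sup>2))" if "r \<ge> 0" for r
    by (rule ennreal_plus[symmetric]) (use that pos nn in simp_all)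
  show "ennreal ((L2_norm (\<lambda>x. B t x + curl (u t) x))\<^sup>2)
          + ennreal ((\<nu> + \<eta>) / 2)
            * (\<integral>\<^sup>+ s\<in>{0..t}. ennreal ((grad_L2_norm (\<lambda>x. B s x + curl (u s) x))\<^sup>2) \<partial>lborel)
      \<le> ennreal (hall_C0 10 20000000 \<nu> \<eta> u\<^sub>0 B\<^sub>0)"
    unfolding nn_integral_Icc_continuous[OF bound(1) zero_le_power2] m a[OF zero_le_power2]
    by (rule ennreal_leI[OF bound(2)])
qed simp_all

end
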